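(* Let $X_1,Y_1\in\{H(\infty,1),H^1,D^1_0,HL(1)\}$. For each radial weight $\nu$ such that $Q:L^1_{[0,1)}\to Y_1$ is bounded, where $Q\in\{H_\nu,\widetilde{H_\nu}\}$, there is a radial weight $\omega$ such that $$\widehat{\omega}(t)\asymp\widehat{\nu}(t),\quad t\in[0,1),$$ $\omega\in L^\infty_{[0,r_0]}$ for any $r_0\in(0,1)$, $T:X_1\to Y_1$ is bounded, and $T:L^1_{[0,1)}\to Y_1$ is not bounded, where $T\in\{H_\omega,\widetilde{H_\omega}\}$.
   Context: $\mathbb{D}$ is the open unit disc of $\mathbb{C}$, $\mathcal{H}(\mathbb{D})$ the space of analytic functions on $\mathbb{D}$, $dA=\frac{dx\,dy}{\pi}$. $L^1_{[0,1)}$ is the Lebesgue space of measurable functions on $[0,1)$ with $\|f\|=\int_0^1|f(t)|\,dt<\infty$; $L^\infty_{[0,r_0]}$ is the space of essentially bounded functions on $[0,r_0]$. $a\asymp b$ means $C^{-1}a\le b\le Ca$ for a constant $C>0$ (here independent of $t$). Radial weights: a radial weight is a nonnegative $\omega\in L^1([0,1))$, extended to $\mathbb{D}$ by $\omega(z)=\omega(|z|)$; standing assumption: $\widehat{\omega}(r)=\int_r^1\omega(s)\,ds>0$ for all $0\le r<1$. Moments: $\omega_x=\int_0^1 r^x\omega(r)\,dr$, $x\ge0$. Operators (for any radial weight $\omega$): $B^\omega_z(\zeta)=\sum_{n\ge0}\frac{(\overline{z}\zeta)^n}{2\omega_{2n+1}}$ is the reproducing kernel of the Bergman space $A^2_\omega=\{f\in\mathcal{H}(\mathbb{D}):\int_{\mathbb{D}}|f|^2\omega\,dA<\infty\}$,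 and $$H_\omega(f)(z)=\int_0^1 f(t)\left(\frac1z\int_0^zB^\omega_t(\zeta)\,d\zeta\right)\omega(t)\,dt,\qquad \widetilde{H_\omega}(f)(z)=\int_0^1|f(t)|\left(\frac1z\int_0^zB^\omega_t(\zeta)\,d\zeta\right)\omega(t)\,dt.$$ $T:X\to Y$ is bounded if $T(f)$ is well defined and belongs to $Y$ for every $f\in X$, and $\sup_{\|f\|_X\le1}\|T(f)\|_Y<\infty$. Spaces (of $f(z)=\sum_{n\ge 0}\widehat f(n)z^n\in\mathcal{H}(\mathbb{D})$ with finite norm): $H^1$: $\|f\|_{H^1}=\sup_{0<r<1}\frac1{2\pi}\int_0^{2\pi}|f(re^{i\theta})|d\theta$; $D^1_0$: $\|f\|=|f(0)|+\int_{\mathbb{D}}|f'(z)|\,dA(z)$; $HL(1)$: $\|f\|=\sum_{n\ge0}|\widehat f(n)|(n+1)^{-1}$; $H(\infty,1)$: $\|f\|=\int_0^1M_\infty(r,f)\,dr$ with $M_\infty(r,f)=\max_\theta|f(re^{i\theta})|$. *)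

theory Defs
  imports "HOL-Complex_Analysis.Complex_Analysis"
begin

section \<open>Radial weights\<close>

definition weight_hat :: "(real \<Rightarrow> real) \<Rightarrow> real \<Rightarrow> real" where
  "weight_hat \<omega> r = (LINT s:{r..<1}|lebesgue. \<omega> s)"

definition radial_weight :: "(real \<Rightarrow> real) \<Rightarrow> bool" where
  "radial_weight \<omega> \<longleftrightarrow>
     set_integrable lebesgue {0..<1} \<omega> \<and>
     (\<forall>r\<in>{0..<1}. 0 \<le> \<omega> r) \<and>
     (\<forall>r\<in>{0..<1}. 0 < weight_hat \<omega> r)"

definition weight_moment :: "(real \<Rightarrow> real) \<Rightarrow> real \<Rightarrow> real" where
  "weight_moment \<omega> x = (LINT r:{0..<1}|lebesgue. r powr x * \<omega> r)"

definition ess_bounded_on :: "real set \<Rightarrow> (real \<Rightarrow> real) \<Rightarrow> bool" where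
  "ess_bounded_on S \<omega> \<longleftrightarrow>
     set_borel_measurable lebesgue S \<omega> \<and>
     (\<exists>M. AE t in lebesgue. t \<in> S \<longrightarrow> \<bar>\<omega> t\<bar> \<le> M)"

definition comparable_on :: "real set \<Rightarrow> (real \<Rightarrow> real) \<Rightarrow> (real \<Rightarrow> real) \<Rightarrow> bool" where
  "comparable_on S a b \<longleftrightarrow> (\<exists>C>0. \<forall>t\<in>S. inverse C * a t \<le> b t \<and> b t \<le> C * a t)"

section \<open>Hilbert-type operators\<close>

definition bergman_kernel :: "(real \<Rightarrow> real) \<Rightarrow> complex \<Rightarrow> complex \<Rightarrow> complex" where
  "bergman_kernel \<omega> z \<zeta> =
     (\<Sum>n. (cnj z * \<zeta>) ^ n / complex_of_real (2 * weight_moment \<omega> (real (2 * n + 1))))"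

text \<open>
  The mean value \<open>(1/z) \<integral>\<^sub>0\<^sup>z B\<^sub>t(\<zeta>) d\<zeta>\<close> has a removable singularity at \<open>z = 0\<close>,
  where its analytic extension takes the value \<open>B\<^sub>t(0)\<close>.
\<close>
definition hilbert_kernel :: "(real \<Rightarrow> real) \<Rightarrow> real \<Rightarrow> complex \<Rightarrow> complex" where
  "hilbert_kernel \<omega> t z =
     (if z = 0 then bergman_kernel \<omega> (of_real t) 0
      else (1 / z) * contour_integral (linepath 0 z) (bergman_kernel \<omega> (of_real t)))"

text \<open>
  The operators are partial: the value is \<^term>\<open>None\<close> unless the defining Lebesgue
  integral converges absolutely at every point of the unit disc.
\<close>
definition hilbert_op ::
    "(real \<Rightarrow> real) \<Rightarrow> (real \<Rightarrow> complex) \<Rightarrow> (complex \<Rightarrow> complex) option" where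
  "hilbert_op \<omega> f =
     (if \<forall>z\<in>ball 0 1.
           set_integrable lebesgue {0..<1} (\<lambda>t. f t * hilbert_kernel \<omega> t z * of_real (\<omega> t))
      then Some (\<lambda>z. LINT t:{0..<1}|lebesgue. f t * hilbert_kernel \<omega> t z * of_real (\<omega> t))
      else None)"

definition hilbert_abs_op ::
    "(real \<Rightarrow> real) \<Rightarrow> (real \<Rightarrow> complex) \<Rightarrow> (complex \<Rightarrow> complex) option" where
  "hilbert_abs_op \<omega> f = hilbert_op \<omega> (\<lambda>t. of_real (cmod (f t)))"

section \<open>Function spaces\<close>

text \<open>
  A space is its carrier together with its norm. Norms take extended values, so that they
  are meaningful before finiteness is known.
\<close>
type_synonym 'f nspace = "'f set \<times> ('f \<Rightarrow> ennreal)"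

definition L1_norm :: "(real \<Rightarrow> complex) \<Rightarrow> ennreal" where
  "L1_norm f = (\<integral>\<^sup>+t\<in>{0..<1}. ennreal (cmod (f t)) \<partial>lebesgue)"

definition L1_space :: "(real \<Rightarrow> complex) nspace" where
  "L1_space = ({f. set_borel_measurable lebesgue {0..<1} f \<and> L1_norm f < \<infinity>}, L1_norm)"

text \<open>
  Analytic functions on the disc are represented by total functions; their values outside
  the disc are arbitrary and irrelevant.
\<close>
definition analytic_space :: "((complex \<Rightarrow> complex) \<Rightarrow> ennreal) \<Rightarrow> (complex \<Rightarrow> complex) nspace" where
  "analytic_space N = ({f. f holomorphic_on ball 0 1 \<and> N f < \<infinity>}, N)"

definition M_inf :: "real \<Rightarrow> (complex \<Rightarrow> complex) \<Rightarrow> ennreal" where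
  "M_inf r f = (SUP \<theta>. ennreal (cmod (f (of_real r * cis \<theta>))))"

definition H_inf_1 :: "(complex \<Rightarrow> complex) nspace" where
  "H_inf_1 = analytic_space (\<lambda>f. \<integral>\<^sup>+r\<in>{0..<1}. M_inf r f \<partial>lborel)"

definition Hardy_1 :: "(complex \<Rightarrow> complex) nspace" where
  "Hardy_1 = analytic_space (\<lambda>f.
     SUP r\<in>{0<..<1}. ennreal (1 / (2 * pi)) *
       (\<integral>\<^sup>+\<theta>\<in>{0..2 * pi}. ennreal (cmod (f (of_real r * cis \<theta>))) \<partial>lborel))"

text \<open>The factor \<open>1/\<pi>\<close> is the normalization of area measure on the disc.\<close>
definition Dirichlet_1 :: "(complex \<Rightarrow> complex) nspace" where
  "Dirichlet_1 = analytic_space (\<lambda>f.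
     ennreal (cmod (f 0)) +
     ennreal (1 / pi) * (\<integral>\<^sup>+z\<in>ball 0 1. ennreal (cmod (deriv f z)) \<partial>lborel))"

definition taylor_coeff :: "(complex \<Rightarrow> complex) \<Rightarrow> nat \<Rightarrow> complex" where
  "taylor_coeff f n = (deriv ^^ n) f 0 / fact n"

definition Hardy_Littlewood_1 :: "(complex \<Rightarrow> complex) nspace" where
  "Hardy_Littlewood_1 = analytic_space (\<lambda>f. \<Sum>n. ennreal (cmod (taylor_coeff f n) / real (n + 1)))"

definition bounded_op :: "'f nspace \<Rightarrow> 'g nspace \<Rightarrow> ('f \<Rightarrow> 'g option) \<Rightarrow> bool" where
  "bounded_op X Y T \<longleftrightarrow>
     (\<forall>f\<in>fst X. \<exists>g\<in>fst Y. T f = Some g) \<and>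
     (SUP f\<in>{f \<in> fst X. snd X f \<le> 1}. snd Y (the (T f))) < \<infinity>"

definition radius_restrict :: "(complex \<Rightarrow> complex) \<Rightarrow> real \<Rightarrow> complex" where
  "radius_restrict f = (\<lambda>t. f (of_real t))"

end

theory Submission
  imports Defs
begin

text \<open>
  The weight \<open>\<omega>\<close> is \<open>\<nu>\<close> plus a sum \<open>s\<close> of spikes of height \<open>k\<close> on intervals that tend to \<open>1\<close>. Evaluation at
  the origin is bounded on each of the four target spaces and \<open>(H\<^sub>\<omega> f)(0)\<close> is a multiple of
  \<open>\<integral> f \<omega>\<close>, so boundedness on \<open>L\<^sup>1\<close> forces the weight to be essentially bounded: \<open>\<nu>\<close> is, and
  \<open>\<omega>\<close> is not. On the other hand the spikes may be chosen as thin as one likes. Since the moments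
  of \<open>\<nu>\<close> decay subgeometrically, this makes \<open>H\<^sub>\<omega> f - H\<^sub>\<nu> f\<close> a power series \<open>\<Sum> d\<^sub>n z\<^sup>n\<close> with
  \<open>\<Sum> (n + 1) |d\<^sub>n| \<le> C\<close>, uniformly over all \<open>f\<close> in the unit ball of \<open>L\<^sup>1\<close> that satisfy
  \<open>|f(t)| \<le> C (1 - t)\<^sup>-\<^sup>2\<close>. Radial restrictions of functions in each of the four
  source spaces are of this kind.
\<close>

subsection \<open>Moments and kernels\<close>

text \<open>Adding \<open>s\<close> changes the operator twice: the integral of \<open>f\<close>
  gains a part against \<open>s\<close>, and every moment in the kernel grows. An L^1 bound on
  \<open>f\<close> cannot control the first change, because \<open>s\<close> is unbounded; the
  growth bound can. The second change involves a difference of reciprocals of moments, hence their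
  squares in a denominator. Both are governed by the integrals of
  \<open>s(t) t^n / (1 - t)^2\<close> divided by the squared moments of \<open>\<nu>\<close>. The
  spikes are chosen after \<open>\<nu>\<close>, so the sum over \<open>n\<close> can be made as
  small as desired as soon as it converges for each fixed \<open>t < 1\<close>; this is where
  subgeometric decay enters. Essential boundedness of \<open>\<nu>\<close> is used once more there,
  to bound the integrals of \<open>t^n f \<nu>\<close>. The modulus operator is not linear. A
  hypothesis about it is first converted into one about \<open>hilbert_op\<close>, by splitting
  \<open>f\<close> into nonnegative parts. The sixteen pairs of spaces are handled at once through
  \<open>admissible_norm\<close>: growth and L^1 bounds serve the source; triangle inequality,
  series bound and growth at the origin serve the target.\<close>

abbreviation odd_moment :: "(real \<Rightarrow> real) \<Rightarrow> nat \<Rightarrow> real" where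
  "odd_moment \<omega> n \<equiv> weight_moment \<omega> (real (2 * n + 1))"

text \<open>The Taylor coefficients of \<open>hilbert_kernel\<close> in \<open>z\<close>, stripped
  of \<open>t ^ n\<close>: integrating the Bergman series termwise produces the factor
  \<open>n + 1\<close> in the denominator.\<close>

definition kernel_coeff :: "(real \<Rightarrow> real) \<Rightarrow> nat \<Rightarrow> real" where
  "kernel_coeff \<omega> n = 1 / (2 * real (n + 1) * odd_moment \<omega> n)"

text \<open>Mostly used with \<open>g t = t ^ n\<close>; \<open>scaleR\<close> lets the same lemma
  serve real weights and complex integrands.\<close>

lemma set_integrable_bounded_scaleR:
  fixes \<phi> :: "real \<Rightarrow> 'a::{banach,second_countable_topology}"
  assumes "set_integrable lebesgue S \<phi>" "g \<in> borel_measurable borel"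
    and "\<And>t. t \<in> S \<Longrightarrow> \<bar>g t\<bar> \<le> B"
  shows "set_integrable lebesgue S (\<lambda>t. g t *\<^sub>R \<phi> t)"
  unfolding set_integrable_def
proof (rule Bochner_Integration.integrable_bound)
  have \<phi>: "integrable lebesgue (\<lambda>t. indicator S t *\<^sub>R \<phi> t)"
    using assms(1) by (simp add: set_integrable_def)
  show "integrable lebesgue (\<lambda>t. B *\<^sub>R (indicator S t *\<^sub>R \<phi> t))"
    using \<phi> by (rule integrable_scaleR_right)
  have "g \<in> borel_measurable lebesgue"
    using assms(2) by (intro measurable_completion) simp
  then have "(\<lambda>t. g t *\<^sub>R (indicator S t *\<^sub>R \<phi> t)) \<in> borel_measurable lebesgue"
    using borel_measurable_integrable[OF \<phi>] by (rule borel_measurable_scaleR)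
  then show "(\<lambda>t. indicator S t *\<^sub>R g t *\<^sub>R \<phi> t) \<in> borel_measurable lebesgue"
    by (simp add: scaleR_scaleR mult.commute)
  show "AE t in lebesgue. norm (indicator S t *\<^sub>R g t *\<^sub>R \<phi> t) \<le> norm (B *\<^sub>R indicator S t *\<^sub>R \<phi> t)"
  proof (intro AE_I2)
    fix t :: real
    have "\<bar>g t\<bar> * norm (\<phi> t) \<le> \<bar>B\<bar> * norm (\<phi> t)" if "t \<in> S"
      using assms(3)[OF that] by (intro mult_right_mono) auto
    then show "norm (indicator S t *\<^sub>R g t *\<^sub>R \<phi> t) \<le> norm (B *\<^sub>R indicator S t *\<^sub>R \<phi> t)"
      by (cases "t \<in> S") auto
  qed
qed

lemma set_lebesgue_integral_norm_bound:
  fixes \<phi> :: "real \<Rightarrow> 'a::{banach,second_countable_topology}" and g :: "real \<Rightarrow> real"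
  assumes "set_integrable lebesgue S \<phi>" "set_integrable lebesgue S g"
    and "\<And>t. t \<in> S \<Longrightarrow> norm (\<phi> t) \<le> g t"
  shows "norm (LINT t:S|lebesgue. \<phi> t) \<le> (LINT t:S|lebesgue. g t)"
  unfolding set_lebesgue_integral_def
  by (rule Bochner_Integration.integral_norm_bound_integral)
    (use assms in \<open>auto simp: set_integrable_def indicator_def\<close>)

lemma odd_moment_eq:
  "odd_moment \<omega> n = (LINT r:{0..<1}|lebesgue. r ^ (2 * n + 1) * \<omega> r)"
  unfolding weight_moment_def
proof (rule set_lebesgue_integral_cong)
  show "\<forall>r. r \<in> {0..<1} \<longrightarrow> r powr real (2 * n + 1) * \<omega> r = r ^ (2 * n + 1) * \<omega> r"
  proof (intro allI impI)
    fix r :: real assume "r \<in> {0..<1}"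
    then show "r powr real (2 * n + 1) * \<omega> r = r ^ (2 * n + 1) * \<omega> r"
      \<comment> \<open>At \<open>r = 0\<close> both sides vanish: \<open>0 powr x\<close> is 0, and
        the exponent \<open>2 * n + 1\<close> is positive.\<close>
      by (cases "r = 0") (simp_all add: powr_realpow del: of_nat_add of_nat_mult power_Suc power_add of_nat_Suc add_Suc_right)
  qed
qed auto

lemma radial_weight_power_integrable:
  assumes "radial_weight \<omega>"
  shows "set_integrable lebesgue {0..<1} (\<lambda>r. r ^ n * \<omega> r)"
  using set_integrable_bounded_scaleR[of "{0..<1}" \<omega> "\<lambda>r. r ^ n" 1] assms
  by (auto simp: radial_weight_def power_le_one)

text \<open>Only the mass beyond \<open>\<rho>\<close> is kept, and there \<open>r\<close> is at
  least \<open>\<rho>\<close>. Since \<open>weight_hat\<close> is positive at every radius, this is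
  a positive lower bound for each \<open>\<rho>\<close> in \<open>(0, 1)\<close>, however close to
  1.\<close>

lemma power_weight_hat_le_odd_moment:
  assumes \<omega>: "radial_weight \<omega>" and \<rho>: "0 \<le> \<rho>" "\<rho> < 1"
  shows "\<rho> ^ (2 * n + 1) * weight_hat \<omega> \<rho> \<le> odd_moment \<omega> n"
proof -
  have i: "set_integrable lebesgue {0..<1} \<omega>" and nn: "\<And>r. r \<in> {0..<1} \<Longrightarrow> 0 \<le> \<omega> r"
    using \<omega> by (auto simp: radial_weight_def)
  have "\<rho> ^ (2 * n + 1) * weight_hat \<omega> \<rho> = (LINT r:{\<rho>..<1}|lebesgue. \<rho> ^ (2 * n + 1) * \<omega> r)"
    by (simp add: weight_hat_def)
  also have "\<dots> \<le> (LINT r:{\<rho>..<1}|lebesgue. r ^ (2 * n + 1) * \<omega> r)"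
    using \<rho> by (intro set_integral_mono set_integrable_subset[OF radial_weight_power_integrable[OF \<omega>]]
      set_integrable_mult_right set_integrable_subset[OF i] mult_right_mono power_mono nn) auto
  also have "\<dots> \<le> (LINT r:{0..<1}|lebesgue. r ^ (2 * n + 1) * \<omega> r)"
    unfolding set_lebesgue_integral_def
    by (rule integral_mono)
      (use \<rho> nn set_integrable_subset[OF radial_weight_power_integrable[OF \<omega>, of "2 * n + 1"], of "{\<rho>..<1}"]
        radial_weight_power_integrable[OF \<omega>, of "2 * n + 1"] in
        \<open>auto simp: set_integrable_def indicator_def\<close>)
  finally show ?thesis by (simp only: odd_moment_eq)
qed

lemma odd_moment_pos:
  assumes \<omega>: "radial_weight \<omega>"
  shows "0 < odd_moment \<omega> n"
proof -
  have "0 < (1/2) ^ (2 * n + 1) * weight_hat \<omega> (1/2)"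
    using \<omega> by (auto simp: radial_weight_def)
  also have "\<dots> \<le> odd_moment \<omega> n"
    by (rule power_weight_hat_le_odd_moment[OF \<omega>]) auto
  finally show ?thesis .
qed

lemma odd_moment_le:
  assumes \<omega>: "radial_weight \<omega>"
  shows "odd_moment \<omega> n \<le> weight_hat \<omega> 0"
  unfolding odd_moment_eq weight_hat_def
  using \<omega> by (intro set_integral_mono radial_weight_power_integrable mult_left_le_one_le power_le_one zero_le_power)
    (auto simp: radial_weight_def)

lemma kernel_coeff_pos: "radial_weight \<omega> \<Longrightarrow> 0 < kernel_coeff \<omega> n"
  using odd_moment_pos[of \<omega> n] by (simp add: kernel_coeff_def)

text \<open>Moments decay more slowly than any geometric sequence, since \<open>\<omega>\<close> charges every
  neighbourhood of 1.\<close>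

lemma summable_power_div_odd_moment_sq:
  assumes \<omega>: "radial_weight \<omega>" and x: "0 \<le> x" "x < 1"
  shows "summable (\<lambda>n. real (n + 1) * x ^ n / (odd_moment \<omega> n)\<^sup>2)"
proof -
  \<comment> \<open>Here \<open>1 - \<rho> = (1 - x) / 8\<close>, so Bernoulli's inequality gives
    \<open>\<rho> ^ 4 \<ge> (1 + x) / 2 > x\<close>. The fourth power arises from squaring the lower
    bound \<open>\<rho> ^ (2 * n + 1) * H\<close> for the moment.\<close>
  define \<rho> where "\<rho> = (7 + x) / 8"
  have \<rho>: "0 < \<rho>" "\<rho> < 1" using x by (auto simp: \<rho>_def)
  have "x < 1 + real 4 * (\<rho> - 1)" using x by (simp add: \<rho>_def field_simps)
  also have "\<dots> \<le> (1 + (\<rho> - 1)) ^ 4"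
    by (rule Bernoulli_inequality) (use \<rho> in auto)
  finally have x\<rho>: "x < \<rho> ^ 4" by simp
  define q where "q = x / \<rho> ^ 4"
  have q: "0 \<le> q" "q < 1" using x x\<rho> \<rho> by (auto simp: q_def field_simps)
  define H where "H = weight_hat \<omega> \<rho>"
  have H: "0 < H" using \<omega> \<rho> by (simp add: H_def radial_weight_def)
  have "summable (\<lambda>n. (real (Suc n) * q ^ n) * (1 / (\<rho> * H)\<^sup>2))"
    using geometric_deriv_sums[of q] q by (intro summable_mult2) (auto simp: sums_iff)
  then show ?thesis
  proof (rule summable_comparison_test'[where N = 0])
    fix n
    have "(\<rho> ^ (2 * n + 1) * H)\<^sup>2 \<le> (odd_moment \<omega> n)\<^sup>2"
      unfolding H_def using \<rho> H H_def
      by (intro power_mono power_weight_hat_le_odd_moment[OF \<omega>]) auto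
    then have "real (n + 1) * x ^ n / (odd_moment \<omega> n)\<^sup>2 \<le> real (n + 1) * x ^ n / (\<rho> ^ (2 * n + 1) * H)\<^sup>2"
      using \<rho> H x by (intro divide_left_mono mult_nonneg_nonneg mult_pos_pos zero_less_power odd_moment_pos[OF \<omega>]) auto
    also have "(\<rho> ^ (2 * n + 1) * H)\<^sup>2 = (\<rho> ^ 4) ^ n * (\<rho> * H)\<^sup>2"
      by (simp add: power_mult_distrib power_add algebra_simps flip: power_mult)
    also have "real (n + 1) * x ^ n / \<dots> = (real (Suc n) * q ^ n) * (1 / (\<rho> * H)\<^sup>2)"
      by (simp add: q_def power_divide)
    finally show "norm (real (n + 1) * x ^ n / (odd_moment \<omega> n)\<^sup>2) \<le> (real (Suc n) * q ^ n) * (1 / (\<rho> * H)\<^sup>2)"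
      using x by simp
  qed
qed

text \<open>The moments are bounded by \<open>weight_hat \<omega> 0\<close>, so \<open>1 / m\<close>
  is at most a constant multiple of \<open>1 / m\<^sup>2\<close>, and the squared version is a
  majorant.\<close>

lemma summable_power_div_odd_moment:
  assumes \<omega>: "radial_weight \<omega>" and x: "0 \<le> x" "x < 1"
  shows "summable (\<lambda>n. x ^ n / odd_moment \<omega> n)"
proof (rule summable_comparison_test'[where N = 0])
  show "summable (\<lambda>n. weight_hat \<omega> 0 * (real (n + 1) * x ^ n / (odd_moment \<omega> n)\<^sup>2))"
    by (intro summable_mult summable_power_div_odd_moment_sq assms)
  fix n
  have p: "0 < odd_moment \<omega> n" by (rule odd_moment_pos[OF \<omega>])
  have "x ^ n / odd_moment \<omega> n = odd_moment \<omega> n * (x ^ n / (odd_moment \<omega> n)\<^sup>2)"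
    using p by (simp add: power2_eq_square)
  also have "\<dots> \<le> weight_hat \<omega> 0 * (real (n + 1) * x ^ n / (odd_moment \<omega> n)\<^sup>2)"
    using x p odd_moment_le[OF \<omega>, of n]
    by (intro mult_mono divide_right_mono mult_left_le_one_le) (auto simp: mult_le_cancel_right1)
  finally show "norm (x ^ n / odd_moment \<omega> n) \<le> weight_hat \<omega> 0 * (real (n + 1) * x ^ n / (odd_moment \<omega> n)\<^sup>2)"
    using p x by simp
qed

section \<open>Power series of the kernel and of the operators\<close>

lemma summable_kernel_coeff:
  assumes \<omega>: "radial_weight \<omega>" and x: "0 \<le> x" "x < 1"
  shows "summable (\<lambda>n. kernel_coeff \<omega> n * x ^ n)"
proof (rule summable_comparison_test'[where N = 0, OF summable_power_div_odd_moment[OF assms]])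
  fix n
  have p: "0 < odd_moment \<omega> n" by (rule odd_moment_pos[OF \<omega>])
  have "x ^ n / (2 * real (n + 1) * odd_moment \<omega> n) \<le> x ^ n / (1 * odd_moment \<omega> n)"
    using x p by (intro divide_left_mono mult_right_mono mult_pos_pos) auto
  then show "norm (kernel_coeff \<omega> n * x ^ n) \<le> x ^ n / odd_moment \<omega> n"
    using p x by (simp add: kernel_coeff_def)
qed

text \<open>The Bergman kernel is the derivative of the power series with coefficients
  \<open>c\<close>, which are the claimed ones moved up by one place. The contour integral is
  therefore the value of that series at \<open>z\<close>, because \<open>c 0 = 0\<close> makes it
  vanish at the origin, and division by \<open>z\<close> undoes the shift. The origin is a separate
  case, as in \<open>hilbert_kernel\<close>.\<close>

lemma hilbert_kernel_sums:
  assumes \<omega>: "radial_weight \<omega>" and t: "t \<in> {0..<1}" and z: "z \<in> ball 0 1"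
  shows "(\<lambda>n. of_real (kernel_coeff \<omega> n * t ^ n) * z ^ n) sums hilbert_kernel \<omega> t z"
proof -
  define c :: "nat \<Rightarrow> complex" where
    "c n = (if n = 0 then 0 else of_real (kernel_coeff \<omega> (n - 1) * t ^ (n - 1)))" for n
  have c_summable: "summable (\<lambda>n. c (Suc n) * w ^ n)" if "norm w < 1" for w
  proof (rule summable_comparison_test'[where N = 0])
    show "summable (\<lambda>n. kernel_coeff \<omega> n * norm w ^ n)"
      using that by (intro summable_kernel_coeff[OF \<omega>]) auto
    fix n
    have "kernel_coeff \<omega> n * t ^ n * norm w ^ n \<le> kernel_coeff \<omega> n * 1 * norm w ^ n"
      using t kernel_coeff_pos[OF \<omega>, of n]
      by (intro mult_right_mono mult_left_mono power_le_one) auto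
    then show "norm (c (Suc n) * w ^ n) \<le> kernel_coeff \<omega> n * norm w ^ n"
      using t kernel_coeff_pos[OF \<omega>, of n] by (simp add: c_def norm_mult norm_power abs_mult)
  qed
  have c_summable': "summable (\<lambda>n. c n * w ^ n)" if "norm w < 1" for w
  proof -
    have "summable (\<lambda>n. (c (Suc n) * w ^ n) * w)"
      using c_summable[OF that] by (rule summable_mult2)
    then have "summable (\<lambda>n. c (Suc n) * w ^ Suc n)" by (simp only: mult.assoc power_Suc2)
    then show ?thesis by (subst (asm) summable_Suc_iff)
  qed
  have diffs: "diffs c n * w ^ n = (cnj (of_real t) * w) ^ n / of_real (2 * odd_moment \<omega> n)" for n w
    using odd_moment_pos[OF \<omega>, of n]
    by (simp add: diffs_def c_def kernel_coeff_def power_mult_distrib field_simps del: of_nat_Suc)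
  have deriv: "((\<lambda>w. \<Sum>n. c n * w ^ n) has_field_derivative bergman_kernel \<omega> (of_real t) w) (at w)"
    if "norm w < 1" for w
    using termdiffs_strong'[of 1 c w] c_summable' that
    unfolding bergman_kernel_def diffs by simp
  show ?thesis
  proof (cases "z = 0")
    case True
    have "(\<lambda>n. (cnj (of_real t) * (0::complex)) ^ n / of_real (2 * odd_moment \<omega> n)) sums
        (1 / of_real (2 * odd_moment \<omega> 0))"
      using powser_sums_zero[of "\<lambda>n. 1 / complex_of_real (2 * odd_moment \<omega> n)"] by simp
    then have "hilbert_kernel \<omega> t z = of_real (kernel_coeff \<omega> 0)"
      unfolding hilbert_kernel_def bergman_kernel_def using True
      by (simp add: kernel_coeff_def sums_iff)
    then show ?thesis
      using True powser_sums_zero[of "\<lambda>n. complex_of_real (kernel_coeff \<omega> n * t ^ n)"] by simp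
  next
    case False
    have "(bergman_kernel \<omega> (of_real t) has_contour_integral
        (\<Sum>n. c n * pathfinish (linepath 0 z) ^ n) - (\<Sum>n. c n * pathstart (linepath 0 z) ^ n)) (linepath 0 z)"
    proof (rule contour_integral_primitive)
      show "((\<lambda>w. \<Sum>n. c n * w ^ n) has_field_derivative bergman_kernel \<omega> (of_real t) w) (at w within ball 0 1)"
        if "w \<in> ball 0 1" for w
        using deriv[of w] that by (auto intro: has_field_derivative_at_within)
      show "path_image (linepath 0 z) \<subseteq> ball 0 1"
        using z by (simp add: closed_segment_subset)
    qed (rule valid_path_linepath)
    then have "contour_integral (linepath 0 z) (bergman_kernel \<omega> (of_real t)) = (\<Sum>n. c n * z ^ n)"
      using powser_sums_zero[of c] by (simp add: contour_integral_unique sums_iff c_def)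
    also have "\<dots> = (\<Sum>n. c (Suc n) * z ^ Suc n)"
      using suminf_split_head[OF c_summable'[of z]] z by (simp add: c_def)
    also have "\<dots> = z * (\<Sum>n. c (Suc n) * z ^ n)"
      using c_summable[of z] z by (subst suminf_mult[symmetric]) (auto simp: algebra_simps)
    finally have "hilbert_kernel \<omega> t z = (\<Sum>n. c (Suc n) * z ^ n)"
      using False by (simp add: hilbert_kernel_def)
    then show ?thesis
      using summable_sums[OF c_summable[of z]] z by (simp add: c_def)
  qed
qed

text \<open>Since \<open>t ^ n \<le> 1\<close>, the terms are dominated by
  \<open>kernel_coeff \<omega> n * norm z ^ n * norm (\<phi> t)\<close>, which is summable in
  \<open>n\<close> and integrable in \<open>t\<close>. Integrability of \<open>f \<omega>\<close>
  alone thus makes the operator defined at every point of the disc and permits termwise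
  integration.\<close>

lemma hilbert_op_expansion:
  assumes \<omega>: "radial_weight \<omega>"
    and f: "set_integrable lebesgue {0..<1} (\<lambda>t. f t * of_real (\<omega> t))"
  shows "\<exists>h. hilbert_op \<omega> f = Some h \<and>
    (\<forall>z\<in>ball 0 1. (\<lambda>n. of_real (kernel_coeff \<omega> n) *
       (LINT t:{0..<1}|lebesgue. t ^ n *\<^sub>R (f t * of_real (\<omega> t))) * z ^ n) sums h z)"
proof -
  define \<phi> where "\<phi> t = indicator {0..<1} t *\<^sub>R (f t * of_real (\<omega> t))" for t
  have \<phi>: "integrable lebesgue \<phi>" using f by (simp add: set_integrable_def \<phi>_def[abs_def])
  define u where "u z n t = of_real (kernel_coeff \<omega> n) * z ^ n * (t ^ n *\<^sub>R \<phi> t)" for z n t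
  have kp: "0 < kernel_coeff \<omega> n" for n by (rule kernel_coeff_pos[OF \<omega>])
  have \<phi>n: "integrable lebesgue (\<lambda>t. t ^ n *\<^sub>R \<phi> t)" for n
  proof -
    have "set_integrable lebesgue {0..<1} (\<lambda>t. t ^ n *\<^sub>R (f t * of_real (\<omega> t)))"
      by (rule set_integrable_bounded_scaleR[OF f, of _ 1]) (auto simp: power_le_one)
    then show ?thesis
      by (simp add: set_integrable_def \<phi>_def[abs_def] mult.commute)
  qed
  have main: "integrable lebesgue (\<lambda>t. \<Sum>n. u z n t) \<and>
      (\<lambda>n. integral\<^sup>L lebesgue (u z n)) sums (\<integral>t. (\<Sum>n. u z n t) \<partial>lebesgue)"
    if z: "z \<in> ball 0 1" for z
  proof -
    have u_int: "integrable lebesgue (u z n)" for n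
      unfolding u_def[abs_def] using \<phi>n[of n] by (rule integrable_mult_right)
    have bound: "norm (u z n t) \<le> kernel_coeff \<omega> n * norm z ^ n * norm (\<phi> t)" for n t
    proof (cases "t \<in> {0..<1}")
      case True
      then have "kernel_coeff \<omega> n * norm z ^ n * (t ^ n * norm (\<phi> t)) \<le> kernel_coeff \<omega> n * norm z ^ n * (1 * norm (\<phi> t))"
        using kp[of n] by (intro mult_left_mono mult_right_mono power_le_one) auto
      then show ?thesis
        using True kp[of n] by (simp add: u_def norm_mult norm_power abs_mult mult.left_commute)
    qed (simp add: u_def \<phi>_def)
    have S: "summable (\<lambda>n. kernel_coeff \<omega> n * norm z ^ n * C)" for C
      using z by (intro summable_mult2 summable_kernel_coeff[OF \<omega>]) auto
    have s1: "AE t in lebesgue. summable (\<lambda>n. norm (u z n t))"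
      by (intro AE_I2 summable_comparison_test'[OF S, where N = 0]) (use bound in auto)
    have s2: "summable (\<lambda>n. \<integral>t. norm (u z n t) \<partial>lebesgue)"
    proof (rule summable_comparison_test'[OF S, where N = 0])
      fix n
      have "(\<integral>t. norm (u z n t) \<partial>lebesgue) \<le> (\<integral>t. kernel_coeff \<omega> n * norm z ^ n * norm (\<phi> t) \<partial>lebesgue)"
        using u_int \<phi> bound by (intro integral_mono) auto
      then show "norm (\<integral>t. norm (u z n t) \<partial>lebesgue) \<le> kernel_coeff \<omega> n * norm z ^ n * (\<integral>t. norm (\<phi> t) \<partial>lebesgue)"
        by simp
    qed
    show ?thesis using integrable_suminf[OF u_int s1 s2] sums_integral[OF u_int s1 s2] by blast
  qed
  have eq: "indicator {0..<1} t *\<^sub>R (f t * hilbert_kernel \<omega> t z * of_real (\<omega> t)) = (\<Sum>n. u z n t)"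
    if z: "z \<in> ball 0 1" for z t
  proof (cases "t \<in> {0..<1}")
    case True
    have "(\<lambda>n. of_real (kernel_coeff \<omega> n * t ^ n) * z ^ n * \<phi> t) sums (hilbert_kernel \<omega> t z * \<phi> t)"
      by (intro sums_mult2 hilbert_kernel_sums[OF \<omega> True z])
    moreover have "of_real (kernel_coeff \<omega> n * t ^ n) * z ^ n * \<phi> t = u z n t" for n
      by (simp add: u_def scaleR_conv_of_real algebra_simps)
    ultimately show ?thesis
      using True by (simp add: sums_iff \<phi>_def algebra_simps)
  qed (simp add: u_def \<phi>_def)
  have int: "set_integrable lebesgue {0..<1} (\<lambda>t. f t * hilbert_kernel \<omega> t z * of_real (\<omega> t))"
    if "z \<in> ball 0 1" for z
    using main[OF that] by (simp add: set_integrable_def eq[OF that])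
  have coeff: "integral\<^sup>L lebesgue (u z n) = of_real (kernel_coeff \<omega> n) *
       (LINT t:{0..<1}|lebesgue. t ^ n *\<^sub>R (f t * of_real (\<omega> t))) * z ^ n" for z n
  proof -
    have "integral\<^sup>L lebesgue (u z n) = of_real (kernel_coeff \<omega> n) * z ^ n * (\<integral>t. t ^ n *\<^sub>R \<phi> t \<partial>lebesgue)"
      unfolding u_def[abs_def] by (rule integral_mult_right_zero)
    also have "(\<integral>t. t ^ n *\<^sub>R \<phi> t \<partial>lebesgue) = (LINT t:{0..<1}|lebesgue. t ^ n *\<^sub>R (f t * of_real (\<omega> t)))"
      by (simp add: set_lebesgue_integral_def \<phi>_def[abs_def] mult.commute)
    finally show ?thesis by simp
  qed
  have "\<forall>z\<in>ball 0 1. (\<lambda>n. of_real (kernel_coeff \<omega> n) *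
       (LINT t:{0..<1}|lebesgue. t ^ n *\<^sub>R (f t * of_real (\<omega> t))) * z ^ n) sums
       (LINT t:{0..<1}|lebesgue. f t * hilbert_kernel \<omega> t z * of_real (\<omega> t))"
  proof
    fix z :: complex assume z: "z \<in> ball 0 1"
    have "(LINT t:{0..<1}|lebesgue. f t * hilbert_kernel \<omega> t z * of_real (\<omega> t)) = (\<integral>t. (\<Sum>n. u z n t) \<partial>lebesgue)"
      by (simp only: set_lebesgue_integral_def eq[OF z])
    then show "(\<lambda>n. of_real (kernel_coeff \<omega> n) *
       (LINT t:{0..<1}|lebesgue. t ^ n *\<^sub>R (f t * of_real (\<omega> t))) * z ^ n) sums
       (LINT t:{0..<1}|lebesgue. f t * hilbert_kernel \<omega> t z * of_real (\<omega> t))"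
      using main[OF z] by (simp only: coeff)
  qed
  then show ?thesis
    using int by (auto simp: hilbert_op_def)
qed

lemma hilbert_op_SomeD:
  assumes "hilbert_op \<omega> f = Some h" "z \<in> ball 0 1"
  shows "set_integrable lebesgue {0..<1} (\<lambda>t. f t * hilbert_kernel \<omega> t z * of_real (\<omega> t))"
    and "h z = (LINT t:{0..<1}|lebesgue. f t * hilbert_kernel \<omega> t z * of_real (\<omega> t))"
  using assms by (auto simp: hilbert_op_def split: if_splits)

lemma hilbert_kernel_0:
  assumes "radial_weight \<omega>" "t \<in> {0..<1}"
  shows "hilbert_kernel \<omega> t 0 = of_real (kernel_coeff \<omega> 0)"
  using hilbert_kernel_sums[OF assms, of 0]
    powser_sums_zero[of "\<lambda>n. complex_of_real (kernel_coeff \<omega> n * t ^ n)"]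
  by (auto dest: sums_unique2)

text \<open>The kernel at \<open>z = 0\<close> does not depend on \<open>t\<close>. Convergence of
  the defining integral at that single point already returns the integrability of
  \<open>f \<omega>\<close>, which is the converse of \<open>hilbert_op_expansion\<close>.\<close>

lemma hilbert_op_at_0:
  assumes \<omega>: "radial_weight \<omega>" and h: "hilbert_op \<omega> f = Some h"
  shows "set_integrable lebesgue {0..<1} (\<lambda>t. f t * of_real (\<omega> t))"
    and "h 0 = of_real (kernel_coeff \<omega> 0) * (LINT t:{0..<1}|lebesgue. f t * of_real (\<omega> t))"
proof -
  have eq: "f t * hilbert_kernel \<omega> t 0 * of_real (\<omega> t) =
      of_real (kernel_coeff \<omega> 0) * (f t * of_real (\<omega> t))" if "t \<in> {0..<1}" for t
    using hilbert_kernel_0[OF \<omega> that] by simp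
  have "set_integrable lebesgue {0..<1} (\<lambda>t. f t * hilbert_kernel \<omega> t 0 * of_real (\<omega> t))"
    by (rule hilbert_op_SomeD[OF h]) simp
  then have "set_integrable lebesgue {0..<1} (\<lambda>t. of_real (kernel_coeff \<omega> 0) * (f t * of_real (\<omega> t)))"
    by (rule iffD1[OF set_integrable_cong, rotated -1]) (use eq in auto)
  then show "set_integrable lebesgue {0..<1} (\<lambda>t. f t * of_real (\<omega> t))"
    using kernel_coeff_pos[OF \<omega>, of 0] by simp
  have "h 0 = (LINT t:{0..<1}|lebesgue. f t * hilbert_kernel \<omega> t 0 * of_real (\<omega> t))"
    by (rule hilbert_op_SomeD[OF h]) simp
  also have "\<dots> = (LINT t:{0..<1}|lebesgue. of_real (kernel_coeff \<omega> 0) * (f t * of_real (\<omega> t)))"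
    by (rule set_lebesgue_integral_cong) (use eq in auto)
  finally show "h 0 = of_real (kernel_coeff \<omega> 0) * (LINT t:{0..<1}|lebesgue. f t * of_real (\<omega> t))"
    by simp
qed

lemma hilbert_op_holomorphic:
  assumes \<omega>: "radial_weight \<omega>" and h: "hilbert_op \<omega> f = Some h"
  shows "h holomorphic_on ball 0 1"
proof -
  define a where "a n = of_real (kernel_coeff \<omega> n) *
       (LINT t:{0..<1}|lebesgue. t ^ n *\<^sub>R (f t * of_real (\<omega> t)))" for n
  have "(\<lambda>n. a n * (z - 0) ^ n) sums h z" if "z \<in> ball 0 1" for z
    using hilbert_op_expansion[OF \<omega> hilbert_op_at_0(1)[OF assms]] h that by (auto simp: a_def)
  then show ?thesis by (rule power_series_holomorphic)
qed

lemma hilbert_op_linear: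
  assumes \<omega>: "radial_weight \<omega>" and f: "hilbert_op \<omega> f = Some h" and g: "hilbert_op \<omega> g = Some k"
  shows "\<exists>l. hilbert_op \<omega> (\<lambda>t. c * f t + g t) = Some l \<and> (\<forall>z\<in>ball 0 1. l z = c * h z + k z)"
proof -
  have eq: "(c * f t + g t) * hilbert_kernel \<omega> t z * of_real (\<omega> t) =
     c * (f t * hilbert_kernel \<omega> t z * of_real (\<omega> t)) + g t * hilbert_kernel \<omega> t z * of_real (\<omega> t)" for t z
    by (simp add: algebra_simps)
  have 1: "set_integrable lebesgue {0..<1} (\<lambda>t. c * (f t * hilbert_kernel \<omega> t z * of_real (\<omega> t)))"
    if "z \<in> ball 0 1" for z
    by (intro set_integrable_mult_right hilbert_op_SomeD[OF f that])
  have "set_integrable lebesgue {0..<1} (\<lambda>t. (c * f t + g t) * hilbert_kernel \<omega> t z * of_real (\<omega> t))"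
    "(LINT t:{0..<1}|lebesgue. (c * f t + g t) * hilbert_kernel \<omega> t z * of_real (\<omega> t)) = c * h z + k z"
    if z: "z \<in> ball 0 1" for z
    unfolding eq using set_integral_add[OF 1[OF z] hilbert_op_SomeD(1)[OF g z]] hilbert_op_SomeD(2)[OF f z]
      hilbert_op_SomeD(2)[OF g z] by simp_all
  then show ?thesis by (simp add: hilbert_op_def)
qed

subsection \<open>Boundedness on the Lebesgue space\<close>

lemma bounded_opE:
  assumes "bounded_op X Y T"
  obtains M :: real where "0 \<le> M"
    and "\<forall>f\<in>fst X. \<exists>g\<in>fst Y. T f = Some g"
    and "\<forall>f g. f \<in> fst X \<longrightarrow> snd X f \<le> 1 \<longrightarrow> T f = Some g \<longrightarrow> snd Y g \<le> ennreal M"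
proof -
  define s where "s = (SUP f\<in>{f \<in> fst X. snd X f \<le> 1}. snd Y (the (T f)))"
  have s: "s < \<infinity>" using assms by (simp add: bounded_op_def s_def)
  show thesis
  proof
    show "\<forall>f\<in>fst X. \<exists>g\<in>fst Y. T f = Some g"
      using assms by (auto simp: bounded_op_def)
    have "snd Y g \<le> ennreal (enn2real s)" if "f \<in> fst X" "snd X f \<le> 1" "T f = Some g" for f g
    proof -
      have "snd Y (the (T f)) \<le> s" unfolding s_def using that by (intro SUP_upper) auto
      then show ?thesis using \<open>T f = Some g\<close> s by simp
    qed
    then show "\<forall>f g. f \<in> fst X \<longrightarrow> snd X f \<le> 1 \<longrightarrow> T f = Some g \<longrightarrow> snd Y g \<le> ennreal (enn2real s)"
      by blast
  qed simp
qed

lemma bounded_opI: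
  assumes "\<And>f. f \<in> fst X \<Longrightarrow> \<exists>g\<in>fst Y. T f = Some g"
    and "\<And>f g. f \<in> fst X \<Longrightarrow> snd X f \<le> 1 \<Longrightarrow> T f = Some g \<Longrightarrow> snd Y g \<le> M" and "M < \<infinity>"
  shows "bounded_op X Y T"
proof -
  have "(SUP f\<in>{f \<in> fst X. snd X f \<le> 1}. snd Y (the (T f))) \<le> M"
    using assms(1,2) by (intro SUP_least) fastforce
  then show ?thesis using assms by (auto simp: bounded_op_def)
qed

lemma L1_norm_mono:
  "(\<And>t. t \<in> {0..<1} \<Longrightarrow> cmod (f t) \<le> cmod (g t)) \<Longrightarrow> L1_norm f \<le> L1_norm g"
  unfolding L1_norm_def by (intro nn_integral_mono) (auto simp: indicator_def ennreal_leI)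

lemma L1_norm_scale:
  assumes "set_borel_measurable lebesgue {0..<1} f"
  shows "L1_norm (\<lambda>t. c * f t) = ennreal (cmod c) * L1_norm f"
proof -
  have [measurable]: "(\<lambda>t. indicator {0..<1} t *\<^sub>R f t) \<in> borel_measurable lebesgue"
    using assms by (simp add: set_borel_measurable_def)
  have eq: "ennreal (cmod (c * f t)) * indicator {0..<1} t =
      ennreal (cmod c) * ennreal (cmod (indicator {0..<1} t *\<^sub>R f t))"
    "ennreal (cmod (f t)) * indicator {0..<1} t = ennreal (cmod (indicator {0..<1} t *\<^sub>R f t))" for t
    by (auto simp: indicator_def norm_mult ennreal_mult)
  show ?thesis
    unfolding L1_norm_def eq by (rule nn_integral_cmult) measurable
qed

text \<open>Dividing by a positive upper bound \<open>c\<close> instead of the norm itself avoids a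
  separate case for functions of norm zero.\<close>

lemma L1_unit_ball_scale:
  assumes f: "set_borel_measurable lebesgue {0..<1} f" "L1_norm f \<le> ennreal c" and c: "0 < c"
  shows "L1_norm (\<lambda>t. of_real (1 / c) * f t) \<le> 1"
    and "(\<lambda>t. of_real (1 / c) * f t) \<in> fst L1_space"
proof -
  have "L1_norm (\<lambda>t. of_real (1 / c) * f t) = ennreal (1 / c) * L1_norm f"
    using L1_norm_scale[OF f(1), of "of_real (1 / c)"] c by (simp add: norm_divide)
  also have "\<dots> \<le> ennreal (1 / c) * ennreal c" by (intro mult_left_mono f) auto
  also have "\<dots> = 1" using c by (simp flip: ennreal_mult)
  finally show le: "L1_norm (\<lambda>t. of_real (1 / c) * f t) \<le> 1" .
  have "(\<lambda>t. of_real (1 / c) * (indicator {0..<1} t *\<^sub>R f t)) \<in> borel_measurable lebesgue"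
    using f(1) unfolding set_borel_measurable_def by (intro borel_measurable_times) auto
  then show "(\<lambda>t. of_real (1 / c) * f t) \<in> fst L1_space"
    using le by (auto simp: set_borel_measurable_def L1_space_def intro: le_less_trans)
qed

text \<open>The constants 2, 4 and 8 are chosen so that all four norms satisfy the bounds.\<close>

locale admissible_norm =
  fixes N :: "(complex \<Rightarrow> complex) \<Rightarrow> ennreal"
  assumes triangle: "\<lbrakk>f holomorphic_on ball 0 1; g holomorphic_on ball 0 1; h holomorphic_on ball 0 1;
      \<And>z. z \<in> ball 0 1 \<Longrightarrow> f z = c * g z + h z\<rbrakk> \<Longrightarrow> N f \<le> ennreal (cmod c) * N g + N h"
    and series: "\<lbrakk>summable (\<lambda>n. real (n + 1) * cmod (d n));
      \<And>z. z \<in> ball 0 1 \<Longrightarrow> (\<lambda>n. d n * z ^ n) sums f z\<rbrakk> \<Longrightarrow>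
      N f \<le> ennreal (2 * (\<Sum>n. real (n + 1) * cmod (d n)))"
    and radial_bound: "\<lbrakk>f holomorphic_on ball 0 1; t \<in> {0..<1}\<rbrakk> \<Longrightarrow>
      ennreal (cmod (f (of_real t))) \<le> ennreal (4 / (1 - t)\<^sup>2) * N f"
    and L1_bound: "f holomorphic_on ball 0 1 \<Longrightarrow> L1_norm (radius_restrict f) \<le> 8 * N f"
begin

text \<open>Definedness and estimate for a single input. Bounds in this form can be added and scaled
  without further reference to option values.\<close>

definition op_bound :: "(real \<Rightarrow> real) \<Rightarrow> (real \<Rightarrow> complex) \<Rightarrow> ennreal \<Rightarrow> bool" where
  "op_bound \<omega> f M \<longleftrightarrow> (\<exists>h. hilbert_op \<omega> f = Some h \<and> N h \<le> M)"

lemma N_zero: "N (\<lambda>_. 0) = 0"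
  using series[of "\<lambda>_. 0" "\<lambda>_. 0"] by simp

lemma op_bound_zero: "op_bound \<omega> (\<lambda>_. 0) 0"
  by (simp add: op_bound_def hilbert_op_def N_zero set_integrable_def)

lemma op_bound_linear:
  assumes "radial_weight \<omega>" "op_bound \<omega> f M" "op_bound \<omega> g L"
  shows "op_bound \<omega> (\<lambda>t. c * f t + g t) (ennreal (cmod c) * M + L)"
proof -
  obtain h k where h: "hilbert_op \<omega> f = Some h" "N h \<le> M" and k: "hilbert_op \<omega> g = Some k" "N k \<le> L"
    using assms by (auto simp: op_bound_def)
  obtain l where l: "hilbert_op \<omega> (\<lambda>t. c * f t + g t) = Some l" "\<And>z. z \<in> ball 0 1 \<Longrightarrow> l z = c * h z + k z"
    using hilbert_op_linear[OF assms(1) h(1) k(1)] by blast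
  have "N l \<le> ennreal (cmod c) * N h + N k"
    using l h k by (intro triangle hilbert_op_holomorphic[OF assms(1)])
  also have "\<dots> \<le> ennreal (cmod c) * M + L"
    using h k by (intro add_mono mult_left_mono) auto
  finally show ?thesis using l by (auto simp: op_bound_def)
qed

lemma op_bound_scale:
  assumes "radial_weight \<omega>" "op_bound \<omega> f M"
  shows "op_bound \<omega> (\<lambda>t. c * f t) (ennreal (cmod c) * M)"
  using op_bound_linear[OF assms op_bound_zero, of c] by simp

lemma bounded_hilbert_opE:
  assumes "radial_weight \<omega>" "bounded_op L1_space (analytic_space N) (hilbert_op \<omega>)"
  obtains M where "0 \<le> M"
    "\<forall>f c. set_borel_measurable lebesgue {0..<1} f \<longrightarrow> L1_norm f \<le> ennreal c \<longrightarrow> 0 < c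
      \<longrightarrow> op_bound \<omega> f (ennreal (c * M))"
proof -
  obtain M where M0: "0 \<le> M" "\<forall>f\<in>fst L1_space. \<exists>g\<in>fst (analytic_space N). hilbert_op \<omega> f = Some g"
    "\<forall>f g. f \<in> fst L1_space \<longrightarrow> snd L1_space f \<le> 1 \<longrightarrow> hilbert_op \<omega> f = Some g \<longrightarrow>
       snd (analytic_space N) g \<le> ennreal M"
    by (rule bounded_opE[OF assms(2)])
  note M = M0(1) M0(2,3)[rule_format]
  show thesis
  proof (rule that[OF M(1)], intro allI impI)
    fix f and c :: real assume f: "set_borel_measurable lebesgue {0..<1} f" "L1_norm f \<le> ennreal c" and c: "0 < c"
    define g where "g t = of_real (1 / c) * f t" for t
    have g1: "L1_norm g \<le> 1" and g: "g \<in> fst L1_space"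
      unfolding g_def[abs_def] by (rule L1_unit_ball_scale[OF f c])+
    from M(2)[OF g] obtain k where k: "hilbert_op \<omega> g = Some k" by blast
    have "N k \<le> ennreal M" using M(3)[OF g _ k] g1 by (simp add: L1_space_def analytic_space_def)
    then have "op_bound \<omega> g (ennreal M)" using k by (auto simp: op_bound_def)
    from op_bound_scale[OF assms(1) this, of "of_real c"]
    show "op_bound \<omega> f (ennreal (c * M))"
      using c M(1) by (simp add: g_def ennreal_mult)
  qed
qed

text \<open>The map \<open>\<alpha>\<close> covers the identity on L^1, the radial restriction and
  its modulus. Two hypotheses appear because \<open>bounded_op\<close> asks for membership on the
  whole source but for a uniform bound on its unit ball only.\<close>

lemma bounded_hilbert_opI:
  assumes \<omega>: "radial_weight \<omega>"
    and "\<And>f. f \<in> fst X \<Longrightarrow> \<exists>M<\<infinity>. op_bound \<omega> (\<alpha> f) M"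
    and "\<And>f. f \<in> fst X \<Longrightarrow> snd X f \<le> 1 \<Longrightarrow> op_bound \<omega> (\<alpha> f) M" and "M < \<infinity>"
  shows "bounded_op X (analytic_space N) (\<lambda>f. hilbert_op \<omega> (\<alpha> f))"
proof (rule bounded_opI)
  show "\<exists>g\<in>fst (analytic_space N). hilbert_op \<omega> (\<alpha> f) = Some g" if f: "f \<in> fst X" for f
  proof -
    obtain L g where "L < \<infinity>" "hilbert_op \<omega> (\<alpha> f) = Some g" "N g \<le> L"
      using assms(2)[OF f] by (auto simp: op_bound_def)
    then show ?thesis
      using hilbert_op_holomorphic[OF \<omega>] by (auto simp: analytic_space_def)
  qed
  show "snd (analytic_space N) g \<le> M"
    if "f \<in> fst X" "snd X f \<le> 1" "hilbert_op \<omega> (\<alpha> f) = Some g" for f g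
    using assms(3)[OF that(1,2)] that(3) by (auto simp: op_bound_def analytic_space_def)
qed (rule assms)

text \<open>The two operators agree on nonnegative inputs. A complex \<open>f\<close> is a
  combination, with coefficients 1, -1, i and -i, of the positive and negative parts of its real and
  imaginary parts. Each part is dominated by \<open>|f|\<close>, so linearity of
  \<open>hilbert_op\<close> costs a factor 4.\<close>

lemma bounded_hilbert_op_if_abs:
  assumes \<omega>: "radial_weight \<omega>" and b: "bounded_op L1_space (analytic_space N) (hilbert_abs_op \<omega>)"
  shows "bounded_op L1_space (analytic_space N) (hilbert_op \<omega>)"
proof -
  obtain M where M0: "0 \<le> M" "\<forall>f\<in>fst L1_space. \<exists>g\<in>fst (analytic_space N). hilbert_abs_op \<omega> f = Some g"
    "\<forall>f g. f \<in> fst L1_space \<longrightarrow> snd L1_space f \<le> 1 \<longrightarrow> hilbert_abs_op \<omega> f = Some g \<longrightarrow>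
       snd (analytic_space N) g \<le> ennreal M"
    by (rule bounded_opE[OF b])
  note M = M0(1) M0(2,3)[rule_format]
  \<comment> \<open>The bound \<open>L\<close> is assumed for all inputs whose norm does not exceed
    that of \<open>f\<close>; hence a unit-ball estimate passes to every nonnegative part of an
    \<open>f\<close> in the unit ball.\<close>
  have pos: "op_bound \<omega> (\<lambda>t. of_real (p (f t))) L"
    if f: "f \<in> fst L1_space" and p: "continuous_on UNIV p" "\<And>z. 0 \<le> p z \<and> p z \<le> cmod z"
      and L: "\<And>g h. g \<in> fst L1_space \<Longrightarrow> L1_norm g \<le> L1_norm f \<Longrightarrow> hilbert_abs_op \<omega> g = Some h \<Longrightarrow>
         h \<in> fst (analytic_space N) \<Longrightarrow> N h \<le> L"
    for p :: "complex \<Rightarrow> real" and f L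
  proof -
    define g where "g t = complex_of_real (p (f t))" for t
    have g_le: "L1_norm g \<le> L1_norm f"
      by (rule L1_norm_mono) (use p(2) in \<open>simp add: g_def\<close>)
    have [measurable]: "p \<in> borel_measurable borel"
      using p(1) by (rule borel_measurable_continuous_onI)
    \<comment> \<open>This lets the indicator pass through \<open>p\<close>, so that measurability
      of \<open>f\<close> cut off to \<open>[0, 1)\<close> suffices.\<close>
    have p0: "p 0 = 0" using p(2)[of 0] by simp
    have [measurable]: "(\<lambda>t. indicator {0..<1} t *\<^sub>R f t) \<in> borel_measurable lebesgue"
      using f by (simp add: L1_space_def set_borel_measurable_def)
    have "(\<lambda>t. complex_of_real (p (indicator {0..<1} t *\<^sub>R f t))) \<in> borel_measurable lebesgue"
      by measurable
    also have "(\<lambda>t. complex_of_real (p (indicator {0..<1} t *\<^sub>R f t))) = (\<lambda>t. indicator {0..<1} t *\<^sub>R g t)"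
      by (auto simp: g_def indicator_def p0)
    finally have g: "g \<in> fst L1_space"
      using f g_le by (auto simp: L1_space_def set_borel_measurable_def)
    obtain h where h: "h \<in> fst (analytic_space N)" "hilbert_abs_op \<omega> g = Some h"
      using M(2)[OF g] by blast
    have "(\<lambda>t. complex_of_real (cmod (g t))) = g"
      using p(2) by (auto simp: g_def)
    then have "hilbert_op \<omega> g = Some h" using h(2) by (simp add: hilbert_abs_op_def)
    then show ?thesis using L[OF g g_le h(2,1)] by (auto simp: op_bound_def g_def[abs_def])
  qed
  have all: "op_bound \<omega> f (4 * L)"
    if f: "f \<in> fst L1_space"
      and L: "\<And>g h. g \<in> fst L1_space \<Longrightarrow> L1_norm g \<le> L1_norm f \<Longrightarrow> hilbert_abs_op \<omega> g = Some h \<Longrightarrow>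
         h \<in> fst (analytic_space N) \<Longrightarrow> N h \<le> L" for f L
  proof -
    \<comment> \<open>Taking \<open>c\<close> to be 1, -1, -i and i gives the positive and negative
      parts of \<open>Re f\<close> and then of \<open>Im f\<close>.\<close>
    have p: "op_bound \<omega> (\<lambda>t. of_real (max 0 (Re (c * f t)))) L" if c: "cmod c = 1" for c
    proof (rule pos[OF f _ _ L])
      show "continuous_on UNIV (\<lambda>z. max 0 (Re (c * z)))" by (intro continuous_intros)
      show "0 \<le> max 0 (Re (c * z)) \<and> max 0 (Re (c * z)) \<le> cmod z" for z
        using complex_Re_le_cmod[of "c * z"] c by (simp add: norm_mult)
    qed
    have "op_bound \<omega> (\<lambda>t. 1 * of_real (max 0 (Re (1 * f t))) +
        (-1 * of_real (max 0 (Re (-1 * f t))) +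
        (\<i> * of_real (max 0 (Re (-\<i> * f t))) + (-\<i> * of_real (max 0 (Re (\<i> * f t))) + 0))))
       (ennreal (cmod 1) * L + (ennreal (cmod (-1)) * L + (ennreal (cmod \<i>) * L + (ennreal (cmod (-\<i>)) * L + 0))))"
      by (intro op_bound_linear \<omega> p op_bound_zero) simp_all
    also have "(\<lambda>t. 1 * of_real (max 0 (Re (1 * f t))) +
        (-1 * of_real (max 0 (Re (-1 * f t))) +
        (\<i> * of_real (max 0 (Re (-\<i> * f t))) + (-\<i> * of_real (max 0 (Re (\<i> * f t))) + 0)))) = f"
      by (auto simp: complex_eq_iff max_def)
    also have "(ennreal (cmod 1) * L + (ennreal (cmod (-1)) * L + (ennreal (cmod \<i>) * L + (ennreal (cmod (-\<i>)) * L + 0)))) = 4 * L"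
      by (simp add: add.assoc[symmetric] mult_2[symmetric])
    finally show ?thesis .
  qed
  have "bounded_op L1_space (analytic_space N) (\<lambda>f. hilbert_op \<omega> (id f))"
  proof (rule bounded_hilbert_opI[OF \<omega>])
    fix f assume f: "f \<in> fst L1_space"
    \<comment> \<open>The summand 1 keeps \<open>c\<close> positive when the norm is zero.\<close>
    define c where "c = enn2real (L1_norm f) + 1"
    have c: "c > 0" "L1_norm f \<le> ennreal c"
      using f by (auto simp: c_def L1_space_def ennreal_plus add_nonneg_pos)
    have "op_bound \<omega> (\<lambda>t. of_real (1/c) * f t) (4 * ennreal M)"
    proof (rule all)
      have fm: "set_borel_measurable lebesgue {0..<1} f" using f by (simp add: L1_space_def)
      note scale = L1_unit_ball_scale[OF fm c(2,1)]
      show "(\<lambda>t. of_real (1/c) * f t) \<in> fst L1_space" by (rule scale(2))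
      show "N h \<le> ennreal M" if "g \<in> fst L1_space" "L1_norm g \<le> L1_norm (\<lambda>t. of_real (1/c) * f t)"
        "hilbert_abs_op \<omega> g = Some h" for g h
        using M(3)[OF that(1) _ that(3)] that(2) scale(1) by (auto simp: L1_space_def analytic_space_def)
    qed
    from op_bound_scale[OF \<omega> this, of "of_real c"]
    have "op_bound \<omega> (id f) (ennreal c * (4 * ennreal M))"
      using c by simp
    moreover have "ennreal c * (4 * ennreal M) < \<infinity>"
      by (simp add: ennreal_mult_less_top)
    ultimately show "\<exists>M<\<infinity>. op_bound \<omega> (id f) M" by blast
  next
    fix f assume "f \<in> fst L1_space" "snd L1_space f \<le> 1"
    then show "op_bound \<omega> (id f) (4 * ennreal M)"
      using all[of f "ennreal M"] M(3) by (auto simp: L1_space_def analytic_space_def)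
  qed (simp add: ennreal_mult_less_top)
  then show ?thesis by simp
qed

text \<open>The test functions are normalized indicators of \<open>E\<close>, where the weight
  exceeds \<open>B\<close>. If \<open>E\<close> had positive measure, the test function would have
  norm 1 while its integral against \<open>\<omega>\<close> is at least \<open>B\<close>, too large
  for the bound on the value at the origin.\<close>

lemma bounded_hilbert_op_imp_AE_bounded:
  assumes \<omega>: "radial_weight \<omega>" and T: "T \<in> {hilbert_op \<omega>, hilbert_abs_op \<omega>}"
    and b: "bounded_op L1_space (analytic_space N) T"
  obtains B where "AE t in lebesgue. t \<in> {0..<1} \<longrightarrow> \<omega> t \<le> B"
proof -
  have b': "bounded_op L1_space (analytic_space N) (hilbert_op \<omega>)"
    using T b bounded_hilbert_op_if_abs[OF \<omega>] by auto
  obtain M where M0: "0 \<le> M"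
    "\<forall>f c. set_borel_measurable lebesgue {0..<1} f \<longrightarrow> L1_norm f \<le> ennreal c \<longrightarrow> 0 < c
      \<longrightarrow> op_bound \<omega> f (ennreal (c * M))"
    by (rule bounded_hilbert_opE[OF \<omega> b'])
  note M = M0(1) M0(2)[rule_format]
  define a where "a = kernel_coeff \<omega> 0"
  have a: "0 < a" unfolding a_def by (rule kernel_coeff_pos[OF \<omega>])
  \<comment> \<open>By \<open>radial_bound\<close> at \<open>t = 0\<close>, \<open>4 * M\<close>
    bounds the value at the origin; the summand 1 makes \<open>a * B = 4 * M + a\<close> strictly
    larger.\<close>
  define B where "B = 4 * M / a + 1"
  \<comment> \<open>Cutting \<open>\<omega>\<close> off by the indicator makes \<open>E\<close>
    measurable, as \<open>\<omega>\<close> is controlled on \<open>[0, 1)\<close> only, and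
    \<open>B > 0\<close> then forces \<open>E\<close> into \<open>[0, 1)\<close>.\<close>
  define E where "E = {t. B < indicator {0..<1} t *\<^sub>R \<omega> t}"
  have B: "0 < B" using a M by (simp add: B_def add_nonneg_pos)
  have EI: "E \<subseteq> {0..<1}" using B by (auto simp: E_def indicator_def split: if_splits)
  have \<omega>_int: "integrable lebesgue (\<lambda>t. indicator {0..<1} t *\<^sub>R \<omega> t)"
    using \<omega> by (simp add: radial_weight_def set_integrable_def)
  have E_sets: "E \<in> sets lebesgue"
    unfolding E_def using borel_measurable_integrable[OF \<omega>_int] by (simp add: borel_measurable_iff_greater)
  have E_le: "emeasure lebesgue E \<le> 1"
    using emeasure_mono[OF EI, of lebesgue] by simp
  have "emeasure lebesgue E = 0"
  proof (rule ccontr)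
    assume "emeasure lebesgue E \<noteq> 0"
    define m where "m = measure lebesgue E"
    have em: "emeasure lebesgue E = ennreal m"
      unfolding m_def using E_le by (intro emeasure_eq_ennreal_measure) (auto simp: top_unique)
    have m: "0 < m" using em \<open>emeasure lebesgue E \<noteq> 0\<close>
      by (metis ennreal_0 m_def measure_nonneg order_le_less)
    define f where "f t = complex_of_real (indicator E t / m)" for t
    have fm: "set_borel_measurable lebesgue {0..<1} f"
      unfolding set_borel_measurable_def f_def[abs_def] using E_sets
      by (intro borel_measurable_scaleR borel_measurable_of_real borel_measurable_indicator
        borel_measurable_divide borel_measurable_const) auto
    have "L1_norm f = (\<integral>\<^sup>+t. ennreal (1 / m) * indicator E t \<partial>lebesgue)"
      unfolding L1_norm_def using EI m
      by (intro nn_integral_cong) (auto simp: f_def indicator_def norm_divide)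
    also have "\<dots> = 1"
      using E_sets m by (simp add: em nn_integral_cmult_indicator flip: ennreal_mult)
    finally have f1: "L1_norm f \<le> ennreal 1" by simp
    obtain h where h: "hilbert_op \<omega> f = Some h" "N h \<le> ennreal M"
      using M(2)[OF fm f1] by (auto simp: op_bound_def)
    have i1: "set_integrable lebesgue {0..<1} (\<lambda>t. f t * of_real (\<omega> t))"
      by (rule hilbert_op_at_0(1)[OF \<omega> h(1)])
    have "(LINT t:{0..<1}|lebesgue. f t * of_real (\<omega> t)) = of_real (LINT t:{0..<1}|lebesgue. indicator E t / m * \<omega> t)"
      unfolding set_integral_complex_of_real[symmetric] by (simp add: f_def)
    then have "h 0 = of_real (a * (LINT t:{0..<1}|lebesgue. indicator E t / m * \<omega> t))"
      using hilbert_op_at_0(2)[OF \<omega> h(1)] by (simp add: a_def)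
    then have "a * (LINT t:{0..<1}|lebesgue. indicator E t / m * \<omega> t) \<le> cmod (h 0)"
      using norm_of_real[where 'a=complex] abs_ge_self by metis
    moreover have "B \<le> (LINT t:{0..<1}|lebesgue. indicator E t / m * \<omega> t)"
    proof -
      have "B = (LINT t|lebesgue. indicator E t * (B / m))"
        using E_sets m em by (simp add: m_def)
      also have "\<dots> \<le> (LINT t:{0..<1}|lebesgue. indicator E t / m * \<omega> t)"
        unfolding set_lebesgue_integral_def
      proof (rule integral_mono)
        show "integrable lebesgue (\<lambda>t. indicator E t * (B / m))"
          using E_sets E_le by (intro integrable_mult_left integrable_real_indicator) (auto intro: le_less_trans)
        have "set_integrable lebesgue {0..<1} (\<lambda>t. complex_of_real (indicator E t / m * \<omega> t))"
          using i1 by (simp add: f_def)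
        from integrable_Re[OF this[unfolded set_integrable_def]]
        show "integrable lebesgue (\<lambda>t. indicat_real {0..<1} t *\<^sub>R (indicat_real E t / m * \<omega> t))"
          by simp
        fix t show "indicator E t * (B / m) \<le> indicat_real {0..<1} t *\<^sub>R (indicat_real E t / m * \<omega> t)"
          using EI m by (auto simp: indicator_def E_def divide_right_mono)
      qed
      finally show ?thesis .
    qed
    ultimately have "a * B \<le> cmod (h 0)" using a by (meson mult_left_mono less_imp_le order_trans)
    also have "cmod (h 0) \<le> 4 * M"
    proof -
      have "ennreal (cmod (h 0)) \<le> ennreal 4 * N h"
        using radial_bound[OF hilbert_op_holomorphic[OF \<omega> h(1)], of 0] by simp
      also have "\<dots> \<le> ennreal 4 * ennreal M" by (intro mult_left_mono h) auto
      also have "\<dots> = ennreal (4 * M)" by (rule ennreal_mult[symmetric]) (use M in auto)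
      finally show ?thesis using M by (simp add: ennreal_le_iff)
    qed
    also have "a * B = 4 * M + a" using a by (simp add: B_def field_simps)
    finally show False using a by simp
  qed
  then have "E \<in> null_sets lebesgue" using E_sets by auto
  then have "AE t in lebesgue. t \<notin> E" by (rule AE_not_in)
  then have "AE t in lebesgue. t \<in> {0..<1} \<longrightarrow> \<omega> t \<le> B"
    by eventually_elim (auto simp: E_def)
  then show thesis by (rule that)
qed

end

subsection \<open>Thin spikes\<close>

text \<open>The integral of \<open>s \<Phi>\<close> is tested against measurable \<open>g \<le> \<Phi>\<close> so that the measurability of
  \<open>\<Phi>\<close> need not be discussed.\<close>

lemma spike_exists:
  fixes \<Phi> :: "real \<Rightarrow> real"
  assumes mono: "mono_on {0..<1} \<Phi>" and pos: "\<And>t. t \<in> {0..<1} \<Longrightarrow> 0 < \<Phi> t"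
  obtains s :: "real \<Rightarrow> real" where "s \<in> borel_measurable borel" "\<forall>t. 0 \<le> s t"
    and "\<forall>r<1. \<exists>M. \<forall>t\<le>r. s t \<le> M"
    and "\<forall>K. \<exists>a b. 0 \<le> a \<and> a < b \<and> b \<le> 1 \<and> (\<forall>t\<in>{a..<b}. K \<le> s t)"
    and "\<forall>g\<in>borel_measurable borel. (\<forall>t\<in>{0..<1}. 0 \<le> g t \<and> g t \<le> \<Phi> t) \<longrightarrow>
      set_integrable lebesgue {0..<1} (\<lambda>t. s t * g t) \<and> (LINT t:{0..<1}|lebesgue. s t * g t) \<le> 1"
proof -
  \<comment> \<open>The left endpoints of the spikes, strictly increasing to 1.\<close>
  define c where "c k = real k / real (k + 1)" for k
  have c: "0 \<le> c k" "c k < c (Suc k)" "c k < 1" for k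
    by (auto simp: c_def field_simps)
  have c_lim: "c \<longlonglongrightarrow> 1"
    unfolding c_def using LIMSEQ_n_over_Suc_n[where 'a=real] by simp
  \<comment> \<open>The first bound makes the intervals disjoint. On the interval number
    \<open>k\<close> the spike has height \<open>k\<close> and \<open>\<Phi>\<close> is at most
    \<open>\<Phi> (c (Suc k))\<close>, so the second bound limits its contribution to
    \<open>1 / 2 ^ (k + 1)\<close>; these contributions sum to 1.\<close>
  define w where "w k = min (c (Suc k) - c k) (1 / (2 ^ (k + 1) * real (k + 1) * \<Phi> (c (Suc k))))" for k
  have w: "0 < w k" "c k + w k \<le> c (Suc k)" "real k * w k * \<Phi> (c (Suc k)) \<le> 1 / 2 ^ (k + 1)" for k
  proof -
    have p: "0 < \<Phi> (c (Suc k))" using c by (intro pos) auto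
    show "0 < w k" using c p by (simp add: w_def)
    show "c k + w k \<le> c (Suc k)" by (simp add: w_def)
    have "real k * w k * \<Phi> (c (Suc k)) \<le> real (k + 1) * (1 / (2 ^ (k + 1) * real (k + 1) * \<Phi> (c (Suc k)))) * \<Phi> (c (Suc k))"
      using p \<open>0 < w k\<close> by (intro mult_mono mult_right_mono) (auto simp: w_def)
    also have "\<dots> = 1 / 2 ^ (k + 1)" using p by (simp add: field_simps del: of_nat_Suc of_nat_add)
    finally show "real k * w k * \<Phi> (c (Suc k)) \<le> 1 / 2 ^ (k + 1)" .
  qed
  define J where "J k = {c k..<c k + w k}" for k
  define s where "s t = (\<Sum>k. real k * indicator (J k) t)" for t
  \<comment> \<open>Below each \<open>r < 1\<close> only finitely many spikes are active. Both
    convergence of the series for \<open>s\<close> and its local boundedness come from this.\<close>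
  have fin: "\<exists>K. \<forall>k\<ge>K. \<forall>t\<le>r. indicator (J k) t = (0::real)" if "r < 1" for r
  proof -
    obtain K where "\<And>k. k \<ge> K \<Longrightarrow> r < c k"
      using order_tendstoD(1)[OF c_lim \<open>r < 1\<close>] by (auto simp: eventually_sequentially)
    then have "\<forall>k\<ge>K. \<forall>t\<le>r. indicator (J k) t = (0::real)"
      by (fastforce simp: J_def indicator_def)
    then show ?thesis by blast
  qed
  \<comment> \<open>The series defines \<open>s\<close> on the whole line, so its convergence is
    also checked at and beyond 1, where every term vanishes.\<close>
  have J1: "indicator (J k) t = (0::real)" if "t \<ge> 1" for k t
    using that w(2)[of k] c(3)[of "Suc k"] by (auto simp: J_def indicator_def)
  have summ: "summable (\<lambda>k. real k * indicator (J k) t)" for t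
  proof (cases "t < 1")
    case True
    then obtain K where "\<forall>k\<ge>K. indicator (J k) t = (0::real)" using fin[OF True] by blast
    then show ?thesis by (intro summable_finite[of "{..<K}"]) (auto simp: not_less)
  qed (simp add: J1)
  have s_meas: "s \<in> borel_measurable borel"
    unfolding s_def[abs_def] J_def by measurable
  have s_nonneg: "0 \<le> s t" for t
    unfolding s_def by (intro suminf_nonneg summ) auto
  have s_bdd: "\<exists>M. \<forall>t\<le>r. s t \<le> M" if r: "r < 1" for r
  proof -
    obtain K where K: "\<forall>k\<ge>K. \<forall>t\<le>r. indicator (J k) t = (0::real)" using fin[OF r] by blast
    have "s t \<le> (\<Sum>k<K. real k)" if "t \<le> r" for t
    proof -
      have "s t = (\<Sum>k<K. real k * indicator (J k) t)"
        unfolding s_def using K that by (intro suminf_finite) (auto simp: not_less)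
      also have "\<dots> \<le> (\<Sum>k<K. real k)" by (intro sum_mono) (auto simp: indicator_def)
      finally show ?thesis .
    qed
    then show ?thesis by blast
  qed
  have s_large: "\<exists>a b. 0 \<le> a \<and> a < b \<and> b \<le> 1 \<and> (\<forall>t\<in>{a..<b}. K \<le> s t)" for K
  proof -
    obtain k where k: "K \<le> real k" using real_arch_simple by blast
    have "real k \<le> s t" if "t \<in> J k" for t
    proof -
      have "(\<Sum>j\<in>{k}. real j * indicator (J j) t) \<le> s t"
        unfolding s_def by (intro sum_le_suminf summ) auto
      then show ?thesis using that by simp
    qed
    then have "\<forall>t\<in>{c k..<c k + w k}. K \<le> s t" using k unfolding J_def by force
    moreover have "0 \<le> c k" "c k < c k + w k" "c k + w k \<le> 1"
      using c[of k] c(3)[of "Suc k"] w[of k] by auto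
    ultimately show ?thesis by blast
  qed
  have s_int: "set_integrable lebesgue {0..<1} (\<lambda>t. s t * g t) \<and> (LINT t:{0..<1}|lebesgue. s t * g t) \<le> 1"
    if g: "g \<in> borel_measurable borel" "\<And>t. t \<in> {0..<1} \<Longrightarrow> 0 \<le> g t \<and> g t \<le> \<Phi> t" for g
  proof -
    have m: "(\<lambda>t. indicator {0..<1} t *\<^sub>R (s t * g t)) \<in> borel_measurable lebesgue"
    proof -
      note [measurable] = s_meas g(1)
      have "(\<lambda>t. indicator {0..<1} t *\<^sub>R (s t * g t)) \<in> borel_measurable borel" by measurable
      then show ?thesis by (intro measurable_completion) simp
    qed
    have nn: "AE t in lebesgue. 0 \<le> indicator {0..<1} t *\<^sub>R (s t * g t)"
      using s_nonneg g(2) by (intro AE_I2) (auto simp: indicator_def)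
    \<comment> \<open>In \<open>ennreal\<close> the majorizing series raises no question of
      convergence. Monotonicity of \<open>\<Phi>\<close> replaces \<open>g\<close> on each spike by
      the constant \<open>\<Phi> (c (Suc k))\<close>, so that only lengths of intervals remain to be
      integrated.\<close>
    have pt: "ennreal (indicator {0..<1} t *\<^sub>R (s t * g t)) \<le>
        (\<Sum>k. ennreal (real k * \<Phi> (c (Suc k))) * indicator (J k) t)" for t
    proof (cases "t \<in> {0..<1}")
      case True
      have gt: "0 \<le> g t" using g(2)[OF True] by simp
      have "ennreal (s t * g t) = ennreal (s t) * ennreal (g t)"
        using s_nonneg gt by (intro ennreal_mult)
      also have "ennreal (s t) = (\<Sum>k. ennreal (real k * indicator (J k) t))"
        unfolding s_def by (intro suminf_ennreal2[symmetric] summ) auto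
      also have "\<dots> * ennreal (g t) = (\<Sum>k. ennreal (real k * indicator (J k) t) * ennreal (g t))"
        by (rule ennreal_suminf_multc[symmetric])
      also have "\<dots> \<le> (\<Sum>k. ennreal (real k * \<Phi> (c (Suc k))) * indicator (J k) t)"
      proof (intro suminf_le allI summableI)
        fix k
        show "ennreal (real k * indicator (J k) t) * ennreal (g t) \<le> ennreal (real k * \<Phi> (c (Suc k))) * indicator (J k) t"
        proof (cases "t \<in> J k")
          case tJ: True
          have "g t \<le> \<Phi> t" using g(2)[OF True] by simp
          also have "\<dots> \<le> \<Phi> (c (Suc k))"
            using tJ True w(2)[of k] c[of "Suc k"] by (intro mono_onD[OF mono]) (auto simp: J_def)
          finally show ?thesis
            using tJ gt by (simp add: ennreal_mult[symmetric] ennreal_leI mult_left_mono)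
        qed simp
      qed
      finally show ?thesis using True by simp
    qed simp
    have "(\<integral>\<^sup>+t. ennreal (indicator {0..<1} t *\<^sub>R (s t * g t)) \<partial>lebesgue) \<le>
       (\<integral>\<^sup>+t. (\<Sum>k. ennreal (real k * \<Phi> (c (Suc k))) * indicator (J k) t) \<partial>lebesgue)"
      by (intro nn_integral_mono pt)
    also have "\<dots> = (\<Sum>k. \<integral>\<^sup>+t. ennreal (real k * \<Phi> (c (Suc k))) * indicator (J k) t \<partial>lebesgue)"
      by (intro nn_integral_suminf measurable_completion) (unfold J_def, measurable)
    also have "\<dots> = (\<Sum>k. ennreal (real k * \<Phi> (c (Suc k))) * ennreal (w k))"
    proof (intro suminf_cong)
      fix k
      have "emeasure lebesgue (J k) = ennreal (w k)"
        using w(1)[of k] by (simp add: J_def)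
      then show "(\<integral>\<^sup>+t. ennreal (real k * \<Phi> (c (Suc k))) * indicator (J k) t \<partial>lebesgue) = ennreal (real k * \<Phi> (c (Suc k))) * ennreal (w k)"
        by (subst nn_integral_cmult_indicator) (auto simp: J_def)
    qed
    also have "\<dots> \<le> (\<Sum>k. ennreal ((1 / 2) ^ Suc k))"
    proof (intro suminf_le allI summableI)
      fix k
      have "0 < \<Phi> (c (Suc k))" using c by (intro pos) auto
      then have "ennreal (real k * \<Phi> (c (Suc k))) * ennreal (w k) = ennreal (real k * w k * \<Phi> (c (Suc k)))"
        using w(1)[of k] by (subst ennreal_mult[symmetric]) (auto simp: mult_ac)
      also have "\<dots> \<le> ennreal ((1 / 2) ^ Suc k)"
        using w(3)[of k] by (intro ennreal_leI) (simp add: power_divide)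
      finally show "ennreal (real k * \<Phi> (c (Suc k))) * ennreal (w k) \<le> ennreal ((1 / 2) ^ Suc k)" .
    qed
    also have "\<dots> = 1"
      using power_half_series by (subst suminf_ennreal_eq[where x = 1]) auto
    finally have le1: "(\<integral>\<^sup>+t. ennreal (indicator {0..<1} t *\<^sub>R (s t * g t)) \<partial>lebesgue) \<le> 1" .
    have int: "integrable lebesgue (\<lambda>t. indicator {0..<1} t *\<^sub>R (s t * g t))"
      using m nn le1 by (intro integrableI_nonneg) (auto intro: le_less_trans)
    have "ennreal (LINT t|lebesgue. indicator {0..<1} t *\<^sub>R (s t * g t)) \<le> 1"
      using le1 nn_integral_eq_integral[OF int nn] by simp
    then show ?thesis using int by (simp add: set_integrable_def set_lebesgue_integral_def)
  qed
  show thesis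
  proof (rule that[OF s_meas])
    show "\<forall>t. 0 \<le> s t" using s_nonneg by blast
    show "\<forall>r<1. \<exists>M. \<forall>t\<le>r. s t \<le> M" using s_bdd by blast
    show "\<forall>K. \<exists>a b. 0 \<le> a \<and> a < b \<and> b \<le> 1 \<and> (\<forall>t\<in>{a..<b}. K \<le> s t)" using s_large by blast
    show "\<forall>g\<in>borel_measurable borel. (\<forall>t\<in>{0..<1}. 0 \<le> g t \<and> g t \<le> \<Phi> t) \<longrightarrow>
      set_integrable lebesgue {0..<1} (\<lambda>t. s t * g t) \<and> (LINT t:{0..<1}|lebesgue. s t * g t) \<le> 1"
      by (intro ballI impI s_int) auto
  qed
qed

text \<open>All requirements on \<open>s\<close> are encoded in one increasing majorant and then
  read off by choosing test functions below it. The last two conclusions are what the comparison of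
  coefficients in \<open>perturbed_op_bound\<close> consumes; partial sums are used there to prove
  convergence.\<close>

lemma small_perturbation:
  assumes \<nu>: "radial_weight \<nu>"
  obtains s where "s \<in> borel_measurable borel" "\<forall>t. 0 \<le> s t"
    and "\<forall>r<1. \<exists>M. \<forall>t\<le>r. s t \<le> M"
    and "\<forall>K. \<exists>a b. 0 \<le> a \<and> a < b \<and> b \<le> 1 \<and> (\<forall>t\<in>{a..<b}. K \<le> s t)"
    and "set_integrable lebesgue {0..<1} s"
    and "\<forall>r\<in>{0..<1}. weight_hat s r \<le> weight_hat \<nu> r"
    and "\<forall>n. set_integrable lebesgue {0..<1} (\<lambda>t. s t * (t ^ n / (1 - t)\<^sup>2))"
    and "\<forall>n. (\<Sum>k<n. real (k + 1) / (odd_moment \<nu> k)\<^sup>2 * (LINT t:{0..<1}|lebesgue. s t * (t ^ k / (1 - t)\<^sup>2))) \<le> 1"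
proof -
  have hat_pos: "0 < weight_hat \<nu> t" if "t \<in> {0..<1}" for t
    using \<nu> that by (auto simp: radial_weight_def)
  have hat_anti: "weight_hat \<nu> u \<le> weight_hat \<nu> t" if "t \<le> u" "t \<in> {0..<1}" "u \<in> {0..<1}" for t u
  proof -
    have "set_integrable lebesgue {v..<1} \<nu>" if "v \<in> {0..<1}" for v
      using \<nu> that by (auto simp: radial_weight_def intro: set_integrable_subset)
    then show ?thesis
      unfolding weight_hat_def set_lebesgue_integral_def using that \<nu>
      by (intro integral_mono) (auto simp: set_integrable_def radial_weight_def indicator_def)
  qed
  define S where "S t = (\<Sum>n. real (n + 1) * t ^ n / (odd_moment \<nu> n)\<^sup>2)" for t
  have S_sum: "summable (\<lambda>n. real (n + 1) * t ^ n / (odd_moment \<nu> n)\<^sup>2)" if "t \<in> {0..<1}" for t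
    using that by (intro summable_power_div_odd_moment_sq[OF \<nu>]) auto
  have S_nonneg: "0 \<le> S t" if "t \<in> {0..<1}" for t
    unfolding S_def using that by (intro suminf_nonneg S_sum) auto
  have S_mono: "S t \<le> S u" if "t \<le> u" "t \<in> {0..<1}" "u \<in> {0..<1}" for t u
    unfolding S_def using that by (intro suminf_le S_sum divide_right_mono mult_left_mono power_mono) auto
  have sq: "1 / (1 - t)\<^sup>2 \<le> 1 / (1 - u)\<^sup>2" if "t \<le> u" "t \<in> {0..<1}" "u \<in> {0..<1}" for t u :: real
    using that by (intro divide_left_mono power_mono) auto
  have sq1: "1 \<le> 1 / (1 - t)\<^sup>2" if "t \<in> {0..<1}" for t :: real
    using sq[of 0 t] that by simp
  \<comment> \<open>The first summand pays for \<open>weight_hat s \<le> weight_hat \<nu>\<close>;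
    the second, with its two parts \<open>1\<close> and \<open>S t\<close>, for integrability
    against \<open>1 / (1 - t)\<^sup>2\<close> and for the weighted sum of moments. Each is
    increasing, as \<open>weight_hat \<nu>\<close> decreases and \<open>S\<close> has nonnegative
    coefficients.\<close>
  define \<Phi> where "\<Phi> t = 1 / weight_hat \<nu> t + (1 + S t) * (1 / (1 - t)\<^sup>2)" for t
  have \<Phi>_mono: "mono_on {0..<1} \<Phi>"
    unfolding \<Phi>_def[abs_def] 
    by (intro mono_onI add_mono mult_mono divide_left_mono mult_pos_pos hat_pos hat_anti sq S_mono)
      (auto simp: S_nonneg)
  have \<Phi>_ge: "1 / weight_hat \<nu> t \<le> \<Phi> t" "(1 + S t) * (1 / (1 - t)\<^sup>2) \<le> \<Phi> t"
     "1 / (1 - t)\<^sup>2 \<le> \<Phi> t" "S t * (1 / (1 - t)\<^sup>2) \<le> \<Phi> t" if "t \<in> {0..<1}" for t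
  proof -
    have p: "0 \<le> 1 / weight_hat \<nu> t" "0 \<le> 1 / (1 - t)\<^sup>2" "0 \<le> S t * (1 / (1 - t)\<^sup>2)"
      using hat_pos[OF that] S_nonneg[OF that] by (auto intro: mult_nonneg_nonneg)
    show "1 / weight_hat \<nu> t \<le> \<Phi> t" "(1 + S t) * (1 / (1 - t)\<^sup>2) \<le> \<Phi> t"
     "1 / (1 - t)\<^sup>2 \<le> \<Phi> t" "S t * (1 / (1 - t)\<^sup>2) \<le> \<Phi> t"
      using p unfolding \<Phi>_def distrib_right by linarith+
  qed
  have \<Phi>_pos: "0 < \<Phi> t" if "t \<in> {0..<1}" for t
    using \<Phi>_ge(3)[OF that] sq1[OF that] by linarith
  obtain s where s: "s \<in> borel_measurable borel" "\<forall>t. 0 \<le> s t"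
    "\<forall>r<1. \<exists>M. \<forall>t\<le>r. s t \<le> M"
    "\<forall>K. \<exists>a b. 0 \<le> a \<and> a < b \<and> b \<le> 1 \<and> (\<forall>t\<in>{a..<b}. K \<le> s t)"
    and s5: "\<forall>g\<in>borel_measurable borel. (\<forall>t\<in>{0..<1}. 0 \<le> g t \<and> g t \<le> \<Phi> t) \<longrightarrow>
      set_integrable lebesgue {0..<1} (\<lambda>t. s t * g t) \<and> (LINT t:{0..<1}|lebesgue. s t * g t) \<le> 1"
    by (rule spike_exists[OF \<Phi>_mono \<Phi>_pos])
  have P: "set_integrable lebesgue {0..<1} (\<lambda>t. s t * g t)" "(LINT t:{0..<1}|lebesgue. s t * g t) \<le> 1"
    if "g \<in> borel_measurable borel" "\<And>t. t \<in> {0..<1} \<Longrightarrow> 0 \<le> g t \<and> g t \<le> \<Phi> t" for g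
    using bspec[OF s5 that(1)] that(2) by simp_all
  show thesis
  proof (rule that[OF s])
    show s_int: "set_integrable lebesgue {0..<1} s"
      using P(1)[of "\<lambda>_. 1"] order_trans[OF sq1 \<Phi>_ge(3)] by simp
    show "\<forall>r\<in>{0..<1}. weight_hat s r \<le> weight_hat \<nu> r"
    proof
      fix r :: real assume r: "r \<in> {0..<1}"
      \<comment> \<open>Testing against this \<open>g\<close> turns the bound 1 into
        \<open>weight_hat s r / weight_hat \<nu> r \<le> 1\<close>. It lies below
        \<open>\<Phi>\<close> because for \<open>t \<ge> r\<close> the value
        \<open>1 / weight_hat \<nu> r\<close> is at most
        \<open>1 / weight_hat \<nu> t\<close>.\<close>
      define g where "g t = indicator {r..} t * (1 / weight_hat \<nu> r)" for t :: real
      have g_meas: "g \<in> borel_measurable borel" unfolding g_def[abs_def] by measurable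
      have gP: "0 \<le> g t \<and> g t \<le> \<Phi> t" if "t \<in> {0..<1}" for t
      proof (cases "r \<le> t")
        case True
        have "1 / weight_hat \<nu> r \<le> 1 / weight_hat \<nu> t"
          using hat_pos hat_anti[OF True r that] that r by (intro divide_left_mono mult_pos_pos) auto
        then show ?thesis using True \<Phi>_ge(1)[OF that] hat_pos[OF r] by (simp add: g_def)
      qed (use \<Phi>_pos[OF that] in \<open>simp add: g_def\<close>)
      have "(LINT t:{0..<1}|lebesgue. s t * g t) = (LINT t:{r..<1}|lebesgue. s t * (1 / weight_hat \<nu> r))"
        unfolding set_lebesgue_integral_def
        using r by (intro Bochner_Integration.integral_cong) (auto simp: g_def indicator_def)
      also have "\<dots> = weight_hat s r / weight_hat \<nu> r" by (simp add: weight_hat_def)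
      finally have "weight_hat s r / weight_hat \<nu> r \<le> 1"
        using P(2)[OF _ gP] g_meas by simp
      then show "weight_hat s r \<le> weight_hat \<nu> r" using hat_pos[OF r] by (simp add: divide_le_eq)
    qed
    have int: "set_integrable lebesgue {0..<1} (\<lambda>t. s t * (t ^ n / (1 - t)\<^sup>2))" for n
    proof (rule P(1))
      fix t :: real assume t: "t \<in> {0..<1}"
      have "t ^ n / (1 - t)\<^sup>2 \<le> 1 / (1 - t)\<^sup>2"
        using t by (intro divide_right_mono power_le_one) auto
      then show "0 \<le> t ^ n / (1 - t)\<^sup>2 \<and> t ^ n / (1 - t)\<^sup>2 \<le> \<Phi> t"
        using \<Phi>_ge(3)[OF t] t by auto
    qed measurable
    then show "\<forall>n. set_integrable lebesgue {0..<1} (\<lambda>t. s t * (t ^ n / (1 - t)\<^sup>2))" ..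
    show "\<forall>n. (\<Sum>k<n. real (k + 1) / (odd_moment \<nu> k)\<^sup>2 * (LINT t:{0..<1}|lebesgue. s t * (t ^ k / (1 - t)\<^sup>2))) \<le> 1"
    proof
      fix n
      \<comment> \<open>A finite sum in place of \<open>S\<close> keeps \<open>g\<close> visibly
        measurable, and \<open>S t * (1 / (1 - t)\<^sup>2)\<close> bounds it for every
        \<open>n\<close>.\<close>
      define g where "g t = (\<Sum>k<n. real (k + 1) * t ^ k / (odd_moment \<nu> k)\<^sup>2) * (1 / (1 - t)\<^sup>2)" for t
      have "(\<Sum>k<n. real (k + 1) / (odd_moment \<nu> k)\<^sup>2 * (LINT t:{0..<1}|lebesgue. s t * (t ^ k / (1 - t)\<^sup>2))) =
        (\<Sum>k<n. LINT t:{0..<1}|lebesgue. real (k + 1) / (odd_moment \<nu> k)\<^sup>2 * (s t * (t ^ k / (1 - t)\<^sup>2)))"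
        by (intro sum.cong refl set_integral_mult_right[symmetric])
      also have "\<dots> = (LINT t:{0..<1}|lebesgue. \<Sum>k<n. real (k + 1) / (odd_moment \<nu> k)\<^sup>2 * (s t * (t ^ k / (1 - t)\<^sup>2)))"
        unfolding set_lebesgue_integral_def scaleR_sum_right
        by (intro Bochner_Integration.integral_sum[symmetric]
          set_integrable_mult_right[OF int, unfolded set_integrable_def])
      also have "\<dots> = (LINT t:{0..<1}|lebesgue. s t * g t)"
        by (intro set_lebesgue_integral_cong) (auto simp: g_def sum_distrib_left sum_distrib_right mult_ac intro!: sum.cong)
      also have "\<dots> \<le> 1"
      proof (rule P(2))
        show "g \<in> borel_measurable borel" unfolding g_def[abs_def] by measurable
        fix t :: real assume t: "t \<in> {0..<1}"
        have "(\<Sum>k<n. real (k + 1) * t ^ k / (odd_moment \<nu> k)\<^sup>2) \<le> S t"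
          unfolding S_def using t by (intro sum_le_suminf S_sum) auto
        then have "g t \<le> S t * (1 / (1 - t)\<^sup>2)" unfolding g_def by (intro mult_right_mono) auto
        moreover have "0 \<le> g t" unfolding g_def using t by (intro mult_nonneg_nonneg sum_nonneg) auto
        ultimately show "0 \<le> g t \<and> g t \<le> \<Phi> t" using \<Phi>_ge(4)[OF t] by linarith
      qed
      finally show "(\<Sum>k<n. real (k + 1) / (odd_moment \<nu> k)\<^sup>2 * (LINT t:{0..<1}|lebesgue. s t * (t ^ k / (1 - t)\<^sup>2))) \<le> 1" .
    qed
  qed
qed

section \<open>Comparison of the operators for \<open>\<nu>\<close> and
  \<open>\<nu> + s\<close>\<close>

context admissible_norm
begin

text \<open>The operator of \<open>\<nu>\<close> is controlled by the L^1 norm of \<open>f\<close>,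
  so it remains to bound the power series of the difference. Let \<open>p \<le> q\<close> be the
  moments number \<open>n\<close> of \<open>\<nu>\<close> and \<open>\<nu> + s\<close>. The new
  integral of \<open>t^n f s\<close> is at most \<open>K * u n\<close> by the growth of
  \<open>f\<close>. The new kernel changes the coefficient, apart from \<open>n + 1\<close>, by
  \<open>1 / (2 * p) - 1 / (2 * q)\<close>, which is at most \<open>u n / p\<^sup>2\<close>, while
  the integral of \<open>t^n f \<nu>\<close> is at most \<open>B * K\<close>. Hypothesis
  \<open>u_sum\<close> adds these up. The constant depends on \<open>f\<close> only through
  \<open>K\<close>.\<close>

lemma perturbed_op_bound:
  assumes \<nu>: "radial_weight \<nu>" and \<omega>: "radial_weight (\<lambda>t. \<nu> t + s t)"
    and b: "bounded_op L1_space (analytic_space N) (hilbert_op \<nu>)"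
    and B: "AE t in lebesgue. t \<in> {0..<1} \<longrightarrow> \<nu> t \<le> B" "0 \<le> B"
    and s: "s \<in> borel_measurable borel" "\<forall>t. 0 \<le> s t" "set_integrable lebesgue {0..<1} s"
    and u_int: "\<forall>n. set_integrable lebesgue {0..<1} (\<lambda>t. s t * (t ^ n / (1 - t)\<^sup>2))"
    and u_sum: "\<forall>n. (\<Sum>k<n. real (k + 1) / (odd_moment \<nu> k)\<^sup>2 * (LINT t:{0..<1}|lebesgue. s t * (t ^ k / (1 - t)\<^sup>2))) \<le> 1"
    and K: "0 < K"
  obtains C where "\<forall>f. set_borel_measurable lebesgue {0..<1} f \<longrightarrow>
    (\<forall>t\<in>{0..<1}. cmod (f t) \<le> K / (1 - t)\<^sup>2) \<longrightarrow> L1_norm f \<le> ennreal K \<longrightarrow>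
    op_bound (\<lambda>t. \<nu> t + s t) f (ennreal C)"
proof -
  define \<omega> where "\<omega> = (\<lambda>t. \<nu> t + s t)"
  have \<omega>: "radial_weight \<omega>" using \<omega> by (simp add: \<omega>_def)
  define u where "u n = (LINT t:{0..<1}|lebesgue. s t * (t ^ n / (1 - t)\<^sup>2))" for n
  define e where "e n = (LINT t:{0..<1}|lebesgue. t ^ (2 * n + 1) * s t)" for n
  define W where "W = weight_hat \<nu> 0"
  have e_int: "set_integrable lebesgue {0..<1} (\<lambda>t. t ^ (2 * n + 1) * s t)" for n
    using set_integrable_bounded_scaleR[OF s(3), of "\<lambda>t. t ^ (2 * n + 1)" 1]
    by (auto simp: power_le_one mult_le_one)
  have \<omega>_moment: "odd_moment \<omega> n = odd_moment \<nu> n + e n" for n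
    unfolding odd_moment_eq e_def \<omega>_def distrib_left
    by (intro set_integral_add radial_weight_power_integrable \<nu> e_int)
  have e_nonneg: "0 \<le> e n" for n
    unfolding e_def set_lebesgue_integral_def using s(2)
    by (intro Bochner_Integration.integral_nonneg) (auto simp: indicator_def)
  \<comment> \<open>Since \<open>1 / (1 - t)\<^sup>2 \<ge> 1\<close>, the sequence \<open>u\<close>
    dominates the growth of the moments too: one sequence measures both effects of
    \<open>s\<close>.\<close>
  have e_le: "e n \<le> u n" for n
    unfolding e_def u_def
  proof (intro set_integral_mono e_int u_int[rule_format])
    fix t :: real assume t: "t \<in> {0..<1}"
    have "t ^ (2 * n + 1) \<le> t ^ n" using t by (intro power_decreasing) auto
    also have "\<dots> \<le> t ^ n / (1 - t)\<^sup>2"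
      using t by (simp add: le_divide_eq mult_right_le_one_le power_le_one)
    finally show "t ^ (2 * n + 1) * s t \<le> s t * (t ^ n / (1 - t)\<^sup>2)"
      using s(2) by (subst mult.commute) (intro mult_left_mono, auto)
  qed
  have u_nonneg: "0 \<le> u n" for n using e_nonneg e_le by (rule order_trans)
  have W: "0 < odd_moment \<nu> n" "odd_moment \<nu> n \<le> W" for n
    unfolding W_def by (rule odd_moment_pos[OF \<nu>], rule odd_moment_le[OF \<nu>])
  have W0: "0 \<le> W" using W[of 0] by linarith
  obtain M where M0: "0 \<le> M"
    "\<forall>f c. set_borel_measurable lebesgue {0..<1} f \<longrightarrow> L1_norm f \<le> ennreal c \<longrightarrow> 0 < c
      \<longrightarrow> op_bound \<nu> f (ennreal (c * M))"
    by (rule bounded_hilbert_opE[OF \<nu> b])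
  define C where "C = K * M + 2 * (K * (W + B))"
  have "op_bound \<omega> f (ennreal C)"
    if f: "set_borel_measurable lebesgue {0..<1} f" "\<forall>t\<in>{0..<1}. cmod (f t) \<le> K / (1 - t)\<^sup>2" "L1_norm f \<le> ennreal K" for f
  proof -
    have f_meas: "(\<lambda>t. indicator {0..<1} t *\<^sub>R f t) \<in> borel_measurable lebesgue"
      using f(1) by (simp add: set_borel_measurable_def)
    have fs_int: "set_integrable lebesgue {0..<1} (\<lambda>t. f t * of_real (s t))"
    proof (rule set_integrable_bound)
      show "set_integrable lebesgue {0..<1} (\<lambda>t. K * (s t * (t ^ 0 / (1 - t)\<^sup>2)))"
        by (intro set_integrable_mult_right u_int[rule_format])
      have "(\<lambda>t. (indicator {0..<1} t *\<^sub>R f t) * complex_of_real (s t)) \<in> borel_measurable lebesgue"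
        using s(1) by (intro borel_measurable_times[OF f_meas] borel_measurable_of_real measurable_completion) simp
      then show "set_borel_measurable lebesgue {0..<1} (\<lambda>t. f t * complex_of_real (s t))"
        by (simp add: set_borel_measurable_def)
      show "AE t in lebesgue. t \<in> {0..<1} \<longrightarrow> cmod (f t * of_real (s t)) \<le> norm (K * (s t * (t ^ 0 / (1 - t)\<^sup>2)))"
      proof (intro AE_I2 impI)
        fix t :: real assume t: "t \<in> {0..<1}"
        have "cmod (f t * of_real (s t)) = cmod (f t) * s t" using s(2) by (simp add: norm_mult)
        also have "\<dots> \<le> K / (1 - t)\<^sup>2 * s t" using f(2) s(2) t by (intro mult_right_mono) auto
        finally show "cmod (f t * of_real (s t)) \<le> norm (K * (s t * (t ^ 0 / (1 - t)\<^sup>2)))"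
          using s(2) K by (simp add: abs_mult mult.commute)
      qed
    qed
    have fs_bound: "cmod (LINT t:{0..<1}|lebesgue. t ^ n *\<^sub>R (f t * of_real (s t))) \<le> K * u n" for n
    proof -
      have "cmod (LINT t:{0..<1}|lebesgue. t ^ n *\<^sub>R (f t * of_real (s t))) \<le>
         (LINT t:{0..<1}|lebesgue. K * (s t * (t ^ n / (1 - t)\<^sup>2)))"
      proof (rule set_lebesgue_integral_norm_bound)
        show "set_integrable lebesgue {0..<1} (\<lambda>t. t ^ n *\<^sub>R (f t * of_real (s t)))"
          by (rule set_integrable_bounded_scaleR[OF fs_int, of _ 1]) (auto simp: power_le_one)
        show "set_integrable lebesgue {0..<1} (\<lambda>t. K * (s t * (t ^ n / (1 - t)\<^sup>2)))"
          by (intro set_integrable_mult_right u_int[rule_format])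
        fix t :: real assume t: "t \<in> {0..<1}"
        have "norm (t ^ n *\<^sub>R (f t * of_real (s t))) = cmod (f t) * (t ^ n * s t)"
          using s(2) t by (simp add: norm_mult)
        also have "\<dots> \<le> K / (1 - t)\<^sup>2 * (t ^ n * s t)"
          using f(2) s(2) t by (intro mult_right_mono) auto
        finally show "norm (t ^ n *\<^sub>R (f t * of_real (s t))) \<le> K * (s t * (t ^ n / (1 - t)\<^sup>2))"
          by (simp add: mult_ac)
      qed
      then show ?thesis unfolding u_def by (simp only: set_integral_mult_right)
    qed
    have nu_meas: "(\<lambda>t. indicator {0..<1} t *\<^sub>R \<nu> t) \<in> borel_measurable lebesgue"
      using \<nu> by (auto simp: radial_weight_def set_integrable_def)
    have nu_eq: "indicator {0..<1} t *\<^sub>R (t ^ n *\<^sub>R (f t * of_real (\<nu> t))) =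
       (t ^ n) *\<^sub>R ((indicator {0..<1} t *\<^sub>R f t) * of_real (indicator {0..<1} t *\<^sub>R \<nu> t))" for n t
      by (auto simp: indicator_def)
    have nu_meas': "(\<lambda>t. indicator {0..<1} t *\<^sub>R (t ^ n *\<^sub>R (f t * of_real (\<nu> t)))) \<in> borel_measurable lebesgue" for n
      unfolding nu_eq
      by (intro borel_measurable_scaleR borel_measurable_times[OF f_meas] measurable_compose[OF nu_meas borel_measurable_of_real]
        measurable_completion) simp
    \<comment> \<open>The bound on \<open>\<nu>\<close> holds only almost everywhere, hence the
      comparison under the integral sign. Working with nonnegative integrals yields integrability of
      \<open>t^n f \<nu>\<close> and the bound on its integral together.\<close>
    have nn_bound: "(\<integral>\<^sup>+t. norm (indicator {0..<1} t *\<^sub>R (t ^ n *\<^sub>R (f t * of_real (\<nu> t)))) \<partial>lebesgue) \<le> ennreal (B * K)" for n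
    proof -
      have "(\<integral>\<^sup>+t. norm (indicator {0..<1} t *\<^sub>R (t ^ n *\<^sub>R (f t * of_real (\<nu> t)))) \<partial>lebesgue) \<le>
        (\<integral>\<^sup>+t. ennreal B * ennreal (norm (indicator {0..<1} t *\<^sub>R f t)) \<partial>lebesgue)"
        using B(1)
      proof (intro nn_integral_mono_AE, eventually_elim)
        fix t assume le: "t \<in> {0..<1} \<longrightarrow> \<nu> t \<le> B"
        show "ennreal (norm (indicator {0..<1} t *\<^sub>R (t ^ n *\<^sub>R (f t * of_real (\<nu> t))))) \<le>
            ennreal B * ennreal (norm (indicator {0..<1} t *\<^sub>R f t))"
        proof (cases "t \<in> {0..<1}")
          case True
          have "0 \<le> \<nu> t" using \<nu> True by (simp add: radial_weight_def)
          then have "t ^ n * (cmod (f t) * \<nu> t) \<le> 1 * (cmod (f t) * B)"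
            using True le by (intro mult_mono power_le_one) auto
          then show ?thesis
            using True \<open>0 \<le> \<nu> t\<close> B(2) by (simp add: norm_mult mult_ac flip: ennreal_mult)
        qed simp
      qed
      also have "\<dots> = ennreal B * (\<integral>\<^sup>+t. ennreal (norm (indicator {0..<1} t *\<^sub>R f t)) \<partial>lebesgue)"
      proof (rule nn_integral_cmult)
        note [measurable] = f_meas
        show "(\<lambda>t. ennreal (norm (indicator {0..<1} t *\<^sub>R f t))) \<in> borel_measurable lebesgue" by measurable
      qed
      also have "(\<integral>\<^sup>+t. ennreal (norm (indicator {0..<1} t *\<^sub>R f t)) \<partial>lebesgue) = L1_norm f"
        unfolding L1_norm_def by (intro nn_integral_cong) (auto simp: indicator_def)
      also have "ennreal B * L1_norm f \<le> ennreal B * ennreal K" by (intro mult_left_mono f) auto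
      also have "\<dots> = ennreal (B * K)" using B K by (simp add: ennreal_mult)
      finally show ?thesis .
    qed
    have f\<nu>_int: "set_integrable lebesgue {0..<1} (\<lambda>t. f t * of_real (\<nu> t))"
      using nu_meas'[of 0] nn_bound[of 0] unfolding set_integrable_def
      by (intro integrableI_bounded) (auto intro: le_less_trans)
    have f\<nu>n_int: "set_integrable lebesgue {0..<1} (\<lambda>t. t ^ n *\<^sub>R (f t * of_real (\<nu> t)))" for n
      by (rule set_integrable_bounded_scaleR[OF f\<nu>_int, of _ 1]) (auto simp: power_le_one)
    have fsn_int: "set_integrable lebesgue {0..<1} (\<lambda>t. t ^ n *\<^sub>R (f t * of_real (s t)))" for n
      by (rule set_integrable_bounded_scaleR[OF fs_int, of _ 1]) (auto simp: power_le_one)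
    have f\<nu>_bound: "cmod (LINT t:{0..<1}|lebesgue. t ^ n *\<^sub>R (f t * of_real (\<nu> t))) \<le> B * K" for n
    proof -
      have "ennreal (cmod (LINT t:{0..<1}|lebesgue. t ^ n *\<^sub>R (f t * of_real (\<nu> t)))) \<le> ennreal (B * K)"
        unfolding set_lebesgue_integral_def
        using integral_norm_bound_ennreal[OF f\<nu>n_int[of n, unfolded set_integrable_def]] nn_bound[of n]
        by (rule order_trans)
      then show ?thesis using B K by (simp add: ennreal_le_iff)
    qed
    have split: "f t * complex_of_real (\<omega> t) = f t * of_real (\<nu> t) + f t * of_real (s t)" for t
      by (simp add: \<omega>_def algebra_simps)
    have f\<omega>_int: "set_integrable lebesgue {0..<1} (\<lambda>t. f t * of_real (\<omega> t))"
      unfolding split by (intro set_integral_add f\<nu>_int fs_int)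
    define a where "a n = (LINT t:{0..<1}|lebesgue. t ^ n *\<^sub>R (f t * of_real (s t)))" for n
    define b where "b n = (LINT t:{0..<1}|lebesgue. t ^ n *\<^sub>R (f t * of_real (\<nu> t)))" for n
    have ab: "(LINT t:{0..<1}|lebesgue. t ^ n *\<^sub>R (f t * of_real (\<omega> t))) = b n + a n" for n
      unfolding split a_def b_def scaleR_add_right by (intro set_integral_add f\<nu>n_int fsn_int)
    obtain h where h: "hilbert_op \<omega> f = Some h"
      "\<forall>z\<in>ball 0 1. (\<lambda>n. of_real (kernel_coeff \<omega> n) * (b n + a n) * z ^ n) sums h z"
      using hilbert_op_expansion[OF \<omega> f\<omega>_int] unfolding ab by blast
    obtain h0 where h0: "hilbert_op \<nu> f = Some h0"
      "\<forall>z\<in>ball 0 1. (\<lambda>n. of_real (kernel_coeff \<nu> n) * b n * z ^ n) sums h0 z"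
      using hilbert_op_expansion[OF \<nu> f\<nu>_int] unfolding b_def by blast
    have "N h0 \<le> ennreal (K * M)"
      using M0(2)[rule_format, OF f(1,3) K] h0(1) by (auto simp: op_bound_def)
    define d where "d n = of_real (kernel_coeff \<omega> n) * (b n + a n) - of_real (kernel_coeff \<nu> n) * b n" for n
    define g where "g z = h z - h0 z" for z
    have g_sums: "(\<lambda>n. d n * z ^ n) sums g z" if "z \<in> ball 0 1" for z
      using sums_diff[OF h(2)[rule_format, OF that] h0(2)[rule_format, OF that]]
      by (simp add: d_def g_def algebra_simps)
    have d_bound: "real (n + 1) * cmod (d n) \<le> K * (W + B) * (real (n + 1) / (odd_moment \<nu> n)\<^sup>2 * u n)" for n
    proof -
      define p q where "p = odd_moment \<nu> n" and "q = odd_moment \<omega> n"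
      have p: "0 < p" "p \<le> W" using W[of n] by (auto simp: p_def)
      have q: "q = p + e n" by (simp only: p_def q_def \<omega>_moment)
      have pq: "p \<le> q" "0 < q" using q p e_nonneg[of n] by auto
      \<comment> \<open>Grouped so that each term contains one small factor: \<open>a n\<close>, the
        integral against the spikes, or the change of the kernel coefficient.\<close>
      have "d n = of_real (kernel_coeff \<omega> n) * a n - of_real (kernel_coeff \<nu> n - kernel_coeff \<omega> n) * b n"
        by (simp add: d_def algebra_simps)
      also have "cmod \<dots> \<le> kernel_coeff \<omega> n * cmod (a n) + \<bar>kernel_coeff \<nu> n - kernel_coeff \<omega> n\<bar> * cmod (b n)"
        using kernel_coeff_pos[OF \<omega>, of n] by (intro order_trans[OF norm_triangle_ineq4]) (simp add: norm_mult flip: of_real_diff)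
      finally have "real (n + 1) * cmod (d n) \<le>
        real (n + 1) * (kernel_coeff \<omega> n * cmod (a n) + \<bar>kernel_coeff \<nu> n - kernel_coeff \<omega> n\<bar> * cmod (b n))"
        by (intro mult_left_mono) auto
      also have "\<dots> = (real (n + 1) * kernel_coeff \<omega> n) * cmod (a n) + \<bar>real (n + 1) * kernel_coeff \<nu> n - real (n + 1) * kernel_coeff \<omega> n\<bar> * cmod (b n)"
      proof -
        have "\<bar>m * x - m * y\<bar> = m * \<bar>x - y\<bar>" if "0 \<le> m" for m x y :: real
          using that by (simp add: abs_mult flip: right_diff_distrib)
        then show ?thesis by (simp only: of_nat_0_le_iff distrib_left mult.assoc)
      qed
      also have "real (n + 1) * kernel_coeff \<omega> n = 1 / (2 * q)"
        by (simp add: kernel_coeff_def q_def del: of_nat_add of_nat_Suc)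
      also have "real (n + 1) * kernel_coeff \<nu> n = 1 / (2 * p)"
        by (simp add: kernel_coeff_def p_def del: of_nat_add of_nat_Suc)
      also have "1 / (2 * p) - 1 / (2 * q) = e n / (2 * p * q)"
        using p pq by (simp add: q field_simps)
      also have "\<bar>e n / (2 * p * q)\<bar> = e n / (2 * p * q)" using p pq e_nonneg[of n] by simp
      also have "1 / (2 * q) * cmod (a n) + e n / (2 * p * q) * cmod (b n) \<le>
         W / p\<^sup>2 * (K * u n) + u n / p\<^sup>2 * (B * K)"
      \<comment> \<open>Both terms are brought to the denominator \<open>p\<^sup>2\<close>: the
        first through \<open>1 / p = p / p\<^sup>2 \<le> W / p\<^sup>2\<close>, the second through
        \<open>p \<le> q\<close> and \<open>e n \<le> u n\<close>.\<close>
      proof (intro add_mono mult_mono)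
        have "1 / (2 * q) \<le> 1 / p" using p pq by (intro divide_left_mono) auto
        also have "\<dots> = p / p\<^sup>2" by (simp add: power2_eq_square)
        also have "\<dots> \<le> W / p\<^sup>2" using p by (intro divide_right_mono) auto
        finally show "1 / (2 * q) \<le> W / p\<^sup>2" .
        show "e n / (2 * p * q) \<le> u n / p\<^sup>2"
          unfolding power2_eq_square using p pq e_nonneg e_le u_nonneg by (intro frac_le mult_mono) auto
      qed (use p pq W0 u_nonneg fs_bound f\<nu>_bound in \<open>auto simp: a_def b_def\<close>)
      also have "\<dots> = K * (W + B) * (1 / p\<^sup>2 * u n)" by (simp add: algebra_simps add_divide_distrib)
      also have "\<dots> \<le> K * (W + B) * (real (n + 1) / p\<^sup>2 * u n)"
        using K W0 B(2) u_nonneg[of n] by (intro mult_left_mono mult_right_mono divide_right_mono) auto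
      finally show ?thesis by (simp add: p_def)
    qed
    have psum: "(\<Sum>k<n. real (k + 1) * cmod (d k)) \<le> K * (W + B)" for n
    proof -
      have "(\<Sum>k<n. real (k + 1) * cmod (d k)) \<le> (\<Sum>k<n. K * (W + B) * (real (k + 1) / (odd_moment \<nu> k)\<^sup>2 * u k))"
        by (intro sum_mono d_bound)
      also have "\<dots> = K * (W + B) * (\<Sum>k<n. real (k + 1) / (odd_moment \<nu> k)\<^sup>2 * u k)"
        by (simp add: sum_distrib_left)
      also have "\<dots> \<le> K * (W + B) * 1"
        using u_sum K W0 B(2) by (intro mult_left_mono) (auto simp: u_def)
      finally show ?thesis by simp
    qed
    have d_summable: "summable (\<lambda>n. real (n + 1) * cmod (d n))"
      by (intro summableI_nonneg_bounded[where x = "K * (W + B)"] psum) auto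
    have "N g \<le> ennreal (2 * (\<Sum>n. real (n + 1) * cmod (d n)))"
      by (rule series[OF d_summable g_sums])
    also have "\<dots> \<le> ennreal (2 * (K * (W + B)))"
      using suminf_le_const[OF d_summable psum] by (intro ennreal_leI mult_left_mono) auto
    finally have Ng: "N g \<le> ennreal (2 * (K * (W + B)))" .
    have hol: "h holomorphic_on ball 0 1" "h0 holomorphic_on ball 0 1"
      using hilbert_op_holomorphic \<omega> \<nu> h(1) h0(1) by blast+
    have "N h \<le> ennreal (cmod 1) * N h0 + N g"
      using hol by (intro triangle) (auto simp: g_def[abs_def] intro!: holomorphic_intros)
    also have "\<dots> \<le> ennreal (K * M) + ennreal (2 * (K * (W + B)))"
      using \<open>N h0 \<le> _\<close> Ng by (intro add_mono) auto
    also have "\<dots> = ennreal C"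
      unfolding C_def using K M0(1) W0 B(2) by (intro ennreal_plus[symmetric]) auto
    finally show ?thesis using h(1) by (auto simp: op_bound_def)
  qed
  then show thesis by (intro that[of C]) (simp add: \<omega>_def)
qed

end

section \<open>The perturbed weight for an arbitrary pair of admissible norms\<close>

lemma exists_perturbed_weight:
  assumes X: "admissible_norm NX" and Y: "admissible_norm NY"
    and \<nu>: "radial_weight \<nu>" and Q: "Q \<in> {hilbert_op \<nu>, hilbert_abs_op \<nu>}"
    and b: "bounded_op L1_space (analytic_space NY) Q"
  shows "\<exists>\<omega>. radial_weight \<omega> \<and>
           comparable_on {0..<1} (weight_hat \<omega>) (weight_hat \<nu>) \<and>
           (\<forall>r\<^sub>0\<in>{0<..<1}. ess_bounded_on {0..r\<^sub>0} \<omega>) \<and>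
           (\<forall>T\<in>{hilbert_op \<omega>, hilbert_abs_op \<omega>}.
              bounded_op (analytic_space NX) (analytic_space NY) (\<lambda>f. T (radius_restrict f)) \<and>
              \<not> bounded_op L1_space (analytic_space NY) T)"
proof -
  interpret X: admissible_norm NX by (rule X)
  interpret Y: admissible_norm NY by (rule Y)
  have b': "bounded_op L1_space (analytic_space NY) (hilbert_op \<nu>)"
    using Q b Y.bounded_hilbert_op_if_abs[OF \<nu>] by auto
  obtain B0 where B0: "AE t in lebesgue. t \<in> {0..<1} \<longrightarrow> \<nu> t \<le> B0"
    by (rule Y.bounded_hilbert_op_imp_AE_bounded[OF \<nu> Q b])
  define B where "B = max B0 0"
  have B: "AE t in lebesgue. t \<in> {0..<1} \<longrightarrow> \<nu> t \<le> B" "0 \<le> B"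
    using B0 by (auto simp: B_def elim: eventually_mono)
  obtain s where s: "s \<in> borel_measurable borel" "\<forall>t. 0 \<le> s t"
    "\<forall>r<1. \<exists>M. \<forall>t\<le>r. s t \<le> M"
    "\<forall>K. \<exists>a b. 0 \<le> a \<and> a < b \<and> b \<le> 1 \<and> (\<forall>t\<in>{a..<b}. K \<le> s t)"
    "set_integrable lebesgue {0..<1} s"
    "\<forall>r\<in>{0..<1}. weight_hat s r \<le> weight_hat \<nu> r"
    "\<forall>n. set_integrable lebesgue {0..<1} (\<lambda>t. s t * (t ^ n / (1 - t)\<^sup>2))"
    "\<forall>n. (\<Sum>k<n. real (k + 1) / (odd_moment \<nu> k)\<^sup>2 * (LINT t:{0..<1}|lebesgue. s t * (t ^ k / (1 - t)\<^sup>2))) \<le> 1"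
    by (rule small_perturbation[OF \<nu>])
  define \<omega> where "\<omega> t = \<nu> t + s t" for t
  have \<nu>_int: "set_integrable lebesgue {0..<1} \<nu>" and \<nu>_nonneg: "\<And>t. t \<in> {0..<1} \<Longrightarrow> 0 \<le> \<nu> t"
    and \<nu>_pos: "\<And>t. t \<in> {0..<1} \<Longrightarrow> 0 < weight_hat \<nu> t"
    using \<nu> by (auto simp: radial_weight_def)
  have hat: "weight_hat \<omega> r = weight_hat \<nu> r + weight_hat s r" if "r \<in> {0..<1}" for r
    unfolding weight_hat_def \<omega>_def using that
    by (intro set_integral_add set_integrable_subset[OF \<nu>_int] set_integrable_subset[OF s(5)]) auto
  have s_hat: "0 \<le> weight_hat s r" for r
    unfolding weight_hat_def set_lebesgue_integral_def using s(2)
    by (intro Bochner_Integration.integral_nonneg) (auto simp: indicator_def)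
  have \<omega>_int: "set_integrable lebesgue {0..<1} \<omega>"
    unfolding \<omega>_def by (intro set_integral_add \<nu>_int s(5))
  have \<omega>: "radial_weight \<omega>"
    unfolding radial_weight_def
    using \<omega>_int hat \<nu>_pos s_hat \<nu>_nonneg s(2) by (auto simp: \<omega>_def add_pos_nonneg)
  have comp: "comparable_on {0..<1} (weight_hat \<omega>) (weight_hat \<nu>)"
    unfolding comparable_on_def
  \<comment> \<open>The constant 2 works because \<open>weight_hat s\<close> lies between 0 and
    \<open>weight_hat \<nu>\<close>.\<close>
  proof (intro exI[of _ 2] conjI ballI)
    fix t :: real assume t: "t \<in> {0..<1}"
    have "weight_hat s t \<le> weight_hat \<nu> t" using s(6) t by blast
    then show "inverse 2 * weight_hat \<omega> t \<le> weight_hat \<nu> t" "weight_hat \<nu> t \<le> 2 * weight_hat \<omega> t"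
      using hat[OF t] s_hat[of t] \<nu>_pos[OF t] by auto
  qed simp
  have ess: "ess_bounded_on {0..r} \<omega>" if r: "r \<in> {0<..<1}" for r
    unfolding ess_bounded_on_def
  proof
    have "set_integrable lebesgue {0..r} \<omega>"
      using r by (intro set_integrable_subset[OF \<omega>_int]) auto
    then show "set_borel_measurable lebesgue {0..r} \<omega>"
      by (auto simp: set_integrable_def set_borel_measurable_def)
    obtain M where M: "\<forall>t\<le>r. s t \<le> M" using s(3) r by auto
    have "AE t in lebesgue. t \<in> {0..r} \<longrightarrow> \<bar>\<omega> t\<bar> \<le> B + M"
      using B(1)
    proof eventually_elim
      fix t assume t: "t \<in> {0..<1} \<longrightarrow> \<nu> t \<le> B"
      show "t \<in> {0..r} \<longrightarrow> \<bar>\<omega> t\<bar> \<le> B + M"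
      proof
        assume "t \<in> {0..r}"
        then have "t \<in> {0..<1}" "s t \<le> M" using r M by auto
        then show "\<bar>\<omega> t\<bar> \<le> B + M" using t \<nu>_nonneg[of t] s(2)[rule_format, of t] by (auto simp: \<omega>_def)
      qed
    qed
    then show "\<exists>M. AE t in lebesgue. t \<in> {0..r} \<longrightarrow> \<bar>\<omega> t\<bar> \<le> M" ..
  qed
  have not_bdd: "\<not> bounded_op L1_space (analytic_space NY) T" if T: "T \<in> {hilbert_op \<omega>, hilbert_abs_op \<omega>}" for T
  proof
    assume "bounded_op L1_space (analytic_space NY) T"
    then obtain L where L: "AE t in lebesgue. t \<in> {0..<1} \<longrightarrow> \<omega> t \<le> L"
      by (rule Y.bounded_hilbert_op_imp_AE_bounded[OF \<omega> T])
    \<comment> \<open>A spike higher than the alleged essential bound \<open>L\<close>: its base is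
      a nondegenerate interval, so it cannot be a null set.\<close>
    obtain a c where ac: "0 \<le> a" "a < c" "c \<le> 1" "\<forall>t\<in>{a..<c}. L + 1 \<le> s t" using s(4) by blast
    have "AE t in lebesgue. t \<notin> {a..<c}"
      using L
    proof eventually_elim
      fix t assume t: "t \<in> {0..<1} \<longrightarrow> \<omega> t \<le> L"
      show "t \<notin> {a..<c}"
      proof
        assume tc: "t \<in> {a..<c}"
        then have "t \<in> {0..<1}" "L + 1 \<le> s t" using ac by auto
        then show False using t \<nu>_nonneg[of t] by (auto simp: \<omega>_def)
      qed
    qed
    then have "emeasure lebesgue {a..<c} = 0"
    proof -
      have "{t \<in> space lebesgue. \<not> t \<notin> {a..<c}} = {a..<c}" by auto
      from AE_iff_measurable[OF _ this] \<open>AE t in lebesgue. t \<notin> {a..<c}\<close> show ?thesis by simp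
    qed
    then show False using ac by simp
  qed
  have main: "\<exists>C. \<forall>f\<in>fst (analytic_space NX). NX f \<le> ennreal K \<longrightarrow>
      Y.op_bound \<omega> (radius_restrict f) (ennreal C) \<and>
      Y.op_bound \<omega> (\<lambda>t. of_real (cmod (radius_restrict f t))) (ennreal C)" if K: "0 < K" for K
  proof -
    \<comment> \<open>The value \<open>8 * K\<close> covers both source estimates, the growth
      constant \<open>4 * K\<close> and the L^1 bound \<open>8 * K\<close>.\<close>
    obtain C where C: "\<forall>f. set_borel_measurable lebesgue {0..<1} f \<longrightarrow>
      (\<forall>t\<in>{0..<1}. cmod (f t) \<le> 8 * K / (1 - t)\<^sup>2) \<longrightarrow> L1_norm f \<le> ennreal (8 * K) \<longrightarrow>
      Y.op_bound (\<lambda>t. \<nu> t + s t) f (ennreal C)"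
      by (rule Y.perturbed_op_bound[OF \<nu> \<omega>[unfolded \<omega>_def[abs_def]] b' B s(1,2,5,7,8), of "8 * K"])
        (use K in auto)
    have "Y.op_bound \<omega> (radius_restrict f) (ennreal C) \<and>
      Y.op_bound \<omega> (\<lambda>t. of_real (cmod (radius_restrict f t))) (ennreal C)"
      if f: "f \<in> fst (analytic_space NX)" "NX f \<le> ennreal K" for f
    proof -
      have hol: "f holomorphic_on ball 0 1" using f by (simp add: analytic_space_def)
      have "continuous_on {0..<1} (\<lambda>t. f (of_real t))"
        by (intro continuous_on_compose2[OF holomorphic_on_imp_continuous_on[OF hol]] continuous_intros) auto
      then have "(\<lambda>t. indicator {0..<1} t *\<^sub>R radius_restrict f t) \<in> borel_measurable borel"
        unfolding radius_restrict_def by (intro borel_measurable_continuous_on_indicator) auto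
      then have m: "(\<lambda>t. indicator {0..<1} t *\<^sub>R radius_restrict f t) \<in> borel_measurable lebesgue"
        by (intro measurable_completion) simp
      \<comment> \<open>The modulus of the restriction obeys the same growth and norm bounds as the
        restriction, so with its measurability the constant \<open>C\<close> serves both
        operators.\<close>
      then have "(\<lambda>t. complex_of_real (cmod (indicator {0..<1} t *\<^sub>R radius_restrict f t))) \<in> borel_measurable lebesgue"
        by measurable
      also have "(\<lambda>t. complex_of_real (cmod (indicator {0..<1} t *\<^sub>R radius_restrict f t))) =
          (\<lambda>t. indicator {0..<1} t *\<^sub>R complex_of_real (cmod (radius_restrict f t)))"
        by (auto simp: indicator_def)
      finally have m': "set_borel_measurable lebesgue {0..<1} (\<lambda>t. complex_of_real (cmod (radius_restrict f t)))"
        by (simp add: set_borel_measurable_def)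
      have bd: "cmod (radius_restrict f t) \<le> 8 * K / (1 - t)\<^sup>2" if t: "t \<in> {0..<1}" for t
      proof -
        have "ennreal (cmod (radius_restrict f t)) \<le> ennreal (4 / (1 - t)\<^sup>2) * NX f"
          unfolding radius_restrict_def by (rule X.radial_bound[OF hol t])
        also have "\<dots> \<le> ennreal (4 / (1 - t)\<^sup>2) * ennreal K" by (intro mult_left_mono f) auto
        also have "\<dots> = ennreal (4 / (1 - t)\<^sup>2 * K)" using K by (intro ennreal_mult[symmetric]) auto
        finally have "cmod (radius_restrict f t) \<le> 4 / (1 - t)\<^sup>2 * K" using K by (simp add: ennreal_le_iff)
        also have "\<dots> \<le> 8 * K / (1 - t)\<^sup>2" using K by (simp add: divide_right_mono)
        finally show ?thesis .
      qed
      have "L1_norm (radius_restrict f) \<le> ennreal 8 * ennreal K"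
        using order_trans[OF X.L1_bound[OF hol] mult_left_mono[OF f(2)]] by simp
      then have L: "L1_norm (radius_restrict f) \<le> ennreal (8 * K)" using K by (simp add: ennreal_mult)
      have "L1_norm (\<lambda>t. of_real (cmod (radius_restrict f t))) = L1_norm (radius_restrict f)"
        by (simp add: L1_norm_def)
      with C m m' bd L show ?thesis
        by (auto simp: \<omega>_def[abs_def] set_borel_measurable_def)
    qed
    then show ?thesis by blast
  qed
  have norm_ex: "\<exists>K>0. NX f \<le> ennreal K" if "f \<in> fst (analytic_space NX)" for f
    using that by (intro exI[of _ "enn2real (NX f) + 1"])
      (auto simp: analytic_space_def ennreal_plus add_nonneg_pos)
  obtain C1 where C1: "\<forall>f\<in>fst (analytic_space NX). NX f \<le> ennreal 1 \<longrightarrow>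
      Y.op_bound \<omega> (radius_restrict f) (ennreal C1) \<and>
      Y.op_bound \<omega> (\<lambda>t. of_real (cmod (radius_restrict f t))) (ennreal C1)"
    using main[of 1] by auto
  have 1: "bounded_op (analytic_space NX) (analytic_space NY) (\<lambda>f. hilbert_op \<omega> (radius_restrict f))"
  proof (rule Y.bounded_hilbert_opI[OF \<omega>, where M = "ennreal C1"])
    fix f assume f: "f \<in> fst (analytic_space NX)"
    then obtain K where "K > 0" "NX f \<le> ennreal K" using norm_ex by blast
    then show "\<exists>M<\<infinity>. Y.op_bound \<omega> (radius_restrict f) M"
      using main[of K] f by (metis ennreal_less_top infinity_ennreal_def)
  qed (use C1 in \<open>auto simp: analytic_space_def\<close>)
  have 2: "bounded_op (analytic_space NX) (analytic_space NY) (\<lambda>f. hilbert_op \<omega> (\<lambda>t. of_real (cmod (radius_restrict f t))))"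
  proof (rule Y.bounded_hilbert_opI[OF \<omega>, where M = "ennreal C1"])
    fix f assume f: "f \<in> fst (analytic_space NX)"
    then obtain K where "K > 0" "NX f \<le> ennreal K" using norm_ex by blast
    then show "\<exists>M<\<infinity>. Y.op_bound \<omega> (\<lambda>t. of_real (cmod (radius_restrict f t))) M"
      using main[of K] f by (metis ennreal_less_top infinity_ennreal_def)
  qed (use C1 in \<open>auto simp: analytic_space_def\<close>)
  show ?thesis
    using \<omega> comp ess not_bdd 1 2 by (intro exI[of _ \<omega>]) (auto simp: hilbert_abs_op_def)
qed

subsection \<open>The four spaces\<close>

lemma taylor_coeff_sums:
  assumes "f holomorphic_on ball 0 1" "z \<in> ball 0 1"
  shows "(\<lambda>n. taylor_coeff f n * z ^ n) sums f z"
  using holomorphic_power_series[OF assms] by (simp add: taylor_coeff_def)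

lemma taylor_coeff_eqI:
  assumes "\<And>z. z \<in> ball 0 1 \<Longrightarrow> (\<lambda>n. d n * z ^ n) sums f z"
  shows "taylor_coeff f n = d n"
proof -
  have "eventually (\<lambda>z. z \<in> ball (0::complex) 1) (nhds 0)"
    by (rule eventually_nhds_in_open) auto
  then have "\<forall>\<^sub>F z in nhds 0. (\<lambda>n. fps_nth (Abs_fps d) n * z ^ n) sums f z"
    by eventually_elim (use assms in simp)
  from fps_nth_fps_expansion[OF has_fps_expansionI[OF this], of n] show ?thesis
    by (simp add: taylor_coeff_def)
qed

lemma power_series_norm_le:
  fixes d :: "nat \<Rightarrow> complex"
  assumes d: "summable (\<lambda>n. real (n + 1) * cmod (d n))" and f: "(\<lambda>n. d n * z ^ n) sums w" and z: "z \<in> ball 0 1"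
  shows "cmod w \<le> (\<Sum>n. real (n + 1) * cmod (d n))"
proof -
  have le: "cmod (d n * z ^ n) \<le> real (n + 1) * cmod (d n)" for n
  proof -
    have "cmod (d n) * cmod z ^ n \<le> cmod (d n) * 1"
      using z by (intro mult_left_mono power_le_one) auto
    also have "\<dots> \<le> real (n + 1) * cmod (d n)" by (simp add: algebra_simps)
    finally show ?thesis by (simp add: norm_mult norm_power)
  qed
  have s: "summable (\<lambda>n. cmod (d n * z ^ n))"
    by (rule summable_comparison_test'[OF d, where N = 0]) (use le in auto)
  have "cmod w \<le> (\<Sum>n. cmod (d n * z ^ n))"
    using f summable_norm[OF s] by (simp add: sums_iff)
  also have "\<dots> \<le> (\<Sum>n. real (n + 1) * cmod (d n))" by (intro suminf_le le s d)
  finally show ?thesis .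
qed

text \<open>Three of the spaces yield growth of order \<open>1 / (1 - t)\<close> only. This lifts it
  to the common form in \<open>radial_bound\<close>; it is applied with \<open>c = 1\<close> and
  \<open>c = 1 + t\<close>.\<close>

lemma divide_one_minus_le:
  fixes t c :: real
  assumes "t \<in> {0..<1}" "0 \<le> c" "c \<le> 4"
  shows "c / (1 - t) \<le> 4 / (1 - t)\<^sup>2"
proof -
  have "c / (1 - t) = c * (1 - t) / (1 - t)\<^sup>2"
    using assms by (simp add: power2_eq_square)
  also have "\<dots> \<le> 4 * 1 / (1 - t)\<^sup>2"
    using assms by (intro divide_right_mono mult_mono) auto
  finally show ?thesis by simp
qed

lemma ennreal_le_8_mult: "x \<le> 8 * (x :: ennreal)"
  using mult_right_mono[of 1 8 x] by simp

text \<open>The right-hand side may be infinite, since absolute convergence is not assumed; hence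
  the passage through partial sums.\<close>

lemma ennreal_norm_sums_le:
  fixes a :: "nat \<Rightarrow> 'a::real_normed_vector"
  assumes "a sums w"
  shows "ennreal (norm w) \<le> (\<Sum>n. ennreal (norm (a n)))"
proof -
  have "(\<lambda>n. ennreal (norm (\<Sum>k<n. a k))) \<longlonglongrightarrow> ennreal (norm w)"
    using assms by (intro tendsto_ennrealI tendsto_norm) (simp add: sums_def)
  then show ?thesis
  proof (rule LIMSEQ_le_const2, intro exI allI impI)
    fix n
    have "ennreal (norm (\<Sum>k<n. a k)) \<le> ennreal (\<Sum>k<n. norm (a k))"
      by (intro ennreal_leI norm_sum)
    also have "\<dots> = (\<Sum>k<n. ennreal (norm (a k)))"
      by (simp add: sum_ennreal)
    also have "\<dots> \<le> (\<Sum>n. ennreal (norm (a n)))"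
      by (intro sum_le_suminf summableI) auto
    finally show "ennreal (norm (\<Sum>k<n. a k)) \<le> \<dots>" .
  qed
qed

text \<open>By the maximum principle \<open>|f(t)|\<close> is at most \<open>M_inf r f\<close> for
  every \<open>r\<close> in \<open>[t, 1)\<close>. Integrating over these \<open>r\<close> gives the
  growth bound, and \<open>r = t\<close> gives the L^1 bound.\<close>

lemma H_inf_1_admissible: "admissible_norm (\<lambda>f. \<integral>\<^sup>+r\<in>{0..<1}. M_inf r f \<partial>lborel)"
proof
  let ?N = "\<lambda>f. \<integral>\<^sup>+r\<in>{0..<1}. M_inf r f \<partial>lborel"
  have in_ball: "complex_of_real r * cis \<theta> \<in> ball 0 1" if "r \<in> {0..<1}" for r \<theta>
    using that by (simp add: norm_mult)
  have M_inf_ge: "ennreal (cmod (f (of_real t))) \<le> M_inf r f"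
    if hol: "f holomorphic_on ball 0 1" and t: "0 \<le> t" "t \<le> r" "r < 1" for f t r
  \<comment> \<open>For \<open>r = 0\<close> also \<open>t = 0\<close>, and an infinite supremum
    bounds anything. What remains is a circle of positive radius and a real bound, the setting of
    the maximum modulus principle.\<close>
  proof (cases "r = 0 \<or> M_inf r f = \<infinity>")
    case True
    moreover have "ennreal (cmod (f (of_real 0))) \<le> M_inf 0 f"
      unfolding M_inf_def by (intro SUP_upper2[of 0]) auto
    ultimately show ?thesis using t by auto
  next
    case False
    define B where "B = enn2real (M_inf r f)"
    have B: "M_inf r f = ennreal B" using False by (simp add: B_def less_top)
    have r: "0 < r" using False t by auto
    have "cmod (f (of_real t)) \<le> B"
    proof (rule maximum_modulus_frontier[of f "cball 0 r"])
      show "f holomorphic_on interior (cball 0 r)"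
        using hol by (rule holomorphic_on_subset) (use t in auto)
      show "continuous_on (closure (cball 0 r)) f"
        using holomorphic_on_imp_continuous_on[OF hol] by (rule continuous_on_subset) (use t in auto)
      show "cmod (f z) \<le> B" if "z \<in> frontier (cball 0 r)" for z
      proof -
        have "cmod z = r" using that r by auto
        then have "z = of_real r * cis (Arg z)" using rcis_cmod_Arg[of z] by (simp add: rcis_def)
        then have "ennreal (cmod (f z)) \<le> M_inf r f"
          unfolding M_inf_def by (intro SUP_upper2[of "Arg z"]) auto
        moreover have "0 \<le> B" by (simp add: B_def)
        ultimately show ?thesis by (simp add: B)
      qed
    qed (use t in auto)
    then show ?thesis by (simp add: B ennreal_leI)
  qed
  \<comment> \<open>The supremum runs over uncountably many angles, but its superlevel sets are
    unions of open sets. Radii are taken from the open interval \<open>(-1, 1)\<close> first and cut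
    down to \<open>[0, 1)\<close> afterwards.\<close>
  have meas: "(\<lambda>r. M_inf r f * indicator {0..<1} r) \<in> borel_measurable borel"
    if hol: "f holomorphic_on ball 0 1" for f
  proof (rule borel_measurableI_greater)
    fix y :: ennreal
    have "open ({-1<..<1} \<inter> (\<lambda>r. ennreal (cmod (f (of_real r * cis \<theta>)))) -` {y<..})" for \<theta>
    proof (rule continuous_open_preimage)
      show "continuous_on {-1<..<1} (\<lambda>r. ennreal (cmod (f (of_real r * cis \<theta>))))"
        by (intro continuous_on_ennreal continuous_intros
            continuous_on_compose2[OF holomorphic_on_imp_continuous_on[OF hol]]) (auto simp: norm_mult)
    qed auto
    then have "open (\<Union>\<theta>. {-1<..<1} \<inter> (\<lambda>r. ennreal (cmod (f (of_real r * cis \<theta>)))) -` {y<..})"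
      by blast
    then have "{0..<1} \<inter> (\<Union>\<theta>. {-1<..<1} \<inter> (\<lambda>r. ennreal (cmod (f (of_real r * cis \<theta>)))) -` {y<..}) \<in> sets borel"
      by (intro sets.Int) auto
    also have "{0..<1} \<inter> (\<Union>\<theta>. {-1<..<1} \<inter> (\<lambda>r. ennreal (cmod (f (of_real r * cis \<theta>)))) -` {y<..}) =
       {r \<in> space borel. y < M_inf r f * indicator {0..<1} r}"
      by (auto simp: M_inf_def less_SUP_iff indicator_def)
    finally show "{r \<in> space borel. y < M_inf r f * indicator {0..<1} r} \<in> sets borel" .
  qed
  {
    fix f g h :: "complex \<Rightarrow> complex" and c
    assume hol: "f holomorphic_on ball 0 1" "g holomorphic_on ball 0 1" "h holomorphic_on ball 0 1"
      and eq: "\<And>z. z \<in> ball 0 1 \<Longrightarrow> f z = c * g z + h z"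
    have "M_inf r f \<le> ennreal (cmod c) * M_inf r g + M_inf r h" if r: "r \<in> {0..<1}" for r
      unfolding M_inf_def
    proof (intro SUP_least)
      fix \<theta>
      let ?z = "complex_of_real r * cis \<theta>"
      have "ennreal (cmod (f ?z)) \<le> ennreal (cmod c * cmod (g ?z) + cmod (h ?z))"
        using eq[OF in_ball[OF r]] norm_triangle_ineq[of "c * g ?z" "h ?z"]
        by (intro ennreal_leI) (simp add: norm_mult)
      also have "\<dots> = ennreal (cmod c) * ennreal (cmod (g ?z)) + ennreal (cmod (h ?z))"
        by (simp add: ennreal_mult)
      also have "\<dots> \<le> ennreal (cmod c) * (SUP \<theta>. ennreal (cmod (g (of_real r * cis \<theta>)))) + (SUP \<theta>. ennreal (cmod (h (of_real r * cis \<theta>))))"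
        by (intro add_mono mult_left_mono SUP_upper) auto
      finally show "ennreal (cmod (f ?z)) \<le> \<dots>" .
    qed
    then have "?N f \<le> (\<integral>\<^sup>+r. ennreal (cmod c) * (M_inf r g * indicator {0..<1} r) + M_inf r h * indicator {0..<1} r \<partial>lborel)"
      by (intro nn_integral_mono) (auto simp: indicator_def)
    also have "\<dots> = ennreal (cmod c) * ?N g + ?N h"
      using meas[OF hol(2)] meas[OF hol(3)]
      by (subst nn_integral_add) (auto simp: nn_integral_cmult)
    finally show "?N f \<le> ennreal (cmod c) * ?N g + ?N h" .
  next
    fix d :: "nat \<Rightarrow> complex" and f
    assume d: "summable (\<lambda>n. real (n + 1) * cmod (d n))"
      and f: "\<And>z. z \<in> ball 0 1 \<Longrightarrow> (\<lambda>n. d n * z ^ n) sums f z"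
    let ?S = "\<Sum>n. real (n + 1) * cmod (d n)"
    have S: "0 \<le> ?S" using d by (intro suminf_nonneg) auto
    have "M_inf r f \<le> ennreal (2 * ?S)" if "r \<in> {0..<1}" for r
      unfolding M_inf_def
    proof (intro SUP_least ennreal_leI)
      fix \<theta>
      show "cmod (f (of_real r * cis \<theta>)) \<le> 2 * ?S"
        using power_series_norm_le[OF d f[OF in_ball[OF that, of \<theta>]] in_ball[OF that, of \<theta>]] S by linarith
    qed
    then have "?N f \<le> (\<integral>\<^sup>+r. ennreal (2 * ?S) * indicator {0..<1} (r::real) \<partial>lborel)"
      by (intro nn_integral_mono) (auto simp: indicator_def)
    also have "\<dots> = ennreal (2 * ?S)" by (simp add: nn_integral_cmult_indicator)
    finally show "?N f \<le> ennreal (2 * ?S)" .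
  next
    fix f :: "complex \<Rightarrow> complex" and t :: real
    assume hol: "f holomorphic_on ball 0 1" and t: "t \<in> {0..<1}"
    have "ennreal (1 - t) * ennreal (cmod (f (of_real t))) = (\<integral>\<^sup>+r. ennreal (cmod (f (of_real t))) * indicator {t..<1} r \<partial>lborel)"
      using t by (simp add: nn_integral_cmult_indicator mult.commute)
    also have "\<dots> \<le> ?N f"
      using t M_inf_ge[OF hol] by (intro nn_integral_mono) (auto simp: indicator_def)
    finally have "ennreal (1 / (1 - t)) * (ennreal (1 - t) * ennreal (cmod (f (of_real t)))) \<le> ennreal (1 / (1 - t)) * ?N f"
      by (intro mult_left_mono) auto
    moreover have "ennreal (1 / (1 - t)) * (ennreal (1 - t) * ennreal (cmod (f (of_real t)))) = ennreal (cmod (f (of_real t)))"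
      using t by (simp add: mult.assoc[symmetric] ennreal_mult[symmetric])
    ultimately have "ennreal (cmod (f (of_real t))) \<le> ennreal (1 / (1 - t)) * ?N f"
      by simp
    also have "\<dots> \<le> ennreal (4 / (1 - t)\<^sup>2) * ?N f"
      using divide_one_minus_le[OF t, of 1] by (intro mult_right_mono ennreal_leI) auto
    finally show "ennreal (cmod (f (of_real t))) \<le> ennreal (4 / (1 - t)\<^sup>2) * ?N f" .
  next
    fix f :: "complex \<Rightarrow> complex"
    assume hol: "f holomorphic_on ball 0 1"
    have "L1_norm (radius_restrict f) \<le> ?N f"
      unfolding L1_norm_def nn_integral_completion radius_restrict_def
      using M_inf_ge[OF hol] by (intro nn_integral_mono) (auto simp: indicator_def)
    also have "\<dots> \<le> 8 * ?N f" by (rule ennreal_le_8_mult)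
    finally show "L1_norm (radius_restrict f) \<le> 8 * ?N f" .
  }
qed

text \<open>The norm equals the integral over \<open>[0, 1)\<close> of the series of
  \<open>|a_n| t^n\<close>, because \<open>t^n\<close> integrates to \<open>1 / (n + 1)\<close>;
  this majorizes the L^1 norm of the restriction. Growth follows from
  \<open>(n + 1) t^n \<le> 1 / (1 - t)\<close>.\<close>

lemma Hardy_Littlewood_1_admissible:
  "admissible_norm (\<lambda>f. \<Sum>n. ennreal (cmod (taylor_coeff f n) / real (n + 1)))"
proof
  let ?N = "\<lambda>f. \<Sum>n. ennreal (cmod (taylor_coeff f n) / real (n + 1))"
  {
    fix f g h :: "complex \<Rightarrow> complex" and c
    assume hol: "f holomorphic_on ball 0 1" "g holomorphic_on ball 0 1" "h holomorphic_on ball 0 1"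
      and eq: "\<And>z. z \<in> ball 0 1 \<Longrightarrow> f z = c * g z + h z"
    have "taylor_coeff f n = c * taylor_coeff g n + taylor_coeff h n" for n
    proof (rule taylor_coeff_eqI)
      fix z :: complex assume z: "z \<in> ball 0 1"
      show "(\<lambda>n. (c * taylor_coeff g n + taylor_coeff h n) * z ^ n) sums f z"
        using sums_add[OF sums_mult[OF taylor_coeff_sums[OF hol(2) z], of c] taylor_coeff_sums[OF hol(3) z]] eq[OF z]
        by (simp add: algebra_simps)
    qed
    then have "cmod (taylor_coeff f n) / real (n + 1) \<le>
        cmod c * (cmod (taylor_coeff g n) / real (n + 1)) + cmod (taylor_coeff h n) / real (n + 1)" for n
      using norm_triangle_ineq[of "c * taylor_coeff g n" "taylor_coeff h n"]
      by (simp add: divide_right_mono norm_mult flip: add_divide_distrib)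
    then have "ennreal (cmod (taylor_coeff f n) / real (n + 1)) \<le>
        ennreal (cmod c) * ennreal (cmod (taylor_coeff g n) / real (n + 1)) + ennreal (cmod (taylor_coeff h n) / real (n + 1))" for n
      by (simp add: ennreal_leI flip: ennreal_mult ennreal_plus)
    then have "?N f \<le> (\<Sum>n. ennreal (cmod c) * ennreal (cmod (taylor_coeff g n) / real (n + 1)) + ennreal (cmod (taylor_coeff h n) / real (n + 1)))"
      by (intro suminf_le summableI)
    also have "\<dots> = ennreal (cmod c) * ?N g + ?N h"
      by (subst suminf_add[symmetric]) (auto simp: ennreal_suminf_cmult)
    finally show "?N f \<le> ennreal (cmod c) * ?N g + ?N h" .
  next
    fix d :: "nat \<Rightarrow> complex" and f
    assume d: "summable (\<lambda>n. real (n + 1) * cmod (d n))"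
      and f: "\<And>z. z \<in> ball 0 1 \<Longrightarrow> (\<lambda>n. d n * z ^ n) sums f z"
    have "?N f \<le> (\<Sum>n. ennreal (2 * (real (n + 1) * cmod (d n))))"
    proof (intro suminf_le summableI)
      fix n
      have "cmod (d n) / real (n + 1) \<le> cmod (d n) / 1" by (intro divide_left_mono) auto
      also have "\<dots> \<le> 2 * (real (n + 1) * cmod (d n))" by (simp add: algebra_simps)
      finally show "ennreal (cmod (taylor_coeff f n) / real (n + 1)) \<le> ennreal (2 * (real (n + 1) * cmod (d n)))"
        by (simp only: taylor_coeff_eqI[OF f] ennreal_leI)
    qed
    also have "\<dots> = ennreal (\<Sum>n. 2 * (real (n + 1) * cmod (d n)))"
      using d by (intro suminf_ennreal2 summable_mult) auto
    also have "(\<Sum>n. 2 * (real (n + 1) * cmod (d n))) = 2 * (\<Sum>n. real (n + 1) * cmod (d n))"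
      by (rule suminf_mult[OF d])
    finally show "?N f \<le> ennreal (2 * (\<Sum>n. real (n + 1) * cmod (d n)))" .
  next
    fix f :: "complex \<Rightarrow> complex" and t :: real
    assume hol: "f holomorphic_on ball 0 1" and t: "t \<in> {0..<1}"
    \<comment> \<open>Among the \<open>n + 1\<close> powers \<open>1, t, ..., t^n\<close> the last
      is the smallest, so \<open>(n + 1) t^n\<close> stays below the geometric series.\<close>
    have coeff: "t ^ n \<le> 1 / (1 - t) / real (n + 1)" for n
    proof -
      have "real (n + 1) * t ^ n = (\<Sum>j\<le>n. t ^ n)" by simp
      also have "\<dots> \<le> (\<Sum>j\<le>n. t ^ j)" using t by (intro sum_mono power_decreasing) auto
      also have "\<dots> \<le> (\<Sum>j. t ^ j)" using t by (intro sum_le_suminf summable_geometric) auto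
      also have "\<dots> = 1 / (1 - t)" using t by (intro suminf_geometric) auto
      finally have "t ^ n * real (n + 1) \<le> 1 / (1 - t)" by (simp only: mult.commute)
      moreover have "0 < real (n + 1)" by simp
      ultimately show ?thesis by (simp only: pos_le_divide_eq)
    qed
    have le: "cmod (taylor_coeff f n * of_real t ^ n) \<le> 1 / (1 - t) * (cmod (taylor_coeff f n) / real (n + 1))" for n
      using mult_left_mono[OF coeff, of "cmod (taylor_coeff f n)" n] t by (simp add: norm_mult norm_power mult_ac)
    have "ennreal (cmod (f (of_real t))) \<le> (\<Sum>n. ennreal (cmod (taylor_coeff f n * of_real t ^ n)))"
      using t by (intro ennreal_norm_sums_le taylor_coeff_sums[OF hol]) auto
    also have "\<dots> \<le> (\<Sum>n. ennreal (1 / (1 - t)) * ennreal (cmod (taylor_coeff f n) / real (n + 1)))"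
    proof (intro suminf_le summableI)
      fix n
      have "ennreal (cmod (taylor_coeff f n * of_real t ^ n)) \<le> ennreal (1 / (1 - t) * (cmod (taylor_coeff f n) / real (n + 1)))"
        by (rule ennreal_leI[OF le])
      also have "\<dots> = ennreal (1 / (1 - t)) * ennreal (cmod (taylor_coeff f n) / real (n + 1))"
        using t by (intro ennreal_mult) auto
      finally show "ennreal (cmod (taylor_coeff f n * of_real t ^ n)) \<le> \<dots>" .
    qed
    also have "\<dots> = ennreal (1 / (1 - t)) * ?N f" by (rule ennreal_suminf_cmult)
    also have "\<dots> \<le> ennreal (4 / (1 - t)\<^sup>2) * ?N f"
      using divide_one_minus_le[OF t, of 1] by (intro mult_right_mono ennreal_leI) auto
    finally show "ennreal (cmod (f (of_real t))) \<le> ennreal (4 / (1 - t)\<^sup>2) * ?N f" .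
  next
    fix f :: "complex \<Rightarrow> complex"
    assume hol: "f holomorphic_on ball 0 1"
    have int_pow: "(\<integral>\<^sup>+t. ennreal (t ^ n) * indicator {0..<1} t \<partial>lborel) \<le> ennreal (1 / real (n + 1))" for n
    proof -
      have "((\<lambda>t::real. t ^ n) has_integral (1 ^ Suc n / real (Suc n) - 0 ^ Suc n / real (Suc n))) {0..1}"
        by (intro fundamental_theorem_of_calculus)
          (auto intro!: derivative_eq_intros simp: has_real_derivative_iff_has_vector_derivative[symmetric] simp del: of_nat_Suc power_Suc)
      then have "(\<integral>\<^sup>+t. ennreal (t ^ n) * indicator {0..1} t \<partial>lborel) = ennreal (1 / real (n + 1))"
        by (subst nn_integral_has_integral_lebesgue') (auto simp: add.commute)
      moreover have "(\<integral>\<^sup>+t. ennreal (t ^ n) * indicator {0..<1} t \<partial>lborel) \<le> (\<integral>\<^sup>+t. ennreal (t ^ n) * indicator {0..1} t \<partial>lborel)"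
        by (intro nn_integral_mono) (auto simp: indicator_def)
      ultimately show ?thesis by simp
    qed
    have pt: "ennreal (cmod (f (of_real t))) * indicator {0..<1} t \<le>
       (\<Sum>n. ennreal (cmod (taylor_coeff f n)) * (ennreal (t ^ n) * indicator {0..<1} t))" for t
    proof (cases "t \<in> {0..<1}")
      case t: True
      have "ennreal (cmod (f (of_real t))) \<le> (\<Sum>n. ennreal (cmod (taylor_coeff f n * of_real t ^ n)))"
        using t by (intro ennreal_norm_sums_le taylor_coeff_sums[OF hol]) auto
      also have "\<dots> = (\<Sum>n. ennreal (cmod (taylor_coeff f n)) * ennreal (t ^ n))"
        using t by (intro suminf_cong) (simp add: norm_mult norm_power ennreal_mult)
      finally show ?thesis using t by simp
    qed simp
    have "L1_norm (radius_restrict f) \<le>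
        (\<integral>\<^sup>+t. (\<Sum>n. ennreal (cmod (taylor_coeff f n)) * (ennreal (t ^ n) * indicator {0..<1} t)) \<partial>lborel)"
      unfolding L1_norm_def nn_integral_completion radius_restrict_def by (intro nn_integral_mono pt)
    also have "\<dots> = (\<Sum>n. \<integral>\<^sup>+t. ennreal (cmod (taylor_coeff f n)) * (ennreal (t ^ n) * indicator {0..<1} t) \<partial>lborel)"
      by (intro nn_integral_suminf) measurable
    also have "\<dots> = (\<Sum>n. ennreal (cmod (taylor_coeff f n)) * (\<integral>\<^sup>+t. ennreal (t ^ n) * indicator {0..<1} t \<partial>lborel))"
      by (intro suminf_cong nn_integral_cmult) measurable
    also have "\<dots> \<le> (\<Sum>n. ennreal (cmod (taylor_coeff f n)) * ennreal (1 / real (n + 1)))"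
      by (intro suminf_le summableI mult_left_mono int_pow) auto
    also have "\<dots> = ?N f" by (intro suminf_cong, subst ennreal_mult[symmetric]) auto
    also have "\<dots> \<le> 8 * ?N f" by (rule ennreal_le_8_mult)
    finally show "L1_norm (radius_restrict f) \<le> 8 * ?N f" .
  }
qed

section \<open>Cauchy integrals over circles and the Hardy space\<close>

lemma borel_measurable_norm_indicator:
  fixes f :: "'a::topological_space \<Rightarrow> 'b::real_normed_vector"
  assumes "continuous_on A f" "A \<in> sets borel"
  shows "(\<lambda>x. ennreal (norm (f x)) * indicator A x) \<in> borel_measurable borel"
proof -
  have "(\<lambda>x. indicator A x *\<^sub>R norm (f x)) \<in> borel_measurable borel"
    using assms by (intro borel_measurable_continuous_on_indicator continuous_intros)
  then have "(\<lambda>x. ennreal (indicator A x *\<^sub>R norm (f x))) \<in> borel_measurable borel"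
    by measurable
  also have "(\<lambda>x. ennreal (indicator A x *\<^sub>R norm (f x))) = (\<lambda>x. ennreal (norm (f x)) * indicator A x)"
    by (auto simp: indicator_def)
  finally show ?thesis .
qed

text \<open>A bridge from the gauge integrals produced by Cauchy's formula and the fundamental
  theorem of calculus to the nonnegative Lebesgue integrals in the norms.\<close>

lemma has_integral_norm_le_nn_integral:
  fixes f :: "real \<Rightarrow> complex"
  assumes f: "(f has_integral I) {a..b}" and c: "continuous_on {a..b} f"
  shows "ennreal (norm I) \<le> (\<integral>\<^sup>+x\<in>{a..b}. ennreal (norm (f x)) \<partial>lborel)"
proof -
  have i: "(\<lambda>x. norm (f x)) integrable_on {a..b}"
    by (intro integrable_continuous_interval continuous_intros c)
  have "norm I \<le> integral {a..b} (\<lambda>x. norm (f x))"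
    using integral_norm_bound_integral[of f "{a..b}" "\<lambda>x. norm (f x)"] f i
    by (auto simp: integral_unique has_integral_integrable)
  then have "ennreal (norm I) \<le> ennreal (integral {a..b} (\<lambda>x. norm (f x)))" by (rule ennreal_leI)
  also have "\<dots> = (\<integral>\<^sup>+x\<in>{a..b}. ennreal (norm (f x)) \<partial>lborel)"
    by (rule nn_integral_has_integral_lebesgue'[symmetric]) (use i in auto)
  finally show ?thesis .
qed

text \<open>Cauchy's formula in the angle. The factor \<open>r * cis \<theta>\<close> comes from the
  derivative of the parametrization, whose \<open>\<i>\<close> is cancelled by multiplication with
  \<open>- \<i>\<close>.\<close>

lemma Cauchy_integral_cis:
  fixes f :: "complex \<Rightarrow> complex"
  assumes "continuous_on (cball 0 r) f" "f holomorphic_on ball 0 r" and w: "cmod w < r"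
  shows "((\<lambda>\<theta>. f (r * cis \<theta>) * (r * cis \<theta> / (r * cis \<theta> - w))) has_integral (2 * pi * f w)) {0..2 * pi}"
proof -
  have "((\<lambda>u. f u / (u - w)) has_contour_integral (2 * of_real pi * \<i> * f w)) (part_circlepath 0 r 0 (2 * pi))"
    using Cauchy_integral_circlepath[OF assms(1,2)] w by (simp add: circlepath_def)
  then have "((\<lambda>\<theta>. f (0 + r * cis \<theta>) / (0 + r * cis \<theta> - w) * r * \<i> * cis \<theta>) has_integral (2 * of_real pi * \<i> * f w)) {0..2 * pi}"
    by (subst (asm) has_contour_integral_part_circlepath_iff) auto
  from has_integral_mult_right[OF this, of "- \<i>"] show ?thesis
    by (simp add: algebra_simps)
qed

text \<open>In Cauchy's formula the denominator has modulus at least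
  \<open>r - cmod w\<close>.\<close>

lemma circle_mean_bound:
  assumes f: "f holomorphic_on ball 0 1" and r: "0 < r" "r < 1" and w: "cmod w < r"
  shows "ennreal (cmod (f w)) \<le> ennreal (r / (r - cmod w)) *
    (ennreal (1 / (2 * pi)) * (\<integral>\<^sup>+\<theta>\<in>{0..2 * pi}. ennreal (cmod (f (of_real r * cis \<theta>))) \<partial>lborel))"
proof -
  have cont: "continuous_on (cball 0 r) f"
    using holomorphic_on_imp_continuous_on[OF f] r by (auto intro: continuous_on_subset)
  have hol: "f holomorphic_on ball 0 r" using f r by (auto intro: holomorphic_on_subset)
  have ne: "r * cis \<theta> - w \<noteq> 0" for \<theta>
  proof
    assume "r * cis \<theta> - w = 0"
    then have "w = r * cis \<theta>" by simp
    then have "cmod w = r" using r by (simp add: norm_mult)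
    then show False using w by simp
  qed
  have cont': "continuous_on UNIV (\<lambda>\<theta>. f (of_real r * cis \<theta>))"
    by (intro continuous_on_compose2[OF cont] continuous_intros) (use r in \<open>auto simp: norm_mult\<close>)
  have c: "continuous_on {0..2 * pi} (\<lambda>\<theta>. f (r * cis \<theta>) * (r * cis \<theta> / (r * cis \<theta> - w)))"
    using ne by (intro continuous_intros continuous_on_subset[OF cont']) auto
  have "ennreal (cmod (2 * pi * f w)) \<le> (\<integral>\<^sup>+\<theta>\<in>{0..2 * pi}. ennreal (cmod (f (r * cis \<theta>) * (r * cis \<theta> / (r * cis \<theta> - w)))) \<partial>lborel)"
    by (rule has_integral_norm_le_nn_integral[OF Cauchy_integral_cis[OF cont hol w] c])
  also have "\<dots> \<le> (\<integral>\<^sup>+\<theta>. ennreal (r / (r - cmod w)) * (ennreal (cmod (f (r * cis \<theta>))) * indicator {0..2 * pi} \<theta>) \<partial>lborel)"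
  proof (intro nn_integral_mono)
    fix \<theta> :: real
    have "r - cmod w \<le> cmod (r * cis \<theta> - w)"
      using norm_triangle_ineq2[of "r * cis \<theta>" w] r by (simp add: norm_mult)
    then have "cmod (f (r * cis \<theta>)) * (r / cmod (r * cis \<theta> - w)) \<le> cmod (f (r * cis \<theta>)) * (r / (r - cmod w))"
      using w r by (intro mult_left_mono divide_left_mono mult_pos_pos) auto
    then have "ennreal (cmod (f (r * cis \<theta>) * (r * cis \<theta> / (r * cis \<theta> - w)))) \<le> ennreal (r / (r - cmod w) * cmod (f (r * cis \<theta>)))"
      using r by (intro ennreal_leI) (simp add: norm_mult norm_divide mult.commute)
    also have "\<dots> = ennreal (r / (r - cmod w)) * ennreal (cmod (f (r * cis \<theta>)))"
      using w r by (intro ennreal_mult) auto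
    finally show "ennreal (cmod (f (r * cis \<theta>) * (r * cis \<theta> / (r * cis \<theta> - w)))) * indicator {0..2 * pi} \<theta>
       \<le> ennreal (r / (r - cmod w)) * (ennreal (cmod (f (r * cis \<theta>))) * indicator {0..2 * pi} \<theta>)"
      by (auto simp: indicator_def)
  qed
  also have "\<dots> = ennreal (r / (r - cmod w)) * (\<integral>\<^sup>+\<theta>\<in>{0..2 * pi}. ennreal (cmod (f (of_real r * cis \<theta>))) \<partial>lborel)"
  proof (rule nn_integral_cmult)
    have [measurable]: "(\<lambda>\<theta>. f (of_real r * cis \<theta>)) \<in> borel_measurable borel"
      using cont' by (rule borel_measurable_continuous_onI)
    show "(\<lambda>\<theta>. ennreal (cmod (f (of_real r * cis \<theta>))) * indicator {0..2 * pi} \<theta>) \<in> borel_measurable lborel"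
      by measurable
  qed
  finally have "ennreal (1 / (2 * pi)) * ennreal (cmod (2 * pi * f w)) \<le> ennreal (1 / (2 * pi)) *
     (ennreal (r / (r - cmod w)) * (\<integral>\<^sup>+\<theta>\<in>{0..2 * pi}. ennreal (cmod (f (of_real r * cis \<theta>))) \<partial>lborel))"
    by (intro mult_left_mono) auto
  then show ?thesis by (simp add: norm_mult ennreal_mult[symmetric] mult.left_commute)
qed

text \<open>Since \<open>z \<mapsto> F(z) / (1 - t z)\<close> has the value \<open>F(0)\<close> at the origin, the Cauchy kernel may be
  replaced by its difference with the conjugate kernel. The resulting conjugate Poisson kernel has an
  integral over \<open>t\<close> that is bounded uniformly in \<open>\<theta>\<close>, which gives the Fejer-Riesz inequality.\<close>

lemma conjugate_Poisson_formula:
  fixes F :: "complex \<Rightarrow> complex"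
  assumes cont: "continuous_on (cball 0 1) F" and hol: "F holomorphic_on ball 0 1" and t: "t \<in> {0..<1}"
  shows "((\<lambda>\<theta>. F (cis \<theta>) * (- \<i> * of_real (2 * t * sin \<theta> / ((t - cos \<theta>)\<^sup>2 + (sin \<theta>)\<^sup>2))))
    has_integral (2 * pi * (F (of_real t) - F 0))) {0..2 * pi}"
proof -
  have ne: "1 - of_real t * z \<noteq> 0" if "cmod z \<le> 1" for z
  proof
    assume "1 - of_real t * z = 0"
    then have "of_real t * z = 1" by simp
    then have "t * cmod z = 1" using t by (metis abs_of_nonneg atLeastLessThan_iff norm_mult norm_of_real norm_one)
    moreover have "t * cmod z \<le> t * 1" using t that by (intro mult_left_mono) auto
    ultimately show False using t by auto
  qed
  have 1: "((\<lambda>\<theta>. F (1 * cis \<theta>) * (1 * cis \<theta> / (1 * cis \<theta> - of_real t))) has_integral (2 * pi * F (of_real t))) {0..2 * pi}"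
    using Cauchy_integral_cis[of 1 F "of_real t"] cont hol t by simp
  have 2: "((\<lambda>\<theta>. (F (1 * cis \<theta>) / (1 - of_real t * (1 * cis \<theta>))) * (1 * cis \<theta> / (1 * cis \<theta> - 0)))
      has_integral (2 * pi * (F 0 / (1 - of_real t * 0)))) {0..2 * pi}"
  proof -
    have "continuous_on (cball 0 1) (\<lambda>z. F z / (1 - of_real t * z))"
      using ne by (intro continuous_intros cont) auto
    moreover have "(\<lambda>z. F z / (1 - of_real t * z)) holomorphic_on ball 0 1"
      using ne by (intro holomorphic_intros hol) auto
    ultimately show ?thesis using Cauchy_integral_cis[of 1 "\<lambda>z. F z / (1 - of_real t * z)" 0] by simp
  qed
  \<comment> \<open>On the unit circle \<open>c / (c - t) = 1 / (1 - t * cnj c)\<close>. The two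
    kernels are complex conjugates, so their difference is purely imaginary, and the common
    denominator is the squared modulus of \<open>1 - t * c\<close>.\<close>
  have eq: "F (1 * cis \<theta>) * (1 * cis \<theta> / (1 * cis \<theta> - of_real t)) -
      (F (1 * cis \<theta>) / (1 - of_real t * (1 * cis \<theta>))) * (1 * cis \<theta> / (1 * cis \<theta> - 0)) =
      F (cis \<theta>) * (- \<i> * of_real (2 * t * sin \<theta> / ((t - cos \<theta>)\<^sup>2 + (sin \<theta>)\<^sup>2)))" for \<theta>
  proof -
    define c where "c = cis \<theta>"
    have c0: "c \<noteq> 0" "cnj c * c = 1" "cmod c = 1" by (simp_all add: c_def cis_cnj cis_mult)
    have "c - of_real t = c * (1 - of_real t * cnj c)"
      using c0(2) by (simp add: algebra_simps)
    then have "c / (c - of_real t) = 1 / (1 - of_real t * cnj c)" using c0(1) by simp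
    moreover have "1 / (1 - of_real t * cnj c) - 1 / (1 - of_real t * c) =
        (of_real t * (cnj c - c)) / ((1 - of_real t * cnj c) * (1 - of_real t * c))"
      using ne[of c] ne[of "cnj c"] c0 by (simp add: field_simps)
    moreover have "(1 - of_real t * cnj c) * (1 - of_real t * c) = of_real ((t - cos \<theta>)\<^sup>2 + (sin \<theta>)\<^sup>2)"
    proof -
      have "(1 - of_real t * cnj c) * (1 - of_real t * c) = 1 - of_real t * (cnj c + c) + of_real t ^ 2"
        using c0(2) by (simp add: algebra_simps power2_eq_square)
      also have "\<dots> = of_real (1 - 2 * t * cos \<theta> + t\<^sup>2)"
        by (simp add: c_def complex_eq_iff power2_eq_square)
      also have "1 - 2 * t * cos \<theta> + t\<^sup>2 = (t - cos \<theta>)\<^sup>2 + (sin \<theta>)\<^sup>2"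
        using sin_cos_squared_add[of \<theta>] by (simp add: power2_diff algebra_simps)
      finally show ?thesis .
    qed
    moreover have "of_real t * (cnj c - c) = - \<i> * of_real (2 * t * sin \<theta>)"
      by (simp add: c_def complex_eq_iff)
    ultimately have *: "c / (c - of_real t) - 1 / (1 - of_real t * c) = - \<i> * of_real (2 * t * sin \<theta> / ((t - cos \<theta>)\<^sup>2 + (sin \<theta>)\<^sup>2))"
      by simp
    have "F (1 * c) * (1 * c / (1 * c - of_real t)) - (F (1 * c) / (1 - of_real t * (1 * c))) * (1 * c / (1 * c - 0)) =
        F c * (c / (c - of_real t) - 1 / (1 - of_real t * c))"
      using c0(1) by (simp add: right_diff_distrib)
    then show ?thesis unfolding * unfolding c_def .
  qed
  show ?thesis
    using has_integral_diff[OF 1 2] unfolding eq by (simp add: right_diff_distrib)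
qed

text \<open>The integrand has the primitive \<open>arctan ((t - a) / |b|)\<close>, whose total
  variation is below \<open>pi\<close> whatever \<open>a\<close> and \<open>b\<close> are. For
  \<open>b = 0\<close> the integrand is 0.\<close>

lemma nn_integral_Poisson_le:
  fixes a b :: real
  shows "(\<integral>\<^sup>+t\<in>{0..<1}. ennreal (\<bar>b\<bar> / ((t - a)\<^sup>2 + b\<^sup>2)) \<partial>lborel) \<le> ennreal pi"
proof (cases "b = 0")
  case False
  define F where "F t = arctan ((t - a) / \<bar>b\<bar>)" for t
  have "((\<lambda>t. \<bar>b\<bar> / ((t - a)\<^sup>2 + b\<^sup>2)) has_integral (F 1 - F 0)) {0..1}"
  proof (intro fundamental_theorem_of_calculus)
    fix t :: real
    have "((\<lambda>t. (t - a) / \<bar>b\<bar>) has_real_derivative 1 / \<bar>b\<bar>) (at t)"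
      using False by (auto intro!: derivative_eq_intros simp: field_simps)
    from DERIV_chain2[OF DERIV_arctan this]
    have "(F has_real_derivative (1 / \<bar>b\<bar>) / (1 + ((t - a) / \<bar>b\<bar>)\<^sup>2)) (at t)"
      unfolding F_def by (simp add: divide_inverse mult.commute)
    also have "(1 / \<bar>b\<bar>) / (1 + ((t - a) / \<bar>b\<bar>)\<^sup>2) = \<bar>b\<bar> / ((t - a)\<^sup>2 + b\<^sup>2)"
    proof -
      have "1 + ((t - a) / \<bar>b\<bar>)\<^sup>2 = ((t - a)\<^sup>2 + b\<^sup>2) / (\<bar>b\<bar> * \<bar>b\<bar>)"
        using False by (simp add: field_simps power2_eq_square)
      moreover have "(1 / x) / (D / (x * x)) = x / D" if "x \<noteq> 0" for x D :: real
        using that by simp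
      ultimately show ?thesis using False by (simp only: abs_eq_0 not_False_eq_True)
    qed
    finally show "(F has_vector_derivative \<bar>b\<bar> / ((t - a)\<^sup>2 + b\<^sup>2)) (at t within {0..1})"
      by (simp add: has_real_derivative_iff_has_vector_derivative[symmetric] has_field_derivative_at_within)
  qed simp
  then have "(\<integral>\<^sup>+t\<in>{0..1}. ennreal (\<bar>b\<bar> / ((t - a)\<^sup>2 + b\<^sup>2)) \<partial>lborel) = ennreal (F 1 - F 0)"
    by (rule nn_integral_has_integral_lebesgue'[rotated]) auto
  also have "\<dots> \<le> ennreal pi"
    using arctan_ubound[of "(1 - a) / \<bar>b\<bar>"] arctan_lbound[of "(0 - a) / \<bar>b\<bar>"]
    by (intro ennreal_leI) (simp add: F_def)
  finally show ?thesis
    by (rule order_trans[rotated]) (intro nn_integral_mono, auto simp: indicator_def)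
qed simp

text \<open>The conjugate Poisson kernel has modulus at most \<open>2 * P t \<theta>\<close>. After
  Tonelli's theorem the integral of \<open>P\<close> over \<open>t\<close> is at most
  \<open>pi\<close>, so the factors \<open>1 / (2 * pi)\<close>, 2 and \<open>pi\<close> cancel. The
  modulus of the Cauchy kernel would leave a logarithmic singularity in \<open>\<theta>\<close> at
  this point.\<close>

lemma Fejer_Riesz:
  fixes F :: "complex \<Rightarrow> complex"
  assumes cont: "continuous_on (cball 0 1) F" and hol: "F holomorphic_on ball 0 1"
  shows "(\<integral>\<^sup>+t\<in>{0..<1}. ennreal (cmod (F (of_real t) - F 0)) \<partial>lborel) \<le>
    (\<integral>\<^sup>+\<theta>\<in>{0..2 * pi}. ennreal (cmod (F (cis \<theta>))) \<partial>lborel)"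
proof -
  define P where "P t \<theta> = \<bar>sin \<theta>\<bar> / ((t - cos \<theta>)\<^sup>2 + (sin \<theta>)\<^sup>2)" for t \<theta> :: real
  have P_nonneg: "0 \<le> P t \<theta>" for t \<theta> by (simp add: P_def)
  have cont_cis: "continuous_on UNIV (\<lambda>\<theta>. F (cis \<theta>))"
    by (intro continuous_on_compose2[OF cont] continuous_intros) auto
  have [measurable]: "(\<lambda>\<theta>. F (cis \<theta>)) \<in> borel_measurable borel"
    using cont_cis by (rule borel_measurable_continuous_onI)
  have [measurable]: "case_prod P \<in> borel_measurable (borel \<Otimes>\<^sub>M borel)"
    unfolding P_def[abs_def] by measurable
  define G where "G t \<theta> = (ennreal (cmod (F (cis \<theta>))) * indicator {0..2 * pi} \<theta>) * (ennreal (P t \<theta>) * indicator {0..<1} t)" for t \<theta>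
  have Gm: "case_prod G \<in> borel_measurable (lborel \<Otimes>\<^sub>M lborel)"
    unfolding G_def[abs_def] by measurable
  have ne: "(t - cos \<theta>)\<^sup>2 + (sin \<theta>)\<^sup>2 \<noteq> 0" if "t \<in> {0..<1}" for t \<theta> :: real
  proof
    assume "(t - cos \<theta>)\<^sup>2 + (sin \<theta>)\<^sup>2 = 0"
    then have "t = cos \<theta>" "sin \<theta> = 0" by (auto simp: sum_power2_eq_zero_iff)
    then have "t\<^sup>2 = 1" using sin_cos_squared_add[of \<theta>] by simp
    then show False using that by (auto simp: power2_eq_1_iff)
  qed
  have pt: "ennreal (cmod (F (of_real t) - F 0)) * indicator {0..<1} t \<le> ennreal (1 / pi) * (\<integral>\<^sup>+\<theta>. G t \<theta> \<partial>lborel)" for t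
  proof (cases "t \<in> {0..<1}")
    case t: True
    let ?K = "\<lambda>\<theta>. F (cis \<theta>) * (- \<i> * of_real (2 * t * sin \<theta> / ((t - cos \<theta>)\<^sup>2 + (sin \<theta>)\<^sup>2)))"
    have "continuous_on {0..2 * pi} ?K"
      using ne[OF t] by (intro continuous_intros continuous_on_subset[OF cont_cis]) auto
    then have "ennreal (cmod (2 * pi * (F (of_real t) - F 0))) \<le> (\<integral>\<^sup>+\<theta>\<in>{0..2 * pi}. ennreal (cmod (?K \<theta>)) \<partial>lborel)"
      by (rule has_integral_norm_le_nn_integral[OF conjugate_Poisson_formula[OF cont hol t]])
    also have "\<dots> \<le> (\<integral>\<^sup>+\<theta>. ennreal 2 * G t \<theta> \<partial>lborel)"
    proof (intro nn_integral_mono)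
      fix \<theta> :: real
      have "cmod (?K \<theta>) = t * (2 * (cmod (F (cis \<theta>)) * P t \<theta>))"
        using t by (simp add: P_def norm_mult norm_divide abs_mult flip: of_real_power of_real_diff of_real_add)
      also have "\<dots> \<le> 1 * (2 * (cmod (F (cis \<theta>)) * P t \<theta>))"
        using t P_nonneg by (intro mult_right_mono) auto
      finally have "ennreal (cmod (?K \<theta>)) \<le> ennreal (2 * (cmod (F (cis \<theta>)) * P t \<theta>))"
        by (intro ennreal_leI) simp
      also have "\<dots> = ennreal 2 * (ennreal (cmod (F (cis \<theta>))) * ennreal (P t \<theta>))"
        using P_nonneg by (simp add: ennreal_mult)
      finally show "ennreal (cmod (?K \<theta>)) * indicator {0..2 * pi} \<theta> \<le> ennreal 2 * G t \<theta>"
        using t by (auto simp: G_def indicator_def)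
    qed
    also have "\<dots> = ennreal 2 * (\<integral>\<^sup>+\<theta>. G t \<theta> \<partial>lborel)"
      by (rule nn_integral_cmult) (use Gm in measurable)
    finally have "ennreal (1 / (2 * pi)) * ennreal (cmod (2 * pi * (F (of_real t) - F 0))) \<le> ennreal (1 / (2 * pi)) * (ennreal 2 * (\<integral>\<^sup>+\<theta>. G t \<theta> \<partial>lborel))"
      by (intro mult_left_mono) auto
    then show ?thesis
      using t by (simp add: norm_mult mult.assoc[symmetric] ennreal_mult[symmetric] del: ennreal_numeral)
  qed simp
  have inner: "(\<integral>\<^sup>+t. G t \<theta> \<partial>lborel) \<le> ennreal pi * (ennreal (cmod (F (cis \<theta>))) * indicator {0..2 * pi} \<theta>)" for \<theta>
  proof -
    have "(\<integral>\<^sup>+t. G t \<theta> \<partial>lborel) = (ennreal (cmod (F (cis \<theta>))) * indicator {0..2 * pi} \<theta>) * (\<integral>\<^sup>+t\<in>{0..<1}. ennreal (P t \<theta>) \<partial>lborel)"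
      unfolding G_def by (rule nn_integral_cmult) measurable
    also have "\<dots> \<le> (ennreal (cmod (F (cis \<theta>))) * indicator {0..2 * pi} \<theta>) * ennreal pi"
      unfolding P_def by (intro mult_left_mono nn_integral_Poisson_le) auto
    finally show ?thesis by (simp add: mult.commute)
  qed
  have "(\<integral>\<^sup>+t\<in>{0..<1}. ennreal (cmod (F (of_real t) - F 0)) \<partial>lborel) \<le> (\<integral>\<^sup>+t. ennreal (1 / pi) * (\<integral>\<^sup>+\<theta>. G t \<theta> \<partial>lborel) \<partial>lborel)"
    by (intro nn_integral_mono pt)
  also have "\<dots> = ennreal (1 / pi) * (\<integral>\<^sup>+t. (\<integral>\<^sup>+\<theta>. G t \<theta> \<partial>lborel) \<partial>lborel)"
    by (rule nn_integral_cmult) (use lborel.borel_measurable_nn_integral[OF Gm] in simp)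
  also have "(\<integral>\<^sup>+t. (\<integral>\<^sup>+\<theta>. G t \<theta> \<partial>lborel) \<partial>lborel) = (\<integral>\<^sup>+\<theta>. (\<integral>\<^sup>+t. G t \<theta> \<partial>lborel) \<partial>lborel)"
    by (rule lborel_pair.Fubini'[OF Gm, symmetric])
  also have "\<dots> \<le> (\<integral>\<^sup>+\<theta>. ennreal pi * (ennreal (cmod (F (cis \<theta>))) * indicator {0..2 * pi} \<theta>) \<partial>lborel)"
    by (intro nn_integral_mono inner)
  also have "\<dots> = ennreal pi * (\<integral>\<^sup>+\<theta>\<in>{0..2 * pi}. ennreal (cmod (F (cis \<theta>))) \<partial>lborel)"
    by (rule nn_integral_cmult) measurable
  finally have "(\<integral>\<^sup>+t\<in>{0..<1}. ennreal (cmod (F (of_real t) - F 0)) \<partial>lborel) \<le>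
      ennreal (1 / pi) * (ennreal pi * (\<integral>\<^sup>+\<theta>\<in>{0..2 * pi}. ennreal (cmod (F (cis \<theta>))) \<partial>lborel))"
    by (simp add: mult_left_mono)
  then show ?thesis by (simp add: mult.assoc[symmetric] ennreal_mult[symmetric])
qed

text \<open>A function holomorphic on the open disc need not extend continuously to the circle.
  \<open>Fejer_Riesz\<close> is therefore applied to the dilations \<open>f(r z)\<close>, and
  Fatou's lemma carries the L^1 bound to \<open>r = 1\<close>. Growth comes from
  \<open>circle_mean_bound\<close>.\<close>

lemma Hardy_1_admissible:
  "admissible_norm (\<lambda>f. SUP r\<in>{0<..<1}. ennreal (1 / (2 * pi)) *
       (\<integral>\<^sup>+\<theta>\<in>{0..2 * pi}. ennreal (cmod (f (of_real r * cis \<theta>))) \<partial>lborel))"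
proof
  define m where "m f r = ennreal (1 / (2 * pi)) *
       (\<integral>\<^sup>+\<theta>\<in>{0..2 * pi}. ennreal (cmod (f (of_real r * cis \<theta>))) \<partial>lborel)" for f :: "complex \<Rightarrow> complex" and r
  have in_ball: "complex_of_real r * cis \<theta> \<in> ball 0 1" if "r \<in> {0<..<1}" for r \<theta>
    using that by (simp add: norm_mult)
  have meas: "(\<lambda>\<theta>. f (of_real r * cis \<theta>)) \<in> borel_measurable borel"
    if "f holomorphic_on ball 0 1" "r \<in> {0<..<1}" for f r
    using in_ball[OF that(2)]
    by (intro borel_measurable_continuous_onI continuous_on_compose2[OF holomorphic_on_imp_continuous_on[OF that(1)]] continuous_intros) auto
  let ?N = "\<lambda>f. SUP r\<in>{0<..<1}. m f r"
  have N_eq: "(SUP r\<in>{0<..<1}. ennreal (1 / (2 * pi)) *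
       (\<integral>\<^sup>+\<theta>\<in>{0..2 * pi}. ennreal (cmod (f (of_real r * cis \<theta>))) \<partial>lborel)) = ?N f" for f :: "complex \<Rightarrow> complex"
    by (simp add: m_def)
  have m_le: "m f r \<le> ?N f" if "r \<in> {0<..<1}" for f r
    using that by (rule SUP_upper)
  have point: "ennreal (cmod (f w)) \<le> ennreal (r / (r - cmod w)) * ?N f"
    if "f holomorphic_on ball 0 1" "r \<in> {0<..<1}" "cmod w < r" for f r w
  proof -
    have "ennreal (cmod (f w)) \<le> ennreal (r / (r - cmod w)) * m f r"
      unfolding m_def using that by (intro circle_mean_bound) auto
    also have "\<dots> \<le> ennreal (r / (r - cmod w)) * ?N f"
      by (intro mult_left_mono m_le that) auto
    finally show ?thesis .
  qed
  {
    fix f g h :: "complex \<Rightarrow> complex" and c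
    assume hol: "f holomorphic_on ball 0 1" "g holomorphic_on ball 0 1" "h holomorphic_on ball 0 1"
      and eq: "\<And>z. z \<in> ball 0 1 \<Longrightarrow> f z = c * g z + h z"
    have "m f r \<le> ennreal (cmod c) * ?N g + ?N h" if r: "r \<in> {0<..<1}" for r
    proof -
      let ?z = "\<lambda>\<theta>. complex_of_real r * cis \<theta>"
      note [measurable] = meas[OF hol(2) r] meas[OF hol(3) r]
      have "(\<integral>\<^sup>+\<theta>\<in>{0..2 * pi}. ennreal (cmod (f (?z \<theta>))) \<partial>lborel) \<le>
        (\<integral>\<^sup>+\<theta>. ennreal (cmod c) * (ennreal (cmod (g (?z \<theta>))) * indicator {0..2 * pi} \<theta>) + ennreal (cmod (h (?z \<theta>))) * indicator {0..2 * pi} \<theta> \<partial>lborel)"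
      proof (intro nn_integral_mono)
        fix \<theta>
        have "ennreal (cmod (f (?z \<theta>))) \<le> ennreal (cmod c * cmod (g (?z \<theta>)) + cmod (h (?z \<theta>)))"
          using eq[OF in_ball[OF r]] norm_triangle_ineq[of "c * g (?z \<theta>)" "h (?z \<theta>)"]
          by (intro ennreal_leI) (simp add: norm_mult)
        also have "\<dots> = ennreal (cmod c) * ennreal (cmod (g (?z \<theta>))) + ennreal (cmod (h (?z \<theta>)))"
          by (simp add: ennreal_mult)
        finally show "ennreal (cmod (f (?z \<theta>))) * indicator {0..2 * pi} \<theta> \<le>
           ennreal (cmod c) * (ennreal (cmod (g (?z \<theta>))) * indicator {0..2 * pi} \<theta>) + ennreal (cmod (h (?z \<theta>))) * indicator {0..2 * pi} \<theta>"
          by (auto simp: indicator_def)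
      qed
      also have "\<dots> = ennreal (cmod c) * (\<integral>\<^sup>+\<theta>\<in>{0..2 * pi}. ennreal (cmod (g (?z \<theta>))) \<partial>lborel)
          + (\<integral>\<^sup>+\<theta>\<in>{0..2 * pi}. ennreal (cmod (h (?z \<theta>))) \<partial>lborel)"
        by (simp add: nn_integral_add nn_integral_cmult)
      finally have "m f r \<le> ennreal (1 / (2 * pi)) * \<dots>"
        unfolding m_def by (intro mult_left_mono) auto
      also have "\<dots> = ennreal (cmod c) * m g r + m h r"
        by (simp add: m_def distrib_left mult.left_commute)
      also have "\<dots> \<le> ennreal (cmod c) * ?N g + ?N h"
        by (intro add_mono mult_left_mono m_le r) auto
      finally show ?thesis .
    qed
    then show "(SUP r\<in>{0<..<1}. ennreal (1 / (2 * pi)) * (\<integral>\<^sup>+\<theta>\<in>{0..2 * pi}. ennreal (cmod (f (of_real r * cis \<theta>))) \<partial>lborel)) \<le>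
      ennreal (cmod c) * (SUP r\<in>{0<..<1}. ennreal (1 / (2 * pi)) * (\<integral>\<^sup>+\<theta>\<in>{0..2 * pi}. ennreal (cmod (g (of_real r * cis \<theta>))) \<partial>lborel)) +
      (SUP r\<in>{0<..<1}. ennreal (1 / (2 * pi)) * (\<integral>\<^sup>+\<theta>\<in>{0..2 * pi}. ennreal (cmod (h (of_real r * cis \<theta>))) \<partial>lborel))"
      unfolding N_eq by (rule SUP_least)
  next
    fix d :: "nat \<Rightarrow> complex" and f
    assume d: "summable (\<lambda>n. real (n + 1) * cmod (d n))"
      and f: "\<And>z. z \<in> ball 0 1 \<Longrightarrow> (\<lambda>n. d n * z ^ n) sums f z"
    let ?S = "\<Sum>n. real (n + 1) * cmod (d n)"
    have S: "0 \<le> ?S" using d by (intro suminf_nonneg) auto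
    have "m f r \<le> ennreal (2 * ?S)" if r: "r \<in> {0<..<1}" for r
    proof -
      have "(\<integral>\<^sup>+\<theta>\<in>{0..2 * pi}. ennreal (cmod (f (of_real r * cis \<theta>))) \<partial>lborel) \<le> (\<integral>\<^sup>+\<theta>. ennreal ?S * indicator {0..2 * pi} \<theta> \<partial>lborel)"
      proof (intro nn_integral_mono mult_right_mono ennreal_leI)
        fix \<theta> show "cmod (f (of_real r * cis \<theta>)) \<le> ?S"
          by (rule power_series_norm_le[OF d f[OF in_ball[OF r]] in_ball[OF r]])
      qed simp
      also have "\<dots> = ennreal (?S * (2 * pi))"
        using S by (simp add: nn_integral_cmult_indicator ennreal_mult)
      finally have "m f r \<le> ennreal (1 / (2 * pi)) * ennreal (?S * (2 * pi))"
        unfolding m_def by (intro mult_left_mono) auto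
      also have "\<dots> = ennreal ?S" using S by (simp flip: ennreal_mult)
      also have "\<dots> \<le> ennreal (2 * ?S)" using S by (intro ennreal_leI) auto
      finally show ?thesis .
    qed
    then show "(SUP r\<in>{0<..<1}. ennreal (1 / (2 * pi)) * (\<integral>\<^sup>+\<theta>\<in>{0..2 * pi}. ennreal (cmod (f (of_real r * cis \<theta>))) \<partial>lborel)) \<le> ennreal (2 * ?S)"
      unfolding N_eq by (rule SUP_least)
  next
    fix f :: "complex \<Rightarrow> complex" and t :: real
    assume hol: "f holomorphic_on ball 0 1" and t: "t \<in> {0..<1}"
    \<comment> \<open>The midpoint of \<open>t\<close> and 1 turns the factor
      \<open>r / (r - t)\<close> into \<open>(1 + t) / (1 - t)\<close>, with numerator below
      4.\<close>
    define r where "r = (1 + t) / 2"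
    have r: "r \<in> {0<..<1}" "t < r" using t by (auto simp: r_def)
    have "ennreal (cmod (f (of_real t))) \<le> ennreal (r / (r - cmod (of_real t))) * ?N f"
      using t r by (intro point hol) auto
    also have "r / (r - cmod (of_real t)) = (1 + t) / (1 - t)"
      using t by (simp add: r_def field_simps)
    also have "ennreal ((1 + t) / (1 - t)) * ?N f \<le> ennreal (4 / (1 - t)\<^sup>2) * ?N f"
      using divide_one_minus_le[OF t, of "1 + t"] t by (intro mult_right_mono ennreal_leI) auto
    finally show "ennreal (cmod (f (of_real t))) \<le> ennreal (4 / (1 - t)\<^sup>2) *
        (SUP r\<in>{0<..<1}. ennreal (1 / (2 * pi)) * (\<integral>\<^sup>+\<theta>\<in>{0..2 * pi}. ennreal (cmod (f (of_real r * cis \<theta>))) \<partial>lborel))"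
      unfolding N_eq .
  next
    fix f :: "complex \<Rightarrow> complex"
    assume hol: "f holomorphic_on ball 0 1"
    have scaled: "(\<integral>\<^sup>+t\<in>{0..<1}. ennreal (cmod (f (of_real r * of_real t))) \<partial>lborel) \<le> 8 * ?N f" if r: "r \<in> {0<..<1}" for r
    proof -
      define F where "F z = f (of_real r * z)" for z
      have cont: "continuous_on (cball 0 1) F"
        unfolding F_def
        by (intro continuous_on_compose2[OF holomorphic_on_imp_continuous_on[OF hol]] continuous_intros)
          (use r in \<open>auto simp: norm_mult intro!: mult_le_one le_less_trans[OF mult_left_le]\<close>)
      have F_hol: "F holomorphic_on ball 0 1"
        unfolding F_def
        by (intro holomorphic_on_compose_gen[OF _ hol, unfolded o_def] holomorphic_intros)
          (use r in \<open>auto simp: norm_mult intro!: le_less_trans[OF mult_left_le]\<close>)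
      have "continuous_on {0..<1} (\<lambda>t. F (of_real t))"
        by (intro continuous_on_compose2[OF cont] continuous_intros) auto
      then have F_meas: "(\<lambda>t. ennreal (cmod (F (of_real t) - F 0)) * indicator {0..<1} t) \<in> borel_measurable borel"
        by (intro borel_measurable_norm_indicator continuous_intros) auto
      have m_eq: "(\<integral>\<^sup>+\<theta>\<in>{0..2 * pi}. ennreal (cmod (F (cis \<theta>))) \<partial>lborel) = ennreal (2 * pi) * m f r"
        by (simp add: m_def F_def mult.assoc[symmetric] ennreal_mult[symmetric])
      have "(\<integral>\<^sup>+t\<in>{0..<1}. ennreal (cmod (f (of_real r * of_real t))) \<partial>lborel) \<le>
         (\<integral>\<^sup>+t. ennreal (cmod (f 0)) * indicator {0..<1} t + ennreal (cmod (F (of_real t) - F 0)) * indicator {0..<1} t \<partial>lborel)"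
      proof (intro nn_integral_mono)
        fix t :: real
        have "ennreal (cmod (F (of_real t))) \<le> ennreal (cmod (F 0) + cmod (F (of_real t) - F 0))"
          using norm_triangle_ineq[of "F 0" "F (of_real t) - F 0"] by (intro ennreal_leI) simp
        then show "ennreal (cmod (f (of_real r * of_real t))) * indicator {0..<1} t \<le>
          ennreal (cmod (f 0)) * indicator {0..<1} t + ennreal (cmod (F (of_real t) - F 0)) * indicator {0..<1} t"
          by (auto simp: indicator_def F_def)
      qed
      also have "\<dots> = (\<integral>\<^sup>+t. ennreal (cmod (f 0)) * indicator {0..<1} (t::real) \<partial>lborel) + (\<integral>\<^sup>+t\<in>{0..<1}. ennreal (cmod (F (of_real t) - F 0)) \<partial>lborel)"
        by (rule nn_integral_add) (use F_meas in simp_all)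
      also have "\<dots> \<le> ennreal (cmod (f 0)) + ennreal (2 * pi) * m f r"
        using Fejer_Riesz[OF cont F_hol] unfolding m_eq
        by (intro add_mono) (simp_all add: nn_integral_cmult_indicator)
      \<comment> \<open>The value at the origin costs one copy of the norm and
        \<open>Fejer_Riesz\<close> costs \<open>2 * pi < 7\<close>, in total the 8 of
        \<open>L1_bound\<close>.\<close>
      also have "\<dots> \<le> 1 * ?N f + 7 * ?N f"
      proof (intro add_mono mult_mono)
        show "ennreal (cmod (f 0)) \<le> 1 * ?N f"
          using point[OF hol r, of 0] r by simp
        show "ennreal (2 * pi) \<le> 7" using pi_less_4 pi_approx by (simp add: ennreal_le_iff flip: ennreal_numeral)
      qed (use m_le[OF r] in auto)
      also have "\<dots> = (1 + 7) * ?N f" by (rule distrib_right[symmetric])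
      also have "\<dots> = 8 * ?N f" by simp
      finally show ?thesis .
    qed
    define r where "r n = 1 - 1 / real (n + 2)" for n
    have r: "r n \<in> {0<..<1}" for n by (auto simp: r_def field_simps)
    have r_lim: "r \<longlonglongrightarrow> 1" unfolding r_def by real_asymp
    have fr: "(\<lambda>n. ennreal (cmod (f (of_real (r n) * of_real t))) * indicator {0..<1} t) \<longlonglongrightarrow> ennreal (cmod (f (of_real t))) * indicator {0..<1} t" for t
    proof (cases "t \<in> {0..<1}")
      case True
      have "isCont f (of_real t)"
        using holomorphic_on_imp_continuous_on[OF hol] True by (subst (asm) continuous_on_eq_continuous_at) auto
      moreover have "(\<lambda>n. complex_of_real (r n) * of_real t) \<longlonglongrightarrow> of_real 1 * of_real t"
        by (intro tendsto_intros r_lim)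
      ultimately have "(\<lambda>n. f (of_real (r n) * of_real t)) \<longlonglongrightarrow> f (of_real t)"
        using isCont_tendsto_compose[of "of_real t" f "\<lambda>n. of_real (r n) * of_real t" sequentially] by simp
      then show ?thesis using True by (auto intro!: tendsto_ennrealI tendsto_norm)
    qed simp
    have "L1_norm (radius_restrict f) = (\<integral>\<^sup>+t. liminf (\<lambda>n. ennreal (cmod (f (of_real (r n) * of_real t))) * indicator {0..<1} t) \<partial>lborel)"
      unfolding L1_norm_def nn_integral_completion radius_restrict_def
      using lim_imp_Liminf[OF _ fr] by simp
    \<comment> \<open>Fatou's lemma: the dilations converge pointwise, and no common majorant is
      available.\<close>
    also have "\<dots> \<le> liminf (\<lambda>n. \<integral>\<^sup>+t\<in>{0..<1}. ennreal (cmod (f (of_real (r n) * of_real t))) \<partial>lborel)"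
    proof (rule nn_integral_liminf)
      fix n
      have "continuous_on {0..<1} (\<lambda>t. f (of_real (r n) * of_real t))"
        by (intro continuous_on_compose2[OF holomorphic_on_imp_continuous_on[OF hol]] continuous_intros)
          (use r[of n] in \<open>auto simp: norm_mult intro!: le_less_trans[OF mult_left_le]\<close>)
      then have "(\<lambda>t. ennreal (cmod (f (of_real (r n) * of_real t))) * indicator {0..<1} t) \<in> borel_measurable borel"
        by (rule borel_measurable_norm_indicator) simp
      then show "(\<lambda>t. ennreal (cmod (f (of_real (r n) * of_real t))) * indicator {0..<1} t) \<in> borel_measurable lborel"
        by simp
    qed
    also have "\<dots> \<le> 8 * ?N f"
      by (rule Liminf_le) (use scaled[OF r] in auto)
    finally show "L1_norm (radius_restrict f) \<le> 8 * (SUP r\<in>{0<..<1}. ennreal (1 / (2 * pi)) *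
       (\<integral>\<^sup>+\<theta>\<in>{0..2 * pi}. ennreal (cmod (f (of_real r * cis \<theta>))) \<partial>lborel))"
      unfolding N_eq .
  }
qed

section \<open>Area measure on the plane: coordinates, rotations and mean values\<close>

lemma lborel_complex: "lborel = distr (lborel \<Otimes>\<^sub>M lborel) borel (\<lambda>(x, y). Complex x y)"
proof (rule lborel_eqI)
  have m: "(\<lambda>(x, y). Complex x y) \<in> borel_measurable (lborel \<Otimes>\<^sub>M lborel)"
    unfolding Complex_eq by measurable
  show "emeasure (distr (lborel \<Otimes>\<^sub>M lborel) borel (\<lambda>(x, y). Complex x y)) (box l u) = ennreal (\<Prod>b\<in>Basis. (u - l) \<bullet> b)"
    if le: "\<And>b. b \<in> Basis \<Longrightarrow> l \<bullet> b \<le> u \<bullet> b" for l u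
  proof -
    have le': "Re l \<le> Re u" "Im l \<le> Im u" using le[of 1] le[of \<i>] by (auto simp: Basis_complex_def)
    have "(\<lambda>(x, y). Complex x y) -` box l u \<inter> space (lborel \<Otimes>\<^sub>M lborel) = {Re l<..<Re u} \<times> {Im l<..<Im u}"
      by (auto simp: in_box_complex_iff space_pair_measure)
    then have "emeasure (distr (lborel \<Otimes>\<^sub>M lborel) borel (\<lambda>(x, y). Complex x y)) (box l u) =
        emeasure (lborel \<Otimes>\<^sub>M lborel) ({Re l<..<Re u} \<times> {Im l<..<Im u})"
      using m by (subst emeasure_distr) auto
    also have "\<dots> = ennreal (Re u - Re l) * ennreal (Im u - Im l)"
      using le' by (subst lborel.emeasure_pair_measure_Times) auto
    also have "\<dots> = ennreal (\<Prod>b\<in>Basis. (u - l) \<bullet> b)"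
      using le' by (simp add: Basis_complex_def ennreal_mult complex_eq_iff)
    finally show ?thesis .
  qed
qed simp

lemma nn_integral_lborel_complex:
  assumes [measurable]: "f \<in> borel_measurable borel"
  shows "(\<integral>\<^sup>+z. f z \<partial>lborel) = (\<integral>\<^sup>+x. \<integral>\<^sup>+y. f (Complex x y) \<partial>lborel \<partial>lborel)"
    and "(\<integral>\<^sup>+z. f z \<partial>lborel) = (\<integral>\<^sup>+y. \<integral>\<^sup>+x. f (Complex x y) \<partial>lborel \<partial>lborel)"
proof -
  have m: "(\<lambda>(x, y). Complex x y) \<in> borel_measurable (lborel \<Otimes>\<^sub>M lborel)"
    unfolding Complex_eq by measurable
  have fm: "(\<lambda>(x, y). f (Complex x y)) \<in> borel_measurable (lborel \<Otimes>\<^sub>M lborel)"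
    using measurable_compose[OF m assms] by (simp add: case_prod_unfold)
  have "(\<integral>\<^sup>+z. f z \<partial>lborel) = (\<integral>\<^sup>+p. (\<lambda>(x, y). f (Complex x y)) p \<partial>(lborel \<Otimes>\<^sub>M lborel))"
    by (subst lborel_complex) (use m in \<open>simp add: nn_integral_distr case_prod_unfold\<close>)
  also have "\<dots> = (\<integral>\<^sup>+x. \<integral>\<^sup>+y. f (Complex x y) \<partial>lborel \<partial>lborel)"
    using lborel.nn_integral_fst[OF fm] by simp
  finally show 1: "(\<integral>\<^sup>+z. f z \<partial>lborel) = (\<integral>\<^sup>+x. \<integral>\<^sup>+y. f (Complex x y) \<partial>lborel \<partial>lborel)" .
  show "(\<integral>\<^sup>+z. f z \<partial>lborel) = (\<integral>\<^sup>+y. \<integral>\<^sup>+x. f (Complex x y) \<partial>lborel \<partial>lborel)"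
    unfolding 1 by (rule lborel_pair.Fubini'[OF fm, symmetric])
qed

lemma nn_integral_real_translate:
  fixes f :: "real \<Rightarrow> ennreal"
  assumes "f \<in> borel_measurable borel"
  shows "(\<integral>\<^sup>+x. f (x + t) \<partial>lborel) = (\<integral>\<^sup>+x. f x \<partial>lborel)"
  using nn_integral_real_affine[OF assms, of 1 t] by (simp add: add.commute)

lemma borel_measurable_Complex_sections:
  fixes f :: "complex \<Rightarrow> ennreal"
  assumes [measurable]: "f \<in> borel_measurable borel"
  shows "(\<lambda>x. f (Complex x y)) \<in> borel_measurable borel" "(\<lambda>y. f (Complex x y)) \<in> borel_measurable borel"
  unfolding Complex_eq by measurable

text \<open>With the preserved coordinate as the outer variable, a shear is a translation of the
  inner one.\<close>

lemma nn_integral_shear: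
  fixes f :: "complex \<Rightarrow> ennreal"
  assumes f: "f \<in> borel_measurable borel"
  shows "(\<integral>\<^sup>+z. f (z + of_real (a * Im z)) \<partial>lborel) = (\<integral>\<^sup>+z. f z \<partial>lborel)"
    and "(\<integral>\<^sup>+z. f (z + \<i> * of_real (a * Re z)) \<partial>lborel) = (\<integral>\<^sup>+z. f z \<partial>lborel)"
proof -
  note [measurable] = f
  have "(\<integral>\<^sup>+z. f (z + of_real (a * Im z)) \<partial>lborel) = (\<integral>\<^sup>+y. \<integral>\<^sup>+x. f (Complex x y + of_real (a * y)) \<partial>lborel \<partial>lborel)"
    by (subst nn_integral_lborel_complex(2)) auto
  also have "\<dots> = (\<integral>\<^sup>+y. \<integral>\<^sup>+x. f (Complex (x + a * y) y) \<partial>lborel \<partial>lborel)"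
    by (simp add: Complex_eq algebra_simps)
  also have "\<dots> = (\<integral>\<^sup>+y. \<integral>\<^sup>+x. f (Complex x y) \<partial>lborel \<partial>lborel)"
    by (intro nn_integral_cong nn_integral_real_translate borel_measurable_Complex_sections f)
  also have "\<dots> = (\<integral>\<^sup>+z. f z \<partial>lborel)" by (rule nn_integral_lborel_complex(2)[OF f, symmetric])
  finally show "(\<integral>\<^sup>+z. f (z + of_real (a * Im z)) \<partial>lborel) = (\<integral>\<^sup>+z. f z \<partial>lborel)" .
  have "(\<integral>\<^sup>+z. f (z + \<i> * of_real (a * Re z)) \<partial>lborel) = (\<integral>\<^sup>+x. \<integral>\<^sup>+y. f (Complex x y + \<i> * of_real (a * x)) \<partial>lborel \<partial>lborel)"
    by (subst nn_integral_lborel_complex(1)) auto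
  also have "\<dots> = (\<integral>\<^sup>+x. \<integral>\<^sup>+y. f (Complex x (y + a * x)) \<partial>lborel \<partial>lborel)"
    by (simp add: Complex_eq algebra_simps)
  also have "\<dots> = (\<integral>\<^sup>+x. \<integral>\<^sup>+y. f (Complex x y) \<partial>lborel \<partial>lborel)"
    by (intro nn_integral_cong nn_integral_real_translate borel_measurable_Complex_sections f)
  also have "\<dots> = (\<integral>\<^sup>+z. f z \<partial>lborel)" by (rule nn_integral_lborel_complex(1)[OF f, symmetric])
  finally show "(\<integral>\<^sup>+z. f (z + \<i> * of_real (a * Re z)) \<partial>lborel) = (\<integral>\<^sup>+z. f z \<partial>lborel)" .
qed

text \<open>A rotation other than \<open>z \<mapsto> - z\<close> is a product of three shears.\<close>

lemma nn_integral_rotate: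
  fixes f :: "complex \<Rightarrow> ennreal"
  assumes f: "f \<in> borel_measurable borel"
  shows "(\<integral>\<^sup>+z. f (cis \<theta> * z) \<partial>lborel) = (\<integral>\<^sup>+z. f z \<partial>lborel)"
proof -
  have rot: "(\<integral>\<^sup>+z. g (cis \<theta> * z) \<partial>lborel) = (\<integral>\<^sup>+z. g z \<partial>lborel)"
    if ne: "1 + cos \<theta> \<noteq> 0" and g: "g \<in> borel_measurable borel" for \<theta> and g :: "complex \<Rightarrow> ennreal"
  proof -
    note [measurable] = g
    \<comment> \<open>Here \<open>a = - tan (\<theta> / 2)\<close>: the rotation is
      \<open>U\<close>, \<open>V\<close>, \<open>U\<close> in turn, with horizontal shears by
      \<open>a\<close> and a vertical one by \<open>sin \<theta>\<close>. The denominator vanishes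
      only for the half turn.\<close>
    define a b where "a = - sin \<theta> / (1 + cos \<theta>)" and "b = sin \<theta>"
    define U V where "U z = z + of_real (a * Im z)" and "V z = z + \<i> * of_real (b * Re z)" for z
    have [measurable]: "U \<in> borel_measurable borel" "V \<in> borel_measurable borel"
      unfolding U_def[abs_def] V_def[abs_def] by measurable
    have s2: "sin \<theta> * sin \<theta> = (1 - cos \<theta>) * (1 + cos \<theta>)"
      using sin_cos_squared_add[of \<theta>] by (simp add: algebra_simps power2_eq_square)
    have ab: "a * b = cos \<theta> - 1"
    proof -
      have "a * b = - (sin \<theta> * sin \<theta>) / (1 + cos \<theta>)" by (simp add: a_def b_def)
      also have "\<dots> = cos \<theta> - 1" using ne unfolding s2 by simp
      finally show ?thesis .
    qed
    have a1: "a * (1 + cos \<theta>) = - sin \<theta>" using ne by (simp add: a_def)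
    have "U (V (U z)) = cis \<theta> * z" for z
    proof -
      have "Im (V (U z)) = Im z + (b * Re z + (a * b) * Im z)"
        by (simp add: U_def V_def algebra_simps)
      then have im: "Im (V (U z)) = sin \<theta> * Re z + cos \<theta> * Im z"
        unfolding ab by (simp add: b_def algebra_simps)
      have "Re (U (V (U z))) = Re z + a * Im z + a * Im (V (U z))"
        by (simp add: U_def V_def)
      also have "\<dots> = (1 + a * b) * Re z + (a * (1 + cos \<theta>)) * Im z"
        unfolding im by (simp add: b_def algebra_simps)
      also have "\<dots> = cos \<theta> * Re z - sin \<theta> * Im z" unfolding a1 ab by simp
      finally show ?thesis
        using im by (simp add: complex_eq_iff U_def)
    qed
    then have "(\<integral>\<^sup>+z. g (cis \<theta> * z) \<partial>lborel) = (\<integral>\<^sup>+z. g (U (V (U z))) \<partial>lborel)" by simp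
    also have "\<dots> = (\<integral>\<^sup>+z. g (U (V z)) \<partial>lborel)"
      by (rule nn_integral_shear(1)[of "\<lambda>z. g (U (V z))" a, folded U_def]) measurable
    also have "\<dots> = (\<integral>\<^sup>+z. g (U z) \<partial>lborel)"
      by (rule nn_integral_shear(2)[of "\<lambda>z. g (U z)" b, folded V_def]) measurable
    also have "\<dots> = (\<integral>\<^sup>+z. g z \<partial>lborel)"
      by (rule nn_integral_shear(1)[of g a, folded U_def]) measurable
    finally show ?thesis .
  qed
  show ?thesis
  proof (cases "1 + cos \<theta> = 0")
    case True
    then have "cos \<theta> = -1" by simp
    moreover from this have "sin \<theta> = 0" using sin_cos_squared_add[of \<theta>] by simp
    \<comment> \<open>The half turn is a quarter turn applied twice, and \<open>rot\<close> covers
      quarter turns.\<close>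
    ultimately have "cis \<theta> = cis (pi / 2) * cis (pi / 2)" by (simp add: complex_eq_iff)
    then have "(\<integral>\<^sup>+z. f (cis \<theta> * z) \<partial>lborel) = (\<integral>\<^sup>+z. f (cis (pi / 2) * (cis (pi / 2) * z)) \<partial>lborel)"
      by (simp only: mult.assoc)
    also have "\<dots> = (\<integral>\<^sup>+z. f (cis (pi / 2) * z) \<partial>lborel)"
      by (rule rot) (use f in \<open>auto intro!: measurable_compose[OF _ f]\<close>)
    also have "\<dots> = (\<integral>\<^sup>+z. f z \<partial>lborel)" by (rule rot) (use f in auto)
    finally show ?thesis .
  qed (rule rot[OF _ f])
qed

text \<open>This avoids polar coordinates. For each \<open>z\<close> with
  \<open>|z| < \<rho>\<close> the mean of \<open>|g(w + cis \<theta> z)|\<close> over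
  \<open>\<theta>\<close> is at least \<open>|g(w)|\<close>. Integrate over \<open>z\<close>,
  exchange the integrals, and use rotation invariance of area: the dependence on
  \<open>\<theta>\<close> disappears and leaves a factor \<open>2 * pi\<close> on both
  sides.\<close>

lemma area_mean_value:
  assumes g: "g holomorphic_on ball w R" and \<rho>: "0 < \<rho>" "\<rho> \<le> R"
  shows "ennreal (pi * \<rho>\<^sup>2) * ennreal (cmod (g w)) \<le> (\<integral>\<^sup>+z\<in>ball w \<rho>. ennreal (cmod (g z)) \<partial>lborel)"
proof -
  define \<phi> where "\<phi> z = ennreal (cmod (g (w + z))) * indicator (ball 0 \<rho>) z" for z
  have cont: "continuous_on (ball w \<rho>) g"
    using holomorphic_on_imp_continuous_on[OF g] by (rule continuous_on_subset) (use \<rho> in auto)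
  have m2: "(\<lambda>z. ennreal (cmod (g z)) * indicator (ball w \<rho>) z) \<in> borel_measurable borel"
    by (rule borel_measurable_norm_indicator[OF cont]) simp
  have \<phi>_eq: "\<phi> z = (\<lambda>z. ennreal (cmod (g z)) * indicator (ball w \<rho>) z) (w + z)" for z
    by (auto simp: \<phi>_def indicator_def dist_norm)
  have \<phi>_meas[measurable]: "\<phi> \<in> borel_measurable borel"
    unfolding \<phi>_eq[abs_def] by (rule measurable_compose[OF _ m2]) measurable
  have int_\<phi>: "(\<integral>\<^sup>+z. \<phi> z \<partial>lborel) = (\<integral>\<^sup>+z\<in>ball w \<rho>. ennreal (cmod (g z)) \<partial>lborel)"
  proof -
    have "(\<integral>\<^sup>+z\<in>ball w \<rho>. ennreal (cmod (g z)) \<partial>lborel) = (\<integral>\<^sup>+z\<in>ball w \<rho>. ennreal (cmod (g z)) \<partial>distr lborel borel ((+) w))"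
      by (simp only: lborel_distr_plus)
    also have "\<dots> = (\<integral>\<^sup>+z. \<phi> z \<partial>lborel)"
      unfolding \<phi>_eq using m2 by (intro nn_integral_distr) auto
    finally show ?thesis ..
  qed
  have circle: "ennreal (2 * pi) * (ennreal (cmod (g w)) * indicator (ball 0 \<rho>) z) \<le> (\<integral>\<^sup>+\<theta>\<in>{0..2 * pi}. \<phi> (cis \<theta> * z) \<partial>lborel)" for z
  proof (cases "z \<in> ball 0 \<rho>")
    case True
    \<comment> \<open>Carries the unit circle to the circle around \<open>w\<close> through
      \<open>w + z\<close>, whose mean is given by Cauchy's formula at the origin.\<close>
    define F where "F u = g (w + z * u)" for u
    have sub: "w + z * u \<in> ball w R" if "cmod u \<le> 1" for u
    proof -
      have "cmod z * cmod u \<le> cmod z * 1" using that by (intro mult_left_mono) auto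
      then show ?thesis using True \<rho> by (simp add: dist_norm norm_mult)
    qed
    have F1: "continuous_on (cball 0 1) F"
      unfolding F_def by (intro continuous_on_compose2[OF holomorphic_on_imp_continuous_on[OF g]] continuous_intros) (use sub in auto)
    have F2: "F holomorphic_on ball 0 1"
      unfolding F_def by (intro holomorphic_on_compose_gen[OF _ g, unfolded o_def] holomorphic_intros) (use sub in auto)
    have "((\<lambda>\<theta>. F (cis \<theta>)) has_integral (2 * pi * F 0)) {0..2 * pi}"
      using Cauchy_integral_cis[of 1 F 0] F1 F2 by simp
    moreover have "continuous_on {0..2 * pi} (\<lambda>\<theta>. F (cis \<theta>))"
      by (intro continuous_on_compose2[OF F1] continuous_intros) auto
    ultimately have "ennreal (cmod (2 * pi * F 0)) \<le> (\<integral>\<^sup>+\<theta>\<in>{0..2 * pi}. ennreal (cmod (F (cis \<theta>))) \<partial>lborel)"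
      by (rule has_integral_norm_le_nn_integral)
    then show ?thesis
      using True by (simp add: F_def \<phi>_def norm_mult ennreal_mult mult.commute)
  qed simp
  have [measurable]: "cis \<in> borel_measurable borel"
    by (intro borel_measurable_continuous_onI continuous_intros)
  have Gm: "(\<lambda>(\<theta>, z). \<phi> (cis \<theta> * z) * indicator {0..2 * pi} \<theta>) \<in> borel_measurable (lborel \<Otimes>\<^sub>M lborel)"
    by measurable
  have "ennreal (2 * pi) * (ennreal (cmod (g w)) * ennreal (pi * \<rho>\<^sup>2)) = (\<integral>\<^sup>+z. ennreal (2 * pi) * (ennreal (cmod (g w)) * indicator (ball 0 \<rho>) (z :: complex)) \<partial>lborel)"
  proof -
    have "emeasure lborel (ball (0 :: complex) \<rho>) = ennreal (pi * \<rho>\<^sup>2)"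
      using \<rho> by (subst emeasure_ball) (simp_all add: unit_ball_vol_2)
    moreover have "(\<integral>\<^sup>+z. ennreal (2 * pi) * (ennreal (cmod (g w)) * indicator (ball 0 \<rho>) (z :: complex)) \<partial>lborel) =
        ennreal (2 * pi) * (\<integral>\<^sup>+z. ennreal (cmod (g w)) * indicator (ball 0 \<rho>) (z :: complex) \<partial>lborel)"
    proof (rule nn_integral_cmult)
      have [measurable]: "ball (0 :: complex) \<rho> \<in> sets borel" by simp
      show "(\<lambda>z. ennreal (cmod (g w)) * indicator (ball 0 \<rho>) (z :: complex)) \<in> borel_measurable lborel"
        by measurable
    qed
    moreover have "(\<integral>\<^sup>+z. ennreal (cmod (g w)) * indicator (ball 0 \<rho>) (z :: complex) \<partial>lborel) =
        ennreal (cmod (g w)) * emeasure lborel (ball (0 :: complex) \<rho>)"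
      by (rule nn_integral_cmult_indicator) simp
    ultimately show ?thesis by simp
  qed
  also have "\<dots> \<le> (\<integral>\<^sup>+z. (\<integral>\<^sup>+\<theta>\<in>{0..2 * pi}. \<phi> (cis \<theta> * z) \<partial>lborel) \<partial>lborel)"
    by (intro nn_integral_mono circle)
  also have "\<dots> = (\<integral>\<^sup>+\<theta>. \<integral>\<^sup>+z. \<phi> (cis \<theta> * z) * indicator {0..2 * pi} \<theta> \<partial>lborel \<partial>lborel)"
    using lborel_pair.Fubini'[OF Gm] by simp
  also have "\<dots> = (\<integral>\<^sup>+\<theta>. (\<integral>\<^sup>+z. \<phi> z \<partial>lborel) * indicator {0..2 * pi} \<theta> \<partial>lborel)"
  proof (intro nn_integral_cong)
    fix \<theta>
    have "(\<integral>\<^sup>+z. \<phi> (cis \<theta> * z) * indicator {0..2 * pi} \<theta> \<partial>lborel) = (\<integral>\<^sup>+z. \<phi> (cis \<theta> * z) \<partial>lborel) * indicator {0..2 * pi} \<theta>"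
      by (rule nn_integral_multc) measurable
    then show "(\<integral>\<^sup>+z. \<phi> (cis \<theta> * z) * indicator {0..2 * pi} \<theta> \<partial>lborel) = (\<integral>\<^sup>+z. \<phi> z \<partial>lborel) * indicator {0..2 * pi} \<theta>"
      by (simp only: nn_integral_rotate[OF \<phi>_meas])
  qed
  also have "\<dots> = ennreal (2 * pi) * (\<integral>\<^sup>+z. \<phi> z \<partial>lborel)"
    by (simp add: nn_integral_cmult_indicator mult.commute)
  finally have "ennreal (1 / (2 * pi)) * (ennreal (2 * pi) * (ennreal (cmod (g w)) * ennreal (pi * \<rho>\<^sup>2))) \<le>
      ennreal (1 / (2 * pi)) * (ennreal (2 * pi) * (\<integral>\<^sup>+z. \<phi> z \<partial>lborel))"
    by (rule mult_left_mono) simp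
  moreover have "ennreal (1 / (2 * pi)) * (ennreal (2 * pi) * x) = x" for x
    by (simp add: mult.assoc[symmetric] ennreal_mult[symmetric])
  ultimately have "ennreal (cmod (g w)) * ennreal (pi * \<rho>\<^sup>2) \<le> (\<integral>\<^sup>+z\<in>ball w \<rho>. ennreal (cmod (g z)) \<partial>lborel)"
    by (simp only: int_\<phi>)
  then show ?thesis by (subst mult.commute)
qed

section \<open>Radial estimates and the Dirichlet space\<close>

lemma nn_integral_inverse_distance_le:
  assumes d: "0 < d"
  shows "(\<integral>\<^sup>+s. ennreal (1 / (1 - s)) * indicator {s. 2 * d / 3 < 1 - s \<and> 1 - s < 2 * d} s \<partial>lborel) \<le> 2"
proof -
  \<comment> \<open>The interval has length \<open>4 * d / 3\<close> and the integrand is at most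
    \<open>3 / (2 * d)\<close> on it, so \<open>d\<close> cancels.\<close>
  have "{s. 2 * d / 3 < 1 - s \<and> 1 - s < 2 * d} = {1 - 2 * d<..<1 - 2 * d / 3}" by auto
  then have "(\<integral>\<^sup>+s. ennreal (1 / (1 - s)) * indicator {s. 2 * d / 3 < 1 - s \<and> 1 - s < 2 * d} s \<partial>lborel) \<le>
      (\<integral>\<^sup>+s. ennreal (3 / (2 * d)) * indicator {1 - 2 * d<..<1 - 2 * d / 3} s \<partial>lborel)"
    using d by (intro nn_integral_mono) (auto simp: indicator_def field_simps intro!: ennreal_leI)
  also have "\<dots> = ennreal (3 / (2 * d)) * ennreal (4 * d / 3)"
    using d by (simp add: nn_integral_cmult_indicator algebra_simps)
  also have "\<dots> = 2" using d by (simp flip: ennreal_mult ennreal_numeral)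
  finally show ?thesis .
qed

text \<open>The area mean value on the disc of radius \<open>(1 - s) / 2\<close> about
  \<open>s\<close> bounds \<open>(1 - s) |g(s)|\<close> by \<open>4 / pi\<close> times the integral
  of \<open>|g| / (1 - s)\<close> over that disc. After exchanging the integrals, a point
  \<open>w\<close> meets only discs with \<open>1 - s\<close> comparable to \<open>1 - Re w\<close>,
  and \<open>nn_integral_inverse_distance_le\<close> contributes the factor 2. This gives
  \<open>8 / pi\<close>.\<close>

lemma Dirichlet_radial_estimate:
  assumes g: "g holomorphic_on ball 0 1"
  shows "(\<integral>\<^sup>+s\<in>{0..<1}. ennreal (1 - s) * ennreal (cmod (g (of_real s))) \<partial>lborel) \<le>
    8 * (ennreal (1 / pi) * (\<integral>\<^sup>+z\<in>ball 0 1. ennreal (cmod (g z)) \<partial>lborel))"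
proof -
  define H where "H z = ennreal (cmod (g z)) * indicator (ball 0 1) z" for z
  have [measurable]: "H \<in> borel_measurable borel"
    unfolding H_def[abs_def] by (intro borel_measurable_norm_indicator holomorphic_on_imp_continuous_on[OF g]) simp
  \<comment> \<open>No cut-off at \<open>s < 1\<close> is written: for \<open>s \<ge> 1\<close> the
    radius \<open>(1 - s) / 2\<close> is not positive, and the indicator vanishes.\<close>
  define G where "G s w = H w * (ennreal (1 / (1 - s)) * indicator {(s, w). dist (complex_of_real s) w < (1 - s) / 2} (s, w))"
    for s :: real and w
  have "{p \<in> space (lborel \<Otimes>\<^sub>M lborel). dist (complex_of_real (fst p)) (snd p) < (1 - fst p) / 2} \<in> sets (lborel \<Otimes>\<^sub>M lborel)"
    by measurable
  also have "{p \<in> space (lborel \<Otimes>\<^sub>M lborel). dist (complex_of_real (fst p)) (snd p) < (1 - fst p) / 2} =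
      {(s, w). dist (complex_of_real s) w < (1 - s) / 2}"
    by (auto simp: space_pair_measure)
  finally have [measurable]: "{(s, w). dist (complex_of_real s) w < (1 - s) / 2} \<in> sets (lborel \<Otimes>\<^sub>M lborel)" .
  have Gm: "(\<lambda>(s, w). G s w) \<in> borel_measurable (lborel \<Otimes>\<^sub>M lborel)"
    unfolding G_def by measurable
  have pt: "ennreal (1 - s) * ennreal (cmod (g (of_real s))) * indicator {0..<1} s \<le> ennreal (4 / pi) * (\<integral>\<^sup>+w. G s w \<partial>lborel)" for s
  proof (cases "s \<in> {0..<1}")
    case s: True
    define \<rho> where "\<rho> = (1 - s) / 2"
    have \<rho>: "0 < \<rho>" "\<rho> \<le> 1 - s" using s by (auto simp: \<rho>_def)
    have sub: "ball (complex_of_real s) (1 - s) \<subseteq> ball 0 1"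
      using s by (auto simp: ball_subset_ball_iff dist_norm)
    have "ennreal (pi * \<rho>\<^sup>2) * ennreal (cmod (g (of_real s))) \<le> (\<integral>\<^sup>+z\<in>ball (of_real s) \<rho>. ennreal (cmod (g z)) \<partial>lborel)"
      using g sub \<rho> by (intro area_mean_value[of g _ "1 - s"]) (auto intro: holomorphic_on_subset)
    also have "\<dots> = (\<integral>\<^sup>+w. ennreal (1 - s) * G s w \<partial>lborel)"
    proof (intro nn_integral_cong)
      fix w :: complex
      have "w \<in> ball 0 1" if "w \<in> ball (of_real s) \<rho>"
        using that sub subset_ball[OF \<rho>(2), of "complex_of_real s"] by blast
      then show "ennreal (cmod (g w)) * indicator (ball (of_real s) \<rho>) w = ennreal (1 - s) * G s w"
        using s by (auto simp: G_def H_def \<rho>_def indicator_def mult.left_commute simp flip: ennreal_mult)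
    qed
    also have "\<dots> = ennreal (1 - s) * (\<integral>\<^sup>+w. G s w \<partial>lborel)"
      by (rule nn_integral_cmult) (use Gm in measurable)
    finally have "ennreal (4 / (pi * (1 - s))) * (ennreal (pi * \<rho>\<^sup>2) * ennreal (cmod (g (of_real s)))) \<le>
      ennreal (4 / (pi * (1 - s))) * (ennreal (1 - s) * (\<integral>\<^sup>+w. G s w \<partial>lborel))"
      by (intro mult_left_mono) auto
    moreover have "4 / (pi * (1 - s)) * (pi * \<rho>\<^sup>2) = 1 - s"
      using s by (simp add: \<rho>_def power2_eq_square field_simps)
    moreover have "4 / (pi * (1 - s)) * (1 - s) = 4 / pi"
    proof -
      have "4 / (pi * u) * u = 4 / pi" if "u \<noteq> 0" for u using that by simp
      then show ?thesis using s by (metis atLeastLessThan_iff diff_eq_eq add_0 less_irrefl)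
    qed
    ultimately show ?thesis
      using s by (simp add: mult.assoc[symmetric] flip: ennreal_mult)
  qed simp
  have inner: "(\<integral>\<^sup>+s. G s w \<partial>lborel) \<le> H w * 2" for w
  proof (cases "w \<in> ball 0 1")
    case w: True
    define d where "d = 1 - Re w"
    have d: "0 < d" using w abs_Re_le_cmod[of w] by (auto simp: d_def)
    have "(\<integral>\<^sup>+s. G s w \<partial>lborel) = H w * (\<integral>\<^sup>+s. ennreal (1 / (1 - s)) * indicator {(s, w). dist (complex_of_real s) w < (1 - s) / 2} (s, w) \<partial>lborel)"
      unfolding G_def by (rule nn_integral_cmult) measurable
    also have "\<dots> \<le> H w * (\<integral>\<^sup>+s. ennreal (1 / (1 - s)) * indicator {s. 2 * d / 3 < 1 - s \<and> 1 - s < 2 * d} s \<partial>lborel)"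
    proof (intro mult_left_mono nn_integral_mono)
      fix s :: real
      \<comment> \<open>The real part of \<open>of_real s - w\<close> is \<open>d - (1 - s)\<close>.
        Its modulus is below \<open>(1 - s) / 2\<close>, so \<open>d\<close> lies strictly between
        \<open>(1 - s) / 2\<close> and \<open>3 * (1 - s) / 2\<close>.\<close>
      have "2 * d / 3 < 1 - s \<and> 1 - s < 2 * d" if "dist (complex_of_real s) w < (1 - s) / 2"
      proof -
        have "\<bar>s - Re w\<bar> < (1 - s) / 2"
          using abs_Re_le_cmod[of "of_real s - w"] that by (simp add: dist_norm)
        then have "s - Re w < (1 - s) / 2" "- (s - Re w) < (1 - s) / 2" by linarith+
        then show ?thesis unfolding d_def by (simp add: field_simps)
      qed
      then show "indicator {(s, w). dist (complex_of_real s) w < (1 - s) / 2} (s, w) \<le> (indicator {s. 2 * d / 3 < 1 - s \<and> 1 - s < 2 * d} s :: ennreal)"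
        by (auto simp: indicator_def)
    qed auto
    also have "\<dots> \<le> H w * 2"
      using nn_integral_inverse_distance_le[OF d] by (intro mult_left_mono) auto
    finally show ?thesis .
  qed (simp add: G_def H_def)
  have "(\<integral>\<^sup>+s\<in>{0..<1}. ennreal (1 - s) * ennreal (cmod (g (of_real s))) \<partial>lborel) \<le> (\<integral>\<^sup>+s. ennreal (4 / pi) * (\<integral>\<^sup>+w. G s w \<partial>lborel) \<partial>lborel)"
    by (intro nn_integral_mono pt)
  also have "\<dots> = ennreal (4 / pi) * (\<integral>\<^sup>+s. (\<integral>\<^sup>+w. G s w \<partial>lborel) \<partial>lborel)"
    by (rule nn_integral_cmult) (use lborel.borel_measurable_nn_integral[OF Gm] in simp)
  also have "(\<integral>\<^sup>+s. (\<integral>\<^sup>+w. G s w \<partial>lborel) \<partial>lborel) = (\<integral>\<^sup>+w. (\<integral>\<^sup>+s. G s w \<partial>lborel) \<partial>lborel)"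
    by (rule lborel_pair.Fubini'[OF Gm, symmetric])
  also have "ennreal (4 / pi) * \<dots> \<le> ennreal (4 / pi) * (\<integral>\<^sup>+w. H w * 2 \<partial>lborel)"
    by (intro mult_left_mono nn_integral_mono inner) auto
  also have "(\<integral>\<^sup>+w. H w * 2 \<partial>lborel) = (\<integral>\<^sup>+w. H w \<partial>lborel) * 2"
    by (rule nn_integral_multc) measurable
  also have "ennreal (4 / pi) * \<dots> = (ennreal (4 / pi) * 2) * (\<integral>\<^sup>+w. H w \<partial>lborel)"
    by (simp add: mult_ac)
  also have "ennreal (4 / pi) * 2 = 8 * ennreal (1 / pi)"
    by (simp flip: ennreal_mult ennreal_numeral)
  finally show ?thesis by (simp add: H_def mult.assoc)
qed

text \<open>Growth: the area mean value bounds \<open>f'\<close> on the segment from 0 to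
  \<open>t\<close>, and the mean value inequality bounds \<open>f(t) - f(0)\<close>. L^1 bound:
  integrate \<open>|f(t)| \<le> |f(0)| + \<integral> |f'|\<close> over \<open>t\<close>; Tonelli's
  theorem produces the weight \<open>1 - s\<close> on \<open>|f'(s)|\<close>, which
  \<open>Dirichlet_radial_estimate\<close> handles.\<close>

lemma Dirichlet_1_admissible:
  "admissible_norm (\<lambda>f. ennreal (cmod (f 0)) +
     ennreal (1 / pi) * (\<integral>\<^sup>+z\<in>ball 0 1. ennreal (cmod (deriv f z)) \<partial>lborel))"
proof
  let ?A = "\<lambda>f. ennreal (1 / pi) * (\<integral>\<^sup>+z\<in>ball 0 1. ennreal (cmod (deriv f z)) \<partial>lborel)"
  let ?N = "\<lambda>f. ennreal (cmod (f 0)) + ?A f"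
  have meas: "(\<lambda>z. ennreal (cmod (deriv f z)) * indicator (ball 0 1) z) \<in> borel_measurable borel"
    if "f holomorphic_on ball 0 1" for f
    by (intro borel_measurable_norm_indicator holomorphic_on_imp_continuous_on holomorphic_deriv that) auto
  have has_deriv: "(f has_field_derivative deriv f z) (at z)"
    if "f holomorphic_on ball 0 1" "z \<in> ball 0 1" for f z
    using that by (intro holomorphic_derivI) auto
  {
    fix f g h :: "complex \<Rightarrow> complex" and c
    assume hol: "f holomorphic_on ball 0 1" "g holomorphic_on ball 0 1" "h holomorphic_on ball 0 1"
      and eq: "\<And>z. z \<in> ball 0 1 \<Longrightarrow> f z = c * g z + h z"
    have d: "deriv f z = c * deriv g z + deriv h z" if z: "z \<in> ball 0 1" for z
    proof -
      have "((\<lambda>z. c * g z + h z) has_field_derivative (c * deriv g z + deriv h z)) (at z)"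
        by (intro DERIV_add DERIV_cmult has_deriv hol z)
      then have "(f has_field_derivative (c * deriv g z + deriv h z)) (at z)"
        by (rule has_field_derivative_transform_within_open[OF _ open_ball z]) (use eq in auto)
      then show ?thesis by (rule DERIV_imp_deriv)
    qed
    have tri: "ennreal (cmod u) \<le> ennreal (cmod c) * ennreal (cmod v) + ennreal (cmod w)" if "u = c * v + w" for u v w
      using norm_triangle_ineq[of "c * v" w] that
      by (simp add: norm_mult ennreal_leI flip: ennreal_mult ennreal_plus)
    have "(\<integral>\<^sup>+z\<in>ball 0 1. ennreal (cmod (deriv f z)) \<partial>lborel) \<le>
      (\<integral>\<^sup>+z. ennreal (cmod c) * (ennreal (cmod (deriv g z)) * indicator (ball 0 1) z) + ennreal (cmod (deriv h z)) * indicator (ball 0 1) z \<partial>lborel)"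
      using tri[OF d] by (intro nn_integral_mono) (auto simp: indicator_def)
    also have "\<dots> = ennreal (cmod c) * (\<integral>\<^sup>+z\<in>ball 0 1. ennreal (cmod (deriv g z)) \<partial>lborel) + (\<integral>\<^sup>+z\<in>ball 0 1. ennreal (cmod (deriv h z)) \<partial>lborel)"
      using meas[OF hol(2)] meas[OF hol(3)] by (simp add: nn_integral_add nn_integral_cmult)
    finally have "?A f \<le> ennreal (1 / pi) * \<dots>" by (intro mult_left_mono) auto
    also have "\<dots> = ennreal (cmod c) * ?A g + ?A h" by (simp add: distrib_left mult.left_commute)
    finally have "?N f \<le> (ennreal (cmod c) * ennreal (cmod (g 0)) + ennreal (cmod (h 0))) + (ennreal (cmod c) * ?A g + ?A h)"
      by (intro add_mono tri eq) auto
    also have "\<dots> = ennreal (cmod c) * ?N g + ?N h" by (simp add: distrib_left add_ac)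
    finally show "?N f \<le> ennreal (cmod c) * ?N g + ?N h" .
  next
    fix d :: "nat \<Rightarrow> complex" and f
    assume d: "summable (\<lambda>n. real (n + 1) * cmod (d n))"
      and f: "\<And>z. z \<in> ball 0 1 \<Longrightarrow> (\<lambda>n. d n * z ^ n) sums f z"
    let ?S = "\<Sum>n. real (n + 1) * cmod (d n)"
    have S: "0 \<le> ?S" using d by (intro suminf_nonneg) auto
    \<comment> \<open>The weight \<open>n + 1\<close> in the hypothesis is what bounds the
      derivative uniformly on the disc.\<close>
    have d_bound: "cmod (deriv f z) \<le> ?S" if z: "z \<in> ball 0 1" for z
    proof -
      have "((\<lambda>z. \<Sum>n. d n * z ^ n) has_field_derivative (\<Sum>n. diffs d n * z ^ n)) (at z)"
        using f z by (intro termdiffs_strong'[of 1]) (auto simp: sums_iff)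
      then have "(f has_field_derivative (\<Sum>n. diffs d n * z ^ n)) (at z)"
        by (rule has_field_derivative_transform_within_open[OF _ open_ball z]) (use f in \<open>auto simp: sums_iff\<close>)
      then have eq: "deriv f z = (\<Sum>n. diffs d n * z ^ n)" by (rule DERIV_imp_deriv)
      have d1: "summable (\<lambda>n. real (Suc n + 1) * cmod (d (Suc n)))"
        using d by (subst summable_Suc_iff)
      have le: "norm (diffs d n * z ^ n) \<le> real (Suc n + 1) * cmod (d (Suc n))" for n
      proof -
        have "norm (diffs d n * z ^ n) = (real (Suc n) * cmod (d (Suc n))) * cmod z ^ n"
          by (simp add: diffs_def norm_mult norm_power del: of_nat_Suc)
        also have "\<dots> \<le> (real (Suc n + 1) * cmod (d (Suc n))) * 1"
          using z by (intro mult_mono power_le_one) auto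
        finally show ?thesis by simp
      qed
      have s: "summable (\<lambda>n. norm (diffs d n * z ^ n))"
        by (rule summable_comparison_test'[OF d1, where N = 0]) (use le in simp)
      have "cmod (deriv f z) \<le> (\<Sum>n. norm (diffs d n * z ^ n))"
        unfolding eq by (rule summable_norm[OF s])
      also have "\<dots> \<le> (\<Sum>n. real (Suc n + 1) * cmod (d (Suc n)))" by (intro suminf_le le s d1)
      also have "\<dots> \<le> ?S" using suminf_split_head[OF d] by simp
      finally show ?thesis .
    qed
    have "(\<integral>\<^sup>+z\<in>ball 0 1. ennreal (cmod (deriv f z)) \<partial>lborel) \<le> (\<integral>\<^sup>+z. ennreal ?S * indicator (ball 0 1) (z :: complex) \<partial>lborel)"
      using d_bound by (intro nn_integral_mono) (auto simp: indicator_def intro: ennreal_leI)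
    also have "\<dots> = ennreal ?S * ennreal pi"
      by (simp add: nn_integral_cmult_indicator emeasure_ball unit_ball_vol_2)
    finally have "?A f \<le> ennreal (1 / pi) * (ennreal ?S * ennreal pi)" by (intro mult_left_mono) auto
    also have "\<dots> = ennreal ?S" using S by (simp flip: ennreal_mult)
    \<comment> \<open>One copy of \<open>?S\<close> bounds the value at the origin, the other the
      area term, since the disc has normalized area 1; hence the factor 2 in
      \<open>series\<close>.\<close>
    finally have "?N f \<le> ennreal ?S + ennreal ?S"
      using power_series_norm_le[OF d f[of 0]] by (intro add_mono ennreal_leI) auto
    also have "\<dots> = ennreal (2 * ?S)" using S by (simp flip: ennreal_plus)
    finally show "?N f \<le> ennreal (2 * ?S)" .
  next
    fix f :: "complex \<Rightarrow> complex" and t :: real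
    assume hol: "f holomorphic_on ball 0 1" and t: "t \<in> {0..<1}"
    show "ennreal (cmod (f (of_real t))) \<le> ennreal (4 / (1 - t)\<^sup>2) * ?N f"
    proof (cases "?A f = \<infinity>")
      case True
      then show ?thesis using t by (simp add: ennreal_mult_top distrib_left)
    next
      case False
      define a where "a = enn2real (?A f)"
      have a: "?A f = ennreal a" "0 \<le> a" using False by (auto simp: a_def less_top)
      have d_bound: "cmod (deriv f (of_real s)) \<le> 4 / (1 - t)\<^sup>2 * a" if s: "s \<in> {0..t}" for s
      proof -
        \<comment> \<open>The radius depends on \<open>t\<close> and not on \<open>s\<close>, so a
          single bound holds along the segment. Its inverse square
          \<open>4 / (1 - t)\<^sup>2\<close> is the constant of \<open>radial_bound\<close>.\<close>
        define \<rho> where "\<rho> = (1 - t) / 2"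
        have \<rho>: "0 < \<rho>" "\<rho> \<le> 1 - s" using s t by (auto simp: \<rho>_def)
        have sub: "ball (complex_of_real s) (1 - s) \<subseteq> ball 0 1"
          using s t by (auto simp: ball_subset_ball_iff dist_norm)
        have "ennreal (pi * \<rho>\<^sup>2) * ennreal (cmod (deriv f (of_real s))) \<le> (\<integral>\<^sup>+z\<in>ball (of_real s) \<rho>. ennreal (cmod (deriv f z)) \<partial>lborel)"
          using sub \<rho> by (intro area_mean_value[of "deriv f" _ "1 - s"] holomorphic_on_subset[OF holomorphic_deriv[OF hol]]) auto
        also have "\<dots> \<le> (\<integral>\<^sup>+z\<in>ball 0 1. ennreal (cmod (deriv f z)) \<partial>lborel)"
        proof -
          have "ball (complex_of_real s) \<rho> \<subseteq> ball 0 1" using sub \<rho> by (meson order_trans subset_ball)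
          then show ?thesis by (intro nn_integral_mono) (auto simp: indicator_def)
        qed
        finally have "ennreal (1 / pi) * (ennreal (pi * \<rho>\<^sup>2) * ennreal (cmod (deriv f (of_real s)))) \<le> ennreal a"
          unfolding a(1)[symmetric] by (intro mult_left_mono) auto
        then have "ennreal (\<rho>\<^sup>2 * cmod (deriv f (of_real s))) \<le> ennreal a"
          by (simp add: mult.assoc[symmetric] flip: ennreal_mult)
        then have "\<rho>\<^sup>2 * cmod (deriv f (of_real s)) \<le> a" using a(2) by simp
        then show ?thesis using t by (simp add: \<rho>_def field_simps)
      qed
      have "cmod (f (of_real t) - f 0) \<le> 4 / (1 - t)\<^sup>2 * a * cmod (of_real t - 0)"
      proof (rule field_differentiable_bound[where S = "closed_segment 0 (complex_of_real t)" and f' = "deriv f"])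
        have seg: "\<exists>s\<in>{0..t}. z = of_real s" if z: "z \<in> closed_segment 0 (complex_of_real t)" for z
        proof -
          obtain u where "0 \<le> u" "u \<le> 1" "z = u *\<^sub>R complex_of_real t"
            using z by (auto simp: in_segment)
          then show ?thesis using t by (intro bexI[of _ "u * t"]) (auto simp: scaleR_conv_of_real mult_left_le_one_le)
        qed
        show "(f has_field_derivative deriv f z) (at z within closed_segment 0 (complex_of_real t))"
          if z: "z \<in> closed_segment 0 (complex_of_real t)" for z
        proof -
          obtain s where "s \<in> {0..t}" "z = of_real s" using seg[OF z] by blast
          then show ?thesis using t by (intro has_field_derivative_at_within[OF has_deriv[OF hol]]) auto
        qed
        show "cmod (deriv f z) \<le> 4 / (1 - t)\<^sup>2 * a" if z: "z \<in> closed_segment 0 (complex_of_real t)" for z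
        proof -
          obtain s where "s \<in> {0..t}" "z = of_real s" using seg[OF z] by blast
          then show ?thesis using d_bound by blast
        qed
      qed auto
      also have "\<dots> \<le> 4 / (1 - t)\<^sup>2 * a * 1" using t a by (intro mult_left_mono) auto
      finally have "cmod (f (of_real t) - f 0) \<le> 4 / (1 - t)\<^sup>2 * a" by simp
      moreover have "1 * cmod (f 0) \<le> 4 / (1 - t)\<^sup>2 * cmod (f 0)"
      proof (rule mult_right_mono)
        have "1 \<le> 1 / (1 - t)" using t by simp
        then show "1 \<le> 4 / (1 - t)\<^sup>2" using divide_one_minus_le[OF t, of 1] by simp
      qed simp
      ultimately have "cmod (f (of_real t)) \<le> 4 / (1 - t)\<^sup>2 * (cmod (f 0) + a)"
        using norm_triangle_ineq2[of "f (of_real t)" "f 0"] by (simp add: distrib_left)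
      then have "ennreal (cmod (f (of_real t))) \<le> ennreal (4 / (1 - t)\<^sup>2 * (cmod (f 0) + a))" by (rule ennreal_leI)
      also have "\<dots> = ennreal (4 / (1 - t)\<^sup>2) * ?N f"
        unfolding a(1) using a(2) by (subst ennreal_mult) (simp_all add: ennreal_plus)
      finally show ?thesis .
    qed
  next
    fix f :: "complex \<Rightarrow> complex"
    assume hol: "f holomorphic_on ball 0 1"
    define E where "E s = ennreal (cmod (deriv f (of_real s))) * indicator {0..<1} s" for s :: real
    have cont: "continuous_on {0..<1} (\<lambda>s. deriv f (complex_of_real s))"
      by (intro continuous_on_compose2[OF holomorphic_on_imp_continuous_on[OF holomorphic_deriv[OF hol]]] continuous_intros) auto
    then have [measurable]: "E \<in> borel_measurable borel"
      unfolding E_def[abs_def] by (rule borel_measurable_norm_indicator) simp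
    \<comment> \<open>The triangle \<open>s \<le> t\<close> is written as an indicator on the plane
      for Tonelli's theorem. Integrating over \<open>t\<close> first leaves the length
      \<open>1 - s\<close> of \<open>[s, 1)\<close>.\<close>
    define G where "G t s = E s * (indicator {0..<1} t * indicator {(t, s). s \<le> t} (t, s))" for t s :: real
    have [measurable]: "{(t :: real, s). s \<le> t} \<in> sets (lborel \<Otimes>\<^sub>M lborel)"
    proof -
      have "{p \<in> space (lborel \<Otimes>\<^sub>M lborel). snd p \<le> (fst p :: real)} \<in> sets (lborel \<Otimes>\<^sub>M lborel)"
        by measurable
      also have "{p \<in> space (lborel \<Otimes>\<^sub>M lborel). snd p \<le> (fst p :: real)} = {(t, s). s \<le> t}"
        by (auto simp: space_pair_measure)
      finally show ?thesis .
    qed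
    have Gm: "(\<lambda>(t, s). G t s) \<in> borel_measurable (lborel \<Otimes>\<^sub>M lborel)"
      unfolding G_def by measurable
    have pt: "ennreal (cmod (f (of_real t))) * indicator {0..<1} t \<le> ennreal (cmod (f 0)) * indicator {0..<1} t + (\<integral>\<^sup>+s. G t s \<partial>lborel)" for t :: real
    proof (cases "t \<in> {0..<1}")
      case t: True
      have "((\<lambda>s. deriv f (of_real s)) has_integral (f (of_real t) - f (of_real 0))) {0..t}"
      proof (rule fundamental_theorem_of_calculus)
        fix s assume s: "s \<in> {0..t}"
        then have "(f has_field_derivative deriv f (of_real s)) (at (of_real s))"
          using t by (intro has_deriv hol) auto
        then have "((\<lambda>s. f (of_real s)) has_vector_derivative deriv f (of_real s)) (at s)"
          by (rule has_vector_derivative_real_field)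
        then show "((\<lambda>s. f (of_real s)) has_vector_derivative deriv f (of_real s)) (at s within {0..t})"
          by (rule has_vector_derivative_at_within)
      qed (use t in auto)
      then have "ennreal (cmod (f (of_real t) - f (of_real 0))) \<le> (\<integral>\<^sup>+s\<in>{0..t}. ennreal (cmod (deriv f (of_real s))) \<partial>lborel)"
        by (rule has_integral_norm_le_nn_integral) (use t in \<open>auto intro: continuous_on_subset[OF cont]\<close>)
      also have "\<dots> \<le> (\<integral>\<^sup>+s. G t s \<partial>lborel)"
        using t by (intro nn_integral_mono) (auto simp: G_def E_def indicator_def)
      finally have "ennreal (cmod (f 0)) + ennreal (cmod (f (of_real t) - f 0)) \<le> ennreal (cmod (f 0)) + (\<integral>\<^sup>+s. G t s \<partial>lborel)"
        by (intro add_left_mono) simp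
      then have "ennreal (cmod (f (of_real t))) \<le> ennreal (cmod (f 0)) + (\<integral>\<^sup>+s. G t s \<partial>lborel)"
      proof (rule order_trans[rotated])
        show "ennreal (cmod (f (of_real t))) \<le> ennreal (cmod (f 0)) + ennreal (cmod (f (of_real t) - f 0))"
          using norm_triangle_ineq[of "f 0" "f (of_real t) - f 0"] by (simp add: ennreal_leI flip: ennreal_plus)
      qed
      then show ?thesis using t by simp
    qed simp
    have inner: "(\<integral>\<^sup>+t. G t s \<partial>lborel) = ennreal (1 - s) * ennreal (cmod (deriv f (of_real s))) * indicator {0..<1} s" for s
    proof -
      have "(\<integral>\<^sup>+t. G t s \<partial>lborel) = E s * (\<integral>\<^sup>+t. indicator {0..<1} t * indicator {(t, s). s \<le> t} (t, s) \<partial>lborel)"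
        unfolding G_def by (rule nn_integral_cmult) measurable
      also have "\<dots> = E s * ennreal (1 - s)"
      proof (cases "s \<in> {0..<1}")
        case True
        then have "indicator {0..<1} t * indicator {(t, s). s \<le> t} (t, s) = (indicator {s..<1} t :: ennreal)" for t
          by (auto simp: indicator_def)
        then show ?thesis using True by simp
      qed (simp add: E_def)
      finally show ?thesis by (simp add: E_def mult_ac)
    qed
    have "L1_norm (radius_restrict f) \<le> (\<integral>\<^sup>+t. ennreal (cmod (f 0)) * indicator {0..<1} t + (\<integral>\<^sup>+s. G t s \<partial>lborel) \<partial>lborel)"
      unfolding L1_norm_def nn_integral_completion radius_restrict_def by (intro nn_integral_mono pt)
    also have "\<dots> = (\<integral>\<^sup>+t. ennreal (cmod (f 0)) * indicator {0..<1} (t :: real) \<partial>lborel) + (\<integral>\<^sup>+t. (\<integral>\<^sup>+s. G t s \<partial>lborel) \<partial>lborel)"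
      by (rule nn_integral_add) (use lborel.borel_measurable_nn_integral[OF Gm] in auto)
    also have "(\<integral>\<^sup>+t. (\<integral>\<^sup>+s. G t s \<partial>lborel) \<partial>lborel) = (\<integral>\<^sup>+s. (\<integral>\<^sup>+t. G t s \<partial>lborel) \<partial>lborel)"
      by (rule lborel_pair.Fubini'[OF Gm, symmetric])
    also have "\<dots> \<le> 8 * ?A f"
      unfolding inner by (rule Dirichlet_radial_estimate[OF holomorphic_deriv[OF hol open_ball]])
    also have "(\<integral>\<^sup>+t. ennreal (cmod (f 0)) * indicator {0..<1} (t :: real) \<partial>lborel) = ennreal (cmod (f 0))"
      by (simp add: nn_integral_cmult_indicator)
    also have "ennreal (cmod (f 0)) + 8 * ?A f \<le> 8 * ennreal (cmod (f 0)) + 8 * ?A f"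
      by (intro add_right_mono ennreal_le_8_mult)
    also have "\<dots> = 8 * ?N f" by (rule distrib_left[symmetric])
    finally show "L1_norm (radius_restrict f) \<le> 8 * ?N f" by simp
  }
qed

theorem corollary23:
  fixes X\<^sub>1 Y\<^sub>1 :: "(complex \<Rightarrow> complex) nspace"
    and \<nu> :: "real \<Rightarrow> real"
    and Q :: "(real \<Rightarrow> complex) \<Rightarrow> (complex \<Rightarrow> complex) option"
  assumes "X\<^sub>1 \<in> {H_inf_1, Hardy_1, Dirichlet_1, Hardy_Littlewood_1}"
    and "Y\<^sub>1 \<in> {H_inf_1, Hardy_1, Dirichlet_1, Hardy_Littlewood_1}"
    and "radial_weight \<nu>"
    and "Q \<in> {hilbert_op \<nu>, hilbert_abs_op \<nu>}"
    and "bounded_op L1_space Y\<^sub>1 Q"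
  shows "\<exists>\<omega>. radial_weight \<omega> \<and>
           comparable_on {0..<1} (weight_hat \<omega>) (weight_hat \<nu>) \<and>
           (\<forall>r\<^sub>0\<in>{0<..<1}. ess_bounded_on {0..r\<^sub>0} \<omega>) \<and>
           (\<forall>T\<in>{hilbert_op \<omega>, hilbert_abs_op \<omega>}.
              bounded_op X\<^sub>1 Y\<^sub>1 (\<lambda>f. T (radius_restrict f)) \<and>
              \<not> bounded_op L1_space Y\<^sub>1 T)"
proof -
  have adm: "\<exists>N. admissible_norm N \<and> Z = analytic_space N"
    if "Z \<in> {H_inf_1, Hardy_1, Dirichlet_1, Hardy_Littlewood_1}" for Z
    using that H_inf_1_admissible Hardy_1_admissible Dirichlet_1_admissible Hardy_Littlewood_1_admissible
    unfolding H_inf_1_def Hardy_1_def Dirichlet_1_def Hardy_Littlewood_1_def by blast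
  obtain NX NY where "admissible_norm NX" "X\<^sub>1 = analytic_space NX" "admissible_norm NY" "Y\<^sub>1 = analytic_space NY"
    using adm[OF assms(1)] adm[OF assms(2)] by blast
  then show ?thesis
    using exists_perturbed_weight[of NX NY \<nu> Q] assms(3-5) by simp
qed

end
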